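(* Let $n\ge 1$ and $0\le \delta<1$, and put $$\mathcal{K}=\lfloor n/2\rfloor+1,\qquad \mathcal{N}=\Big\lfloor \frac{2n}{1-\delta}\Big\rfloor+1 .$$ Suppose that $\sigma:\mathbb{R}^n\times\mathbb{N}_0^n\to\mathbb{C}$ belongs to the class $\mathcal{S}^{0,\mathcal{K},\mathcal{N}}_{1,\delta}$, that is, $\sigma(\cdot,\xi)\in C^{\mathcal{N}}(\mathbb{R}^n)$ for each $\xi\in\mathbb{N}_0^n$, and for all multi-indices $\nu,\kappa\in\mathbb{N}_0^n$ with $0\le|\nu|\le\mathcal{N}$ and $0\le|\kappa|\le\mathcal{K}$ there is a constant $C_{\nu,\kappa}>0$ such that $$|\partial_x^\nu\triangle_\xi^\kappa\sigma(x,\xi)|\le C_{\nu,\kappa}\,\langle\xi\rangle^{-|\kappa|+\frac{\delta}{2}|\nu|}\qquad\text{for all }(x,\xi)\in\mathbb{R}^n\times\mathbb{N}_0^n .$$ Then the Hermite pseudo-multiplier $\sigma(\cdot,\mathcal{L})$ extends to a bounded operator on $L^2(\mathbb{R}^n)$.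
   Context: $\mathbb{N}_0=\{0,1,2,\dots\}$; for $\xi\in\mathbb{N}_0^n$, $|\xi|=\xi_1+\dots+\xi_n$ and $\langle\xi\rangle=1+|\xi|$. Hermite functions: for $k\in\mathbb{N}_0$, $H_k(t)=(-1)^k e^{t^2}\partial_t^k(e^{-t^2})$ and $h_k(t)=(2^kk!\sqrt{\pi})^{-1/2}H_k(t)e^{-t^2/2}$, $t\in\mathbb{R}$; for $\xi\in\mathbb{N}_0^n$, $h_\xi(x)=\prod_{j=1}^n h_{\xi_j}(x_j)$, $x\in\mathbb{R}^n$. The family $\{h_\xi\}_{\xi\in\mathbb{N}_0^n}$ is an orthonormal basis of $L^2(\mathbb{R}^n)$ of eigenfunctions of $\mathcal{L}=-\Delta+|x|^2$. Finite differences: for $g$ defined on $\mathbb{N}_0^n$, $\triangle_i g(\xi)=g(\xi+e_i)-g(\xi)$ ($e_i$ the $i$-th standard basis vector), $\triangle_i^\ell g=\triangle_i(\triangle_i^{\ell-1}g)$ for $\ell\ge2$, and $\triangle_\xi^\kappa=\triangle_1^{\kappa_1}\cdots\triangle_n^{\kappa_n}$, acting in the variable $\xi$. Hermite pseudo-multiplier with symbol $\sigma$: $\sigma(x,\mathcal{L})f(x)=\sum_{\xi\in\mathbb{N}_0^n}\sigma(x,\xi)\langle f,h_\xi\rangle h_\xi(x)$, where $\langle f,h_\xi\rangle=\int_{\mathbb{R}^n}f h_\xi\,dx$; it is initially defined on finite linear combinations of Hermite functions. *)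

theory Defs
  imports "HOL-Analysis.Analysis"
begin

text \<open>
  The space $R^n$ is \<^typ>\<open>real^'n\<close>, with \<open>n = CARD('n)\<close>; multi-indices, and the frequency
  variable \<open>\<xi>\<close>, are elements of \<^typ>\<open>nat^'n\<close>.
\<close>

definition msize :: "nat^'n \<Rightarrow> nat" where
  "msize \<xi> = (\<Sum>i\<in>UNIV. \<xi> $ i)"

definition jbracket :: "nat^'n \<Rightarrow> real" where
  "jbracket \<xi> = 1 + real (msize \<xi>)"

text \<open>
  The finite type \<open>'n\<close> carries no order, so one fixed enumeration of it plays the role of
  \<open>1, \<dots>, n\<close>. It only determines in which order the coordinate operators \<open>D\<^sub>i\<close> are composed in
  $D^\kappa = D_1^{\kappa_1} \cdots D_n^{\kappa_n}$.
\<close>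

definition coords :: "'n::finite list" where
  "coords = (SOME is. distinct is \<and> set is = UNIV)"

lemma coords: "distinct (coords :: 'n::finite list)" "set (coords :: 'n list) = UNIV"
proof -
  have "\<exists>is :: 'n list. distinct is \<and> set is = UNIV"
    using finite_distinct_list[of "UNIV :: 'n set"] by auto
  then have "distinct (coords :: 'n list) \<and> set (coords :: 'n list) = UNIV"
    unfolding coords_def by (rule someI_ex)
  then show "distinct (coords :: 'n list)" "set (coords :: 'n list) = UNIV"
    by auto
qed

definition multi_power :: "('n \<Rightarrow> 'a \<Rightarrow> 'a) \<Rightarrow> nat^'n \<Rightarrow> 'a \<Rightarrow> 'a" where
  "multi_power D \<kappa> = foldr (\<lambda>i. D i ^^ (\<kappa> $ i)) coords"

definition fdiff :: "'n \<Rightarrow> (nat^'n \<Rightarrow> complex) \<Rightarrow> nat^'n \<Rightarrow> complex" where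
  "fdiff i g \<xi> = g (\<xi> + axis i 1) - g \<xi>"

abbreviation mdiff :: "nat^'n \<Rightarrow> (nat^'n \<Rightarrow> complex) \<Rightarrow> nat^'n \<Rightarrow> complex" where
  "mdiff \<equiv> multi_power fdiff"

definition pderiv_at :: "'n \<Rightarrow> (real^'n \<Rightarrow> complex) \<Rightarrow> real^'n \<Rightarrow> complex" where
  "pderiv_at i f x = vector_derivative (\<lambda>t. f (x + t *\<^sub>R axis i 1)) (at 0)"

abbreviation mderiv :: "nat^'n \<Rightarrow> (real^'n \<Rightarrow> complex) \<Rightarrow> real^'n \<Rightarrow> complex" where
  "mderiv \<equiv> multi_power pderiv_at"

text \<open>
  \<open>Ck k f\<close>: all iterated partial derivatives of \<open>f\<close> of order at most \<open>k\<close>, taken in any order,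
  exist and are continuous on the whole space.
\<close>

primrec Ck :: "nat \<Rightarrow> (real^'n \<Rightarrow> complex) \<Rightarrow> bool" where
  "Ck 0 f \<longleftrightarrow> continuous_on UNIV f"
| "Ck (Suc k) f \<longleftrightarrow> continuous_on UNIV f \<and>
     (\<forall>i. (\<forall>x. (\<lambda>t. f (x + t *\<^sub>R axis i 1)) differentiable (at 0)) \<and> Ck k (pderiv_at i f))"

text \<open>
  The class $S^{0,K,N}_{1,\delta}$: \<open>K\<close> bounds the order of the differences in \<open>\<xi>\<close>, and
  \<open>N\<close> the order of the derivatives in \<open>x\<close>.
\<close>

definition symbol_class ::
    "real \<Rightarrow> nat \<Rightarrow> nat \<Rightarrow> (real^'n \<Rightarrow> nat^'n \<Rightarrow> complex) set" where
  "symbol_class \<delta> K N = {\<sigma>.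
     (\<forall>\<xi>. Ck N (\<lambda>x. \<sigma> x \<xi>)) \<and>
     (\<forall>\<nu> \<kappa>. msize \<nu> \<le> N \<longrightarrow> msize \<kappa> \<le> K \<longrightarrow>
        (\<exists>C>0. \<forall>x \<xi>. cmod (mderiv \<nu> (\<lambda>y. mdiff \<kappa> (\<sigma> y) \<xi>) x)
            \<le> C * jbracket \<xi> powr (- real (msize \<kappa>) + \<delta> / 2 * real (msize \<nu>))))}"

definition hermite_poly :: "nat \<Rightarrow> real \<Rightarrow> real" where
  "hermite_poly k t = (-1) ^ k * exp (t\<^sup>2) * (deriv ^^ k) (\<lambda>s. exp (- s\<^sup>2)) t"

definition hermite1 :: "nat \<Rightarrow> real \<Rightarrow> real" where
  "hermite1 k t =
     (2 ^ k * fact k * sqrt pi) powr (- 1 / 2) * hermite_poly k t * exp (- t\<^sup>2 / 2)"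

definition hermite :: "nat^'n \<Rightarrow> real^'n \<Rightarrow> real" where
  "hermite \<xi> x = (\<Prod>j\<in>UNIV. hermite1 (\<xi> $ j) (x $ j))"

definition hermite_coeff :: "(real^'n \<Rightarrow> complex) \<Rightarrow> nat^'n \<Rightarrow> complex" where
  "hermite_coeff f \<xi> = (LINT x|lborel. f x * complex_of_real (hermite \<xi> x))"

definition hermite_span :: "(real^'n \<Rightarrow> complex) set" where
  "hermite_span = {f. \<exists>S c. finite S \<and>
     f = (\<lambda>x. \<Sum>\<xi>\<in>S. c \<xi> * complex_of_real (hermite \<xi> x))}"

text \<open>For \<open>f\<close> in \<^const>\<open>hermite_span\<close> only finitely many terms of the sum are nonzero.\<close>

definition pseudo_multiplier ::
    "(real^'n \<Rightarrow> nat^'n \<Rightarrow> complex) \<Rightarrow> (real^'n \<Rightarrow> complex) \<Rightarrow> real^'n \<Rightarrow> complex" where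
  "pseudo_multiplier \<sigma> f x =
     (\<Sum>\<^sub>\<infinity>\<xi>\<in>UNIV. \<sigma> x \<xi> * hermite_coeff f \<xi> * complex_of_real (hermite \<xi> x))"

text \<open>
  Elements of $L^2(R^n)$ are represented by square-integrable Borel functions; equality in
  $L^2$ is equality almost everywhere.
\<close>

definition L2 :: "(real^'n \<Rightarrow> complex) set" where
  "L2 = {f. f \<in> borel_measurable lborel \<and> integrable lborel (\<lambda>x. (cmod (f x))\<^sup>2)}"

definition L2_norm :: "(real^'n \<Rightarrow> complex) \<Rightarrow> real" where
  "L2_norm f = sqrt (LINT x|lborel. (cmod (f x))\<^sup>2)"

definition bounded_L2_operator ::
    "((real^'n \<Rightarrow> complex) \<Rightarrow> (real^'n \<Rightarrow> complex)) \<Rightarrow> bool" where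
  "bounded_L2_operator T \<longleftrightarrow>
     (\<forall>f\<in>L2. T f \<in> L2) \<and>
     (\<forall>f\<in>L2. \<forall>g\<in>L2. (AE x in lborel. f x = g x) \<longrightarrow> (AE x in lborel. T f x = T g x)) \<and>
     (\<forall>f\<in>L2. \<forall>g\<in>L2. \<forall>a b.
        AE x in lborel. T (\<lambda>y. a * f y + b * g y) x = a * T f x + b * T g x) \<and>
     (\<exists>C. \<forall>f\<in>L2. L2_norm (T f) \<le> C * L2_norm f)"

end

theory Submission
  imports Defs "HOL-Probability.Sinc_Integral"
begin

text \<open>
  The frequencies are cut into the dyadic blocks \<open>4^k \<le> 1 + |\<xi>| < 4^(k+1)\<close>, and the operator
  into the corresponding pieces \<open>T_k\<close>. Two estimates carry the proof: the pieces are bounded on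
  \<open>L^2\<close> uniformly in \<open>k\<close> (lemma \<open>dyadic_bound\<close>), and two different pieces map to nearly
  orthogonal functions (lemma \<open>inner_block_le\<close>): for \<open>j \<le> k\<close> the inner product of \<open>T_j f\<close> and
  \<open>T_k g\<close> gains the factor \<open>2^((\<delta>-1)(k-j))\<close>. As \<open>\<delta> < 1\<close>, summing these geometric factors
  (Schur's test) bounds the operator on finite sums of Hermite functions (lemma \<open>op_bound\<close>).

  Uniform boundedness of one piece. For fixed \<open>x\<close> the piece integrates \<open>f\<close> against the kernel
  \<open>G(y) = \<Sum>\<xi>. a(\<xi>) h\<^sub>\<xi>(x) h\<^sub>\<xi>(y)\<close>, where \<open>a\<close> is the symbol times a cutoff to the block.
  Multiplying \<open>G\<close> by \<open>y\<^sub>i - x\<^sub>i\<close> either replaces \<open>a\<close> by its difference in direction \<open>i\<close>, at the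
  price of one creation operator, or removes a creation operator. A creation operator costs
  \<open>2^k\<close> and a difference gains \<open>4^(-k)\<close>, so each factor \<open>y\<^sub>i - x\<^sub>i\<close> gains \<open>2^(-k)\<close> (lemma
  \<open>sqn_weighted_kernel_sum_le\<close>). By orthonormality in \<open>y\<close> and the bound \<open>O(2^(kn))\<close> for the sum
  of \<open>h\<^sub>\<xi>(x)^2\<close> over the block, the function \<open>(1 + 2^k |x - y|)^K G(y)\<close> has squared \<open>L^2\<close> norm
  \<open>O(2^(kn))\<close>. As \<open>2K > n\<close> for \<open>K = \<lfloor>n/2\<rfloor> + 1\<close>, the weight \<open>(1 + 2^k |x - y|)^(-2K)\<close> has
  integral \<open>O(2^(-kn))\<close>, and the Cauchy-Schwarz inequality followed by an integration in \<open>x\<close>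
  bounds the piece.

  Near orthogonality. Let \<open>A\<^sub>i = -\<partial>\<^sub>i + x\<^sub>i\<close>, with adjoint \<open>\<partial>\<^sub>i + x\<^sub>i\<close>. Since the sum of all
  \<open>A\<^sub>i A\<^sub>i\<^sup>*\<close> multiplies \<open>h\<^sub>\<xi>\<close> by \<open>2|\<xi>|\<close>, the function \<open>g\<close> in the higher block is a sum of
  \<open>A\<^sub>i g\<^sub>i\<close> with \<open>g\<^sub>i\<close> smaller by \<open>2^(-k)\<close>. Integration by parts moves \<open>A\<^sub>i\<close> to the lower piece,
  where it costs \<open>2^j\<close>; the commutator of \<open>A\<^sub>i\<close> with the symbol is a derivative of the symbol in
  \<open>x\<close>, which costs \<open>2^(\<delta>k)\<close>. In total the inner product gains \<open>2^(j-k) + 2^((\<delta>-1)k)\<close>. This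
  argument compares the two outputs directly and never expands them in Hermite functions.

  Extension. For a general \<open>f\<close> in \<open>L^2\<close> the operator is applied to the truncated sequence of
  Hermite coefficients of \<open>f\<close>. By Bessel's inequality and the bound just described, the results
  form a Cauchy sequence, and the extension maps \<open>f\<close> to its limit.
\<close>

section \<open>Integrating a directional derivative\<close>

lemma one_plus_square_pos [simp]: "0 < 1 + (t::real)\<^sup>2"
  by (rule add_pos_nonneg) auto

lemma integrable_translate:
  fixes w :: "'a::euclidean_space \<Rightarrow> 'b::{banach,second_countable_topology}"
  assumes "integrable lborel w"
  shows "integrable lborel (\<lambda>x. w (x + c))" "(\<integral>x. w (x + c) \<partial>lborel) = integral\<^sup>L lborel w"
proof -
  have w: "integrable (distr lborel borel ((+) c)) w"
    using assms by (simp add: lborel_distr_plus)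
  have m: "(+) c \<in> lborel \<rightarrow>\<^sub>M borel" by measurable
  show "integrable lborel (\<lambda>x. w (x + c))"
    using integrable_distr[OF m w] by (simp add: add.commute)
  have "integral\<^sup>L (distr lborel borel ((+) c)) w = (\<integral>x. w (c + x) \<partial>lborel)"
    by (rule integral_distr[OF m]) (use assms in auto)
  then show "(\<integral>x. w (x + c) \<partial>lborel) = integral\<^sup>L lborel w"
    by (simp add: lborel_distr_plus add.commute)
qed

text \<open>
  By translation invariance every difference quotient of \<open>w\<close> has integral zero, and dominated
  convergence passes this on to the derivative.
\<close>

lemma integral_directional_derivative:
  fixes w w' :: "'a::euclidean_space \<Rightarrow> 'b::{banach,second_countable_topology}"
  assumes w: "integrable lborel w"
    and deriv: "\<And>x. ((\<lambda>t. w (x + t *\<^sub>R b)) has_vector_derivative w' x) (at 0)"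
    and bound: "\<And>x s. 0 \<le> s \<Longrightarrow> s \<le> 1 \<Longrightarrow> norm (w' (x + s *\<^sub>R b)) \<le> g x"
    and g: "integrable lborel g"
  shows "(\<integral>x. w' x \<partial>lborel) = 0"
proof -
  define e where "e n = 1 / real (Suc n)" for n
  have e: "0 < e n" "e n \<le> 1" for n by (auto simp: e_def)
  define q where "q n x = (1 / e n) *\<^sub>R (w (x + e n *\<^sub>R b) - w x)" for n x
  have [measurable]: "w \<in> borel_measurable borel" using w by auto
  have deriv': "((\<lambda>t. w (x + t *\<^sub>R b)) has_vector_derivative w' (x + s *\<^sub>R b)) (at s)" for x s
  proof -
    have "((\<lambda>t. w ((x + s *\<^sub>R b) + t *\<^sub>R b)) has_vector_derivative w' (x + s *\<^sub>R b)) (at 0)"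
      by (rule deriv)
    moreover have "((\<lambda>t. t - s) has_vector_derivative 1) (at s)"
      by (auto intro!: derivative_eq_intros)
    ultimately have "((\<lambda>t. w ((x + s *\<^sub>R b) + t *\<^sub>R b)) \<circ> (\<lambda>t. t - s) has_vector_derivative 1 *\<^sub>R w' (x + s *\<^sub>R b)) (at s)"
      by (intro vector_diff_chain_at) auto
    then show ?thesis by (simp add: o_def algebra_simps)
  qed
  have lim: "(\<lambda>n. q n x) \<longlonglongrightarrow> w' x" for x
  proof -
    have "((\<lambda>t. (w (x + t *\<^sub>R b) - w x) /\<^sub>R t) \<longlongrightarrow> w' x) (at 0)"
    proof -
      have "((\<lambda>t. (w (x + t *\<^sub>R b) - w x - t *\<^sub>R w' x) /\<^sub>R \<bar>t\<bar>) \<longlongrightarrow> 0) (at 0)"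
        using deriv[of x] unfolding has_vector_derivative_def has_derivative_def by simp
      then have "((\<lambda>t. norm ((w (x + t *\<^sub>R b) - w x - t *\<^sub>R w' x) /\<^sub>R \<bar>t\<bar>)) \<longlongrightarrow> 0) (at 0)"
        by (rule tendsto_norm_zero)
      moreover have "\<forall>\<^sub>F t in at 0. norm ((w (x + t *\<^sub>R b) - w x - t *\<^sub>R w' x) /\<^sub>R \<bar>t\<bar>)
          = norm ((w (x + t *\<^sub>R b) - w x) /\<^sub>R t - w' x)"
        unfolding eventually_at_filter
      proof (intro always_eventually allI impI)
        fix t :: real assume "t \<noteq> 0"
        then have "(w (x + t *\<^sub>R b) - w x) /\<^sub>R t - w' x = (w (x + t *\<^sub>R b) - w x - t *\<^sub>R w' x) /\<^sub>R t"
          by (simp add: scaleR_diff_right)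
        then show "norm ((w (x + t *\<^sub>R b) - w x - t *\<^sub>R w' x) /\<^sub>R \<bar>t\<bar>)
          = norm ((w (x + t *\<^sub>R b) - w x) /\<^sub>R t - w' x)" by simp
      qed
      ultimately have "((\<lambda>t. norm ((w (x + t *\<^sub>R b) - w x) /\<^sub>R t - w' x)) \<longlongrightarrow> 0) (at 0)"
        by (rule Lim_transform_eventually)
      then show ?thesis by (simp add: tendsto_norm_zero_iff LIM_zero_iff)
    qed
    moreover have "filterlim e (at 0) sequentially"
      unfolding filterlim_at using e LIMSEQ_Suc[OF lim_1_over_n]
      by (auto simp: e_def[abs_def] less_imp_neq)
    ultimately have "(\<lambda>n. (w (x + e n *\<^sub>R b) - w x) /\<^sub>R e n) \<longlonglongrightarrow> w' x"
      by (rule filterlim_compose)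
    then show ?thesis by (simp add: q_def divide_inverse)
  qed
  have qb: "norm (q n x) \<le> g x" for n x
  proof -
    have "norm (w (x + e n *\<^sub>R b) - w (x + 0 *\<^sub>R b)) \<le> g x * norm (e n - 0)"
    proof (rule differentiable_bound[where S="{0..1}" and f'="\<lambda>s h. h *\<^sub>R w' (x + s *\<^sub>R b)"])
      show "((\<lambda>t. w (x + t *\<^sub>R b)) has_derivative (\<lambda>h. h *\<^sub>R w' (x + s *\<^sub>R b))) (at s within {0..1})" for s
        using deriv'[of x s] unfolding has_vector_derivative_def by (rule has_derivative_at_withinI)
      show "onorm (\<lambda>h. h *\<^sub>R w' (x + s *\<^sub>R b)) \<le> g x" if "s \<in> {0..1}" for s
        using bound[of s x] that by (intro onorm_le) (simp add: mult_left_mono mult.commute)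
    qed (use e[of n] in auto)
    then show ?thesis using e[of n] by (simp add: q_def divide_le_eq mult.commute)
  qed
  have qi: "(\<integral>x. q n x \<partial>lborel) = 0" for n
    unfolding q_def using integrable_translate[OF w, of "e n *\<^sub>R b"] w by simp
  have "(\<lambda>n. \<integral>x. q n x \<partial>lborel) \<longlonglongrightarrow> (\<integral>x. w' x \<partial>lborel)"
  proof (rule integral_dominated_convergence[where w=g])
    show "w' \<in> borel_measurable lborel"
    proof (rule borel_measurable_LIMSEQ_metric[OF _ lim])
      show "q n \<in> borel_measurable lborel" for n unfolding q_def by measurable
    qed
    show "q n \<in> borel_measurable lborel" for n unfolding q_def by measurable
  qed (use lim qb g in auto)
  then show ?thesis by (simp add: qi LIMSEQ_const_iff)
qed

section \<open>Hermite functions on the line\<close>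

text \<open>
  Both statements are proved in one induction: the recurrence for \<open>g (Suc k)\<close> makes it
  differentiable, and differentiating the recurrence gives the next one.
\<close>

lemma gauss_deriv:
  fixes t :: real
  defines "g \<equiv> \<lambda>k. (deriv ^^ k) (\<lambda>s::real. exp (- s\<^sup>2))"
  shows "(g k has_real_derivative g (Suc k) t) (at t)"
    and "g (Suc k) t = - 2 * t * g k t - 2 * real k * g (k - 1) t"
proof -
  have g0: "(g 0 has_real_derivative - 2 * t * g 0 t) (at t)" for t
    unfolding g_def by (auto intro!: derivative_eq_intros)
  have D: "g (Suc k) = deriv (g k)" for k by (simp add: g_def)
  have "(\<forall>t. (g k has_real_derivative g (Suc k) t) (at t)) \<and>
          (\<forall>t. k > 0 \<longrightarrow> (g (k - 1) has_real_derivative g k t) (at t)) \<and>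
          (\<forall>t. g (Suc k) t = - 2 * t * g k t - 2 * real k * g (k - 1) t)" for k
  proof (induction k)
    case 0
    have g1: "g (Suc 0) t = - 2 * t * g 0 t" for t unfolding D by (rule DERIV_imp_deriv[OF g0])
    then show ?case using g0 by (simp add: g1)
  next
    case (Suc k)
    then have eq: "g (Suc k) = (\<lambda>t. - 2 * t * g k t - 2 * real k * g (k - 1) t)"
      and k: "\<And>t. (g k has_real_derivative g (Suc k) t) (at t)"
      and m: "\<And>t. k > 0 \<Longrightarrow> (g (k - 1) has_real_derivative g k t) (at t)"
      by auto
    have d: "(g (Suc k) has_real_derivative - 2 * t * g (Suc k) t - 2 * real (Suc k) * g k t) (at t)" for t
    proof (cases "k = 0")
      case True
      show ?thesis
        by (subst eq) (auto intro!: derivative_eq_intros k[unfolded True] simp: True algebra_simps)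
    next
      case False
      show ?thesis
        by (subst eq) (use False in \<open>auto intro!: derivative_eq_intros k m[unfolded One_nat_def] simp: algebra_simps\<close>)
    qed
    have "g (Suc (Suc k)) t = - 2 * t * g (Suc k) t - 2 * real (Suc k) * g k t" for t
      unfolding D[of "Suc k"] by (rule DERIV_imp_deriv[OF d])
    then show ?case using d k by auto
  qed
  from this[of k] show "(g k has_real_derivative g (Suc k) t) (at t)"
    "g (Suc k) t = - 2 * t * g k t - 2 * real k * g (k - 1) t" by blast+
qed

lemma hermite_poly_0: "hermite_poly 0 t = 1"
  by (simp add: hermite_poly_def mult_exp_exp)

lemma hermite_poly_Suc:
  "hermite_poly (Suc k) t = 2 * t * hermite_poly k t - 2 * real k * hermite_poly (k - 1) t"
proof (cases k)
  case 0
  then show ?thesis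
    unfolding hermite_poly_def gauss_deriv(2) by simp
next
  case (Suc m)
  then show ?thesis
    unfolding hermite_poly_def gauss_deriv(2)[of k]
    by (simp del: funpow.simps add: algebra_simps)
qed

lemma DERIV_hermite_poly:
  "(hermite_poly k has_real_derivative 2 * real k * hermite_poly (k - 1) t) (at t)"
proof -
  have "((\<lambda>t. (- 1) ^ k * exp (t\<^sup>2) * (deriv ^^ k) (\<lambda>s. exp (- s\<^sup>2)) t) has_real_derivative
      2 * t * hermite_poly k t - hermite_poly (Suc k) t) (at t)"
    by (auto intro!: derivative_eq_intros gauss_deriv(1) simp: hermite_poly_def algebra_simps
        simp del: funpow.simps)
  moreover have "hermite_poly k = (\<lambda>t. (- 1) ^ k * exp (t\<^sup>2) * (deriv ^^ k) (\<lambda>s. exp (- s\<^sup>2)) t)"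
    by (simp add: fun_eq_iff hermite_poly_def)
  ultimately show ?thesis
    by (simp only: hermite_poly_Suc) (simp add: algebra_simps)
qed

definition hermite_const :: "nat \<Rightarrow> real" where
  "hermite_const k = (2 ^ k * fact k * sqrt pi) powr (- 1 / 2)"

lemma hermite_const_pos: "0 < hermite_const k"
  by (simp add: hermite_const_def)

lemma hermite_const_sq: "(hermite_const k)\<^sup>2 = 1 / (2 ^ k * fact k * sqrt pi)"
  unfolding hermite_const_def
  by (subst powr_power) (auto simp: powr_minus_divide)

lemma hermite_const_Suc: "hermite_const k = sqrt (2 * real (k + 1)) * hermite_const (Suc k)"
proof (rule power2_eq_imp_eq)
  show "(hermite_const k)\<^sup>2 = (sqrt (2 * real (k + 1)) * hermite_const (Suc k))\<^sup>2"
    by (simp add: power_mult_distrib hermite_const_sq frac_eq_eq del: of_nat_Suc)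
qed (use hermite_const_pos in \<open>auto intro: less_imp_le\<close>)

lemma hermite1_eq: "hermite1 k t = hermite_const k * hermite_poly k t * exp (- t\<^sup>2 / 2)"
  by (simp add: hermite1_def hermite_const_def)

text \<open>
  In terms of the creation operator \<open>A = t - d/dt\<close> this says \<open>A h\<^sub>k = sqrt (2 (k + 1)) h\<^sub>(k+1)\<close>.
\<close>

lemma DERIV_hermite1_raise:
  "(hermite1 k has_real_derivative t * hermite1 k t - sqrt (2 * real (k + 1)) * hermite1 (Suc k) t) (at t)"
proof -
  have "((\<lambda>t. hermite_const k * hermite_poly k t * exp (- t\<^sup>2 / 2)) has_real_derivative
      hermite_const k * (2 * real k * hermite_poly (k - 1) t - t * hermite_poly k t) * exp (- t\<^sup>2 / 2)) (at t)"
    by (auto intro!: derivative_eq_intros DERIV_hermite_poly simp: algebra_simps)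
  moreover have "hermite_const k * (2 * real k * hermite_poly (k - 1) t - t * hermite_poly k t) * exp (- t\<^sup>2 / 2)
      = t * hermite1 k t - sqrt (2 * real (k + 1)) * hermite1 (Suc k) t"
  proof -
    have "sqrt (2 * real (k + 1)) * hermite1 (Suc k) t
        = hermite_const k * hermite_poly (Suc k) t * exp (- t\<^sup>2 / 2)"
      by (simp only: hermite1_eq hermite_const_Suc[of k] mult.assoc)
    then show ?thesis by (simp add: hermite1_eq hermite_poly_Suc ring_distribs del: of_nat_Suc of_nat_add)
  qed
  moreover have "hermite1 k = (\<lambda>t. hermite_const k * hermite_poly k t * exp (- t\<^sup>2 / 2))"
    by (simp add: fun_eq_iff hermite1_eq)
  ultimately show ?thesis by (simp only:)
qed

lemma hermite1_three_term:
  "t * hermite1 k t = sqrt (real k / 2) * hermite1 (k - 1) t + sqrt (real (k + 1) / 2) * hermite1 (Suc k) t"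
proof -
  have s: "sqrt (real (k + 1) / 2) * 2 = sqrt (2 * real (k + 1))" for k
    by (rule power2_eq_imp_eq) (auto simp: power_mult_distrib)
  have c: "sqrt (real (k + 1) / 2) * hermite_const (Suc k) = hermite_const k / 2" for k
    unfolding hermite_const_Suc[of k] s[symmetric] by simp
  have "sqrt (real k / 2) * hermite_const (k - 1) = real k * hermite_const k"
  proof (cases k)
    case (Suc m)
    have "sqrt (real k / 2) * sqrt (2 * real k) = real k"
      by (simp add: real_sqrt_mult[symmetric])
    then show ?thesis using Suc hermite_const_Suc[of m] by (simp add: mult.assoc[symmetric])
  qed simp
  then have "sqrt (real k / 2) * hermite1 (k - 1) t = real k * hermite_const k * hermite_poly (k - 1) t * exp (- t\<^sup>2 / 2)"
    by (simp only: hermite1_eq mult.assoc[symmetric])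
  moreover have "sqrt (real (k + 1) / 2) * hermite1 (Suc k) t = hermite_const k / 2 * hermite_poly (Suc k) t * exp (- t\<^sup>2 / 2)"
    by (simp only: hermite1_eq mult.assoc[symmetric] c)
  ultimately have "sqrt (real k / 2) * hermite1 (k - 1) t + sqrt (real (k + 1) / 2) * hermite1 (Suc k) t
      = real k * hermite_const k * hermite_poly (k - 1) t * exp (- t\<^sup>2 / 2)
        + hermite_const k / 2 * hermite_poly (Suc k) t * exp (- t\<^sup>2 / 2)" by (simp only:)
  also have "\<dots> = t * hermite1 k t"
    unfolding hermite1_eq hermite_poly_Suc by (simp add: algebra_simps)
  finally show ?thesis by simp
qed

text \<open>
  In terms of the annihilation operator \<open>A\<^sup>* = t + d/dt\<close> this says
  \<open>A\<^sup>* h\<^sub>k = sqrt (2 k) h\<^sub>(k-1)\<close>; for \<open>k = 0\<close> the coefficient vanishes, so the default value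
  \<open>k - 1 = 0\<close> is harmless.
\<close>

lemma DERIV_hermite1_lower:
  "(hermite1 k has_real_derivative sqrt (2 * real k) * hermite1 (k - 1) t - t * hermite1 k t) (at t)"
proof -
  have s: "2 * sqrt (a / 2) = sqrt (2 * a)" if "0 \<le> a" for a
    by (rule power2_eq_imp_eq) (use that in \<open>auto simp: power_mult_distrib\<close>)
  have "2 * (t * hermite1 k t) = sqrt (2 * real k) * hermite1 (k - 1) t + sqrt (2 * real (k + 1)) * hermite1 (Suc k) t"
    unfolding hermite1_three_term[of t k] distrib_left mult.assoc[symmetric] by (simp add: s del: of_nat_add)
  then have "t * hermite1 k t - sqrt (2 * real (k + 1)) * hermite1 (Suc k) t
      = sqrt (2 * real k) * hermite1 (k - 1) t - t * hermite1 k t" by linarith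
  then show ?thesis using DERIV_hermite1_raise[of k t] by (simp only:)
qed

lemma continuous_on_hermite1 [continuous_intros]:
  "continuous_on S f \<Longrightarrow> continuous_on S (\<lambda>x. hermite1 k (f x))"
proof -
  have "continuous_on UNIV (hermite1 k)"
    by (rule DERIV_continuous_on[OF DERIV_hermite1_lower[THEN DERIV_subset]]) auto
  then show "continuous_on S f \<Longrightarrow> continuous_on S (\<lambda>x. hermite1 k (f x))"
    using continuous_on_compose2 by blast
qed

lemma borel_measurable_hermite1 [measurable]: "hermite1 k \<in> borel_measurable borel"
  by (intro borel_measurable_continuous_onI continuous_intros)

lemma hermite_poly_bound: "\<exists>C\<ge>0. \<forall>t. \<bar>hermite_poly k t\<bar> \<le> C * (1 + t\<^sup>2) ^ k"
proof (induction k rule: induct_nat_012)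
  case 0
  show ?case by (auto simp: hermite_poly_0 intro: exI[of _ 1])
next
  case 1
  have "\<bar>2 * t\<bar> \<le> 2 * (1 + t\<^sup>2)" for t :: real
    using sum_squares_bound[of t 1] sum_squares_bound[of "-t" 1] by (auto simp: abs_if)
  then show ?case by (intro exI[of _ 2]) (auto simp: hermite_poly_0 hermite_poly_Suc)
next
  case (ge2 k)
  then obtain C D where C: "C \<ge> 0" "\<And>t. \<bar>hermite_poly k t\<bar> \<le> C * (1 + t\<^sup>2) ^ k"
    and D: "D \<ge> 0" "\<And>t. \<bar>hermite_poly (Suc k) t\<bar> \<le> D * (1 + t\<^sup>2) ^ Suc k" by blast
  show ?case
  proof (intro exI conjI allI)
    fix t :: real
    have t: "\<bar>2 * t\<bar> \<le> 2 * (1 + t\<^sup>2)"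
      using sum_squares_bound[of t 1] sum_squares_bound[of "-t" 1] by (auto simp: abs_if)
    have p: "(1 + t\<^sup>2) ^ k \<le> (1 + t\<^sup>2) ^ Suc (Suc k)" by (rule power_increasing) auto
    have "\<bar>hermite_poly (Suc (Suc k)) t\<bar> \<le> \<bar>2 * t\<bar> * \<bar>hermite_poly (Suc k) t\<bar> + 2 * real (Suc k) * \<bar>hermite_poly k t\<bar>"
      unfolding hermite_poly_Suc[of "Suc k"]
      using abs_triangle_ineq4[of "2 * t * hermite_poly (Suc k) t" "2 * real (Suc k) * hermite_poly k t"]
      by (simp add: abs_mult)
    also have "\<dots> \<le> (2 * (1 + t\<^sup>2)) * (D * (1 + t\<^sup>2) ^ Suc k) + 2 * real (Suc k) * (C * (1 + t\<^sup>2) ^ Suc (Suc k))"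
      by (intro add_mono mult_mono order_refl t D order_trans[OF C(2)] p C) auto
    also have "\<dots> = (2 * D + 2 * real (Suc k) * C) * (1 + t\<^sup>2) ^ Suc (Suc k)"
      by (simp add: algebra_simps)
    finally show "\<bar>hermite_poly (Suc (Suc k)) t\<bar> \<le> (2 * D + 2 * real (Suc k) * C) * (1 + t\<^sup>2) ^ Suc (Suc k)" .
  qed (use C D in auto)
qed

lemma power_le_fact_exp:
  fixes s :: real
  assumes "0 \<le> s"
  shows "s ^ m \<le> fact m * exp s"
proof -
  have "s ^ m / fact m = (\<Sum>n\<in>{m}. s ^ n /\<^sub>R fact n)" by (simp add: divide_inverse mult.commute)
  also have "\<dots> \<le> exp s"
    unfolding exp_def using assms
    by (intro sum_le_suminf summable_exp_generic) auto
  finally show ?thesis by (simp add: field_simps)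
qed

text \<open>
  A polynomial of degree \<open>k\<close> is at most \<open>C (1 + t^2)^k\<close>, and the Gaussian absorbs one power of
  \<open>1 + t^2\<close> more. This rate suffices: it is integrable and almost invariant under translations
  by at most 1, which is what integration by parts requires.
\<close>

lemma hermite1_decay: "\<exists>C>0. \<forall>t. \<bar>hermite1 k t\<bar> \<le> C / (1 + t\<^sup>2)"
proof -
  obtain C where C: "C \<ge> 0" "\<And>t. \<bar>hermite_poly k t\<bar> \<le> C * (1 + t\<^sup>2) ^ k"
    using hermite_poly_bound by blast
  define E where "E = fact (Suc k) * 2 ^ Suc k * exp (1 / 2 :: real)"
  have E: "(1 + t\<^sup>2) ^ Suc k * exp (- t\<^sup>2 / 2) \<le> E" for t :: real
  proof -
    have "((1 + t\<^sup>2) / 2) ^ Suc k \<le> fact (Suc k) * exp ((1 + t\<^sup>2) / 2)"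
      by (rule power_le_fact_exp) auto
    also have "exp ((1 + t\<^sup>2) / 2) = exp (1 / 2) * exp (t\<^sup>2 / 2)"
      by (simp add: mult_exp_exp add_divide_distrib)
    finally have "(1 + t\<^sup>2) ^ Suc k \<le> E * exp (t\<^sup>2 / 2)"
      by (simp add: E_def power_divide field_simps)
    then show ?thesis by (simp add: exp_minus field_simps)
  qed
  have "\<bar>hermite1 k t\<bar> * (1 + t\<^sup>2) \<le> hermite_const k * C * E" for t
  proof -
    have "\<bar>hermite1 k t\<bar> * (1 + t\<^sup>2) = hermite_const k * \<bar>hermite_poly k t\<bar> * exp (- t\<^sup>2 / 2) * (1 + t\<^sup>2)"
      using hermite_const_pos[of k] by (simp add: hermite1_eq abs_mult)
    also have "\<dots> \<le> hermite_const k * (C * (1 + t\<^sup>2) ^ k) * exp (- t\<^sup>2 / 2) * (1 + t\<^sup>2)"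
      by (intro mult_right_mono mult_left_mono C less_imp_le hermite_const_pos) auto
    also have "\<dots> = hermite_const k * C * ((1 + t\<^sup>2) ^ Suc k * exp (- t\<^sup>2 / 2))"
      by (simp add: algebra_simps)
    also have "\<dots> \<le> hermite_const k * C * E"
      by (intro mult_left_mono E mult_nonneg_nonneg C less_imp_le hermite_const_pos)
    finally show ?thesis .
  qed
  then have "\<bar>hermite1 k t\<bar> \<le> (hermite_const k * C * E + 1) / (1 + t\<^sup>2)" for t
    by (simp only: pos_le_divide_eq[OF one_plus_square_pos]) (smt (verit))
  moreover have "hermite_const k * C * E + 1 > 0"
    using C(1) hermite_const_pos[of k] by (intro add_nonneg_pos mult_nonneg_nonneg) (auto simp: E_def)
  ultimately show ?thesis by blast
qed

lemma integrable_inverse_one_plus_square: "integrable lborel (\<lambda>t::real. 1 / (1 + t\<^sup>2))"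
proof -
  have "set_integrable lborel (einterval (-\<infinity>) \<infinity>) (\<lambda>x. inverse (1 + x^2))"
    by (rule integrable_inverse_1_plus_square)
  then show ?thesis by (simp add: set_integrable_def divide_inverse)
qed

lemma hermite1_mult_bound: "\<exists>C>0. \<forall>t. \<bar>hermite1 j t * hermite1 k t\<bar> \<le> C / (1 + t\<^sup>2)"
proof -
  obtain C where C: "C > 0" "\<And>t. \<bar>hermite1 j t\<bar> \<le> C / (1 + t\<^sup>2)" using hermite1_decay by blast
  obtain D where D: "D > 0" "\<And>t. \<bar>hermite1 k t\<bar> \<le> D / (1 + t\<^sup>2)" using hermite1_decay by blast
  have "\<bar>hermite1 j t * hermite1 k t\<bar> \<le> C * D / (1 + t\<^sup>2)" for t
  proof -
    have pos: "0 < 1 + t\<^sup>2" by (rule add_pos_nonneg) auto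
    have "D / (1 + t\<^sup>2) \<le> D" using D(1) pos by (simp add: divide_le_eq mult_le_cancel_left1)
    then have "\<bar>hermite1 k t\<bar> \<le> D" using D(2)[of t] by linarith
    then have "\<bar>hermite1 j t * hermite1 k t\<bar> \<le> C / (1 + t\<^sup>2) * D"
      unfolding abs_mult using C D pos by (intro mult_mono) auto
    then show ?thesis by simp
  qed
  then show ?thesis using C(1) D(1) by (intro exI[of _ "C * D"]) auto
qed

lemma inverse_one_plus_square_shift:
  fixes t s :: real
  assumes "\<bar>s\<bar> \<le> 1"
  shows "1 / (1 + (t + s)\<^sup>2) \<le> 3 / (1 + t\<^sup>2)"
proof -
  have "t\<^sup>2 \<le> 2 * (t + s)\<^sup>2 + 2 * s\<^sup>2"
    using sum_squares_bound[of "t + s" "- s"] zero_le_power2[of "t + s + s"] by (simp add: power2_eq_square algebra_simps)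
  moreover have "s\<^sup>2 \<le> 1" using assms by (simp add: abs_square_le_1)
  ultimately have "1 + t\<^sup>2 \<le> 3 * (1 + (t + s)\<^sup>2)" by (smt (verit) zero_le_power2)
  moreover have "0 < 1 + t\<^sup>2" "0 < 1 + (t + s)\<^sup>2" by (auto intro: add_pos_nonneg)
  ultimately show ?thesis by (simp add: field_simps)
qed

lemma integrable_hermite1_mult: "integrable lborel (\<lambda>t. hermite1 j t * hermite1 k t)"
proof -
  obtain C where C: "\<And>t. \<bar>hermite1 j t * hermite1 k t\<bar> \<le> C / (1 + t\<^sup>2)"
    using hermite1_mult_bound by blast
  show ?thesis
  proof (rule Bochner_Integration.integrable_bound)
    show "integrable lborel (\<lambda>t. C * (1 / (1 + t\<^sup>2)))"
      by (intro integrable_mult_right integrable_inverse_one_plus_square)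
    show "AE t in lborel. norm (hermite1 j t * hermite1 k t) \<le> norm (C * (1 / (1 + t\<^sup>2)))"
      using order_trans[OF C abs_ge_self] by (intro AE_I2) simp
  qed auto
qed

text \<open>
  \<open>A\<close> and \<open>A\<^sup>*\<close> are adjoint: this is the integral of the derivative of \<open>h\<^sub>j h\<^sub>k\<close>.
\<close>

lemma hermite1_raise_lower:
  "sqrt (2 * real (k + 1)) * (\<integral>t. hermite1 j t * hermite1 (Suc k) t \<partial>lborel)
    = sqrt (2 * real j) * (\<integral>t. hermite1 (j - 1) t * hermite1 k t \<partial>lborel)"
proof -
  \<comment> \<open>The derivative of \<open>h\<^sub>j h\<^sub>k\<close>, with the lowering formula for \<open>h\<^sub>j\<close> and the raising
      formula for \<open>h\<^sub>k\<close>; the terms with a factor \<open>t\<close> cancel.\<close>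
  define w' :: "real \<Rightarrow> real" where "w' t = sqrt (2 * real j) * (hermite1 (j - 1) t * hermite1 k t)
      - sqrt (2 * real (k + 1)) * (hermite1 j t * hermite1 (Suc k) t)" for t
  obtain C where C: "\<And>t. \<bar>hermite1 (j - 1) t * hermite1 k t\<bar> \<le> C / (1 + t\<^sup>2)" "C > 0"
    using hermite1_mult_bound by blast
  obtain D where D: "\<And>t. \<bar>hermite1 j t * hermite1 (Suc k) t\<bar> \<le> D / (1 + t\<^sup>2)" "D > 0"
    using hermite1_mult_bound by blast
  define E where "E = sqrt (2 * real j) * C + sqrt (2 * real (k + 1)) * D"
  have E: "\<bar>w' t\<bar> \<le> E * (1 / (1 + t\<^sup>2))" for t
  proof -
    have "\<bar>w' t\<bar> \<le> sqrt (2 * real j) * \<bar>hermite1 (j - 1) t * hermite1 k t\<bar>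
      + sqrt (2 * real (k + 1)) * \<bar>hermite1 j t * hermite1 (Suc k) t\<bar>"
      unfolding w'_def by (rule order_trans[OF abs_triangle_ineq4]) (simp add: abs_mult)
    also have "\<dots> \<le> sqrt (2 * real j) * (C / (1 + t\<^sup>2)) + sqrt (2 * real (k + 1)) * (D / (1 + t\<^sup>2))"
      by (intro add_mono mult_left_mono C D) auto
    finally show ?thesis by (simp add: E_def ring_distribs add_divide_distrib)
  qed
  have E0: "0 \<le> E" using C D by (auto simp: E_def)
  have "(\<integral>t. w' t \<partial>lborel) = 0"
  proof (rule integral_directional_derivative[where b="1::real" and g="\<lambda>t. E * (3 / (1 + t\<^sup>2))"])
    show "integrable lborel (\<lambda>t. hermite1 j t * hermite1 k t)" by (rule integrable_hermite1_mult)
    show "((\<lambda>t. hermite1 j (x + t *\<^sub>R 1) * hermite1 k (x + t *\<^sub>R 1)) has_vector_derivative w' x) (at 0)" for x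
    proof -
      have "((\<lambda>t. x + t *\<^sub>R 1) has_real_derivative 1) (at 0)"
        by (auto intro!: derivative_eq_intros)
      then show ?thesis
        unfolding has_real_derivative_iff_has_vector_derivative[symmetric] w'_def
        by (intro DERIV_mult'[OF DERIV_chain2[OF DERIV_hermite1_lower] DERIV_chain2[OF DERIV_hermite1_raise],
              THEN DERIV_cong]) (auto simp: algebra_simps)
    qed
    show "norm (w' (x + s *\<^sub>R 1)) \<le> E * (3 / (1 + x\<^sup>2))" if "0 \<le> s" "s \<le> 1" for x s
    proof -
      have "norm (w' (x + s *\<^sub>R 1)) \<le> E * (1 / (1 + (x + s)\<^sup>2))" using E[of "x + s"] by simp
      also have "\<dots> \<le> E * (3 / (1 + x\<^sup>2))"
        by (intro mult_left_mono inverse_one_plus_square_shift E0) (use that in auto)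
      finally show ?thesis .
    qed
    have "integrable lborel (\<lambda>t::real. E * (3 * (1 / (1 + t\<^sup>2))))"
      by (intro integrable_mult_right integrable_inverse_one_plus_square)
    then show "integrable lborel (\<lambda>t::real. E * (3 / (1 + t\<^sup>2)))" by simp
  qed
  then show ?thesis
    unfolding w'_def by (simp add: integrable_hermite1_mult)
qed

text \<open>
  The adjointness relation lowers both indices, so everything reduces to the Gaussian integral
  and to \<open>A\<^sup>* h\<^sub>0 = 0\<close>.
\<close>

lemma hermite1_orthonormal:
  "(\<integral>t. hermite1 j t * hermite1 k t \<partial>lborel) = (if j = k then 1 else 0)"
proof (induction k arbitrary: j)
  case 0
  show ?case
  proof (cases j)
    case (Suc m)
    have "sqrt (2 * real (m + 1)) * (\<integral>t. hermite1 0 t * hermite1 (Suc m) t \<partial>lborel) = 0"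
      using hermite1_raise_lower[of m 0] by simp
    then show ?thesis using Suc by (simp add: mult.commute)
  next
    case 0
    have "has_bochner_integral lborel (\<lambda>x::real. exp (- x\<^sup>2)) (2 *\<^sub>R (sqrt pi / 2))"
      by (rule has_bochner_integral_even_function[OF gaussian_moment_0]) auto
    then have "(\<integral>x. exp (- (x::real)\<^sup>2) \<partial>lborel) = sqrt pi"
      by (auto dest: has_bochner_integral_integral_eq)
    moreover have "hermite1 0 t * hermite1 0 t = 1 / sqrt pi * exp (- t\<^sup>2)" for t
    proof -
      have "hermite1 0 t * hermite1 0 t = (hermite_const 0)\<^sup>2 * (exp (- t\<^sup>2 / 2) * exp (- t\<^sup>2 / 2))"
        by (simp add: hermite1_eq hermite_poly_0 power2_eq_square)
      then show ?thesis by (simp add: hermite_const_sq mult_exp_exp)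
    qed
    ultimately show ?thesis using 0 by simp
  qed
next
  case (Suc k)
  have *: "sqrt (2 * real (k + 1)) * (\<integral>t. hermite1 j t * hermite1 (Suc k) t \<partial>lborel)
      = sqrt (2 * real j) * (if j - 1 = k then 1 else 0)"
    unfolding hermite1_raise_lower Suc.IH ..
  show ?case
  proof (cases j)
    case 0
    then show ?thesis using * by simp
  next
    case [simp]: (Suc m)
    show ?thesis using * by (cases "m = k") auto
  qed
qed

section \<open>The sum of the squares of the first Hermite functions\<close>

text \<open>
  The derivative of \<open>h\<^sub>k^2\<close> is a difference of consecutive terms, so the sum telescopes.
\<close>

lemma DERIV_sum_hermite1_sq:
  "((\<lambda>t. \<Sum>k<N. (hermite1 k t)\<^sup>2) has_real_derivative
     - sqrt (2 * real N) * (hermite1 (N - 1) t * hermite1 N t)) (at t)"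
proof (induction N)
  case (Suc N)
  have "((\<lambda>t. (\<Sum>k<N. (hermite1 k t)\<^sup>2) + (hermite1 N t)\<^sup>2) has_real_derivative
     - sqrt (2 * real N) * (hermite1 (N - 1) t * hermite1 N t)
     + (hermite1 N t * (sqrt (2 * real N) * hermite1 (N - 1) t - t * hermite1 N t)
       + hermite1 N t * (t * hermite1 N t - sqrt (2 * real (N + 1)) * hermite1 (Suc N) t))) (at t)"
    using DERIV_mult'[OF DERIV_hermite1_raise[of N t] DERIV_hermite1_lower[of N t]]
    by (intro DERIV_add Suc.IH) (simp add: power2_eq_square algebra_simps)
  then show ?case by (auto elim!: DERIV_cong simp: algebra_simps)
qed simp

lemma hermite1_tendsto_0: "(\<lambda>n. hermite1 k (- real n)) \<longlonglongrightarrow> 0"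
proof -
  obtain C where C: "C > 0" "\<And>t. \<bar>hermite1 k t\<bar> \<le> C / (1 + t\<^sup>2)" using hermite1_decay by blast
  have "norm (hermite1 k (- real n)) \<le> C * inverse (real (Suc n))" for n
  proof -
    have "real n \<le> real n * real n" by (cases n) auto
    then have "real (Suc n) \<le> 1 + (- real n)\<^sup>2" by (simp add: power2_eq_square)
    then have "C / (1 + (- real n)\<^sup>2) \<le> C / real (Suc n)"
      using C(1) by (intro divide_left_mono mult_pos_pos one_plus_square_pos) auto
    then show ?thesis using C(2)[of "- real n"] by (simp add: divide_inverse)
  qed
  then have "\<forall>\<^sub>F n in sequentially. norm (hermite1 k (- real n)) \<le> C * inverse (real (Suc n))"
    by (rule always_eventually[OF allI])
  moreover have "(\<lambda>n. C * inverse (real (Suc n))) \<longlonglongrightarrow> 0"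
    using tendsto_mult_right_zero[OF LIMSEQ_inverse_real_of_nat] by blast
  ultimately show ?thesis by (rule Lim_null_comparison)
qed

text \<open>
  The sum vanishes at \<open>-\<infinity>\<close>, and the \<open>L^1\<close> norm of its derivative is at most \<open>sqrt (2 N)\<close> because
  \<open>h\<^sub>(N-1)\<close> and \<open>h\<^sub>N\<close> have norm 1.
\<close>

lemma sum_hermite1_sq_le: "(\<Sum>k<N. (hermite1 k t)\<^sup>2) \<le> sqrt (2 * real N)"
proof -
  define Q where "Q t = (\<Sum>k<N. (hermite1 k t)\<^sup>2)" for t
  define q where "q t = - sqrt (2 * real N) * (hermite1 (N - 1) t * hermite1 N t)" for t
  have Dq: "(Q has_real_derivative q t) (at t)" for t
    using DERIV_sum_hermite1_sq[of N t] by (simp add: Q_def[abs_def] q_def)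
  have cont: "isCont q t" for t
  proof -
    have "continuous_on UNIV q" unfolding q_def[abs_def] by (intro continuous_intros)
    then show ?thesis by (simp add: continuous_on_eq_continuous_at)
  qed
  have qint: "integrable lborel q" unfolding q_def[abs_def]
    by (intro integrable_mult_right integrable_hermite1_mult)
  have qbound: "(\<integral>x. \<bar>q x\<bar> \<partial>lborel) \<le> sqrt (2 * real N)"
  proof -
    have "(\<integral>x. \<bar>q x\<bar> \<partial>lborel) \<le> (\<integral>x. sqrt (2 * real N) *
        ((hermite1 (N - 1) x * hermite1 (N - 1) x + hermite1 N x * hermite1 N x) / 2) \<partial>lborel)"
    proof (rule integral_mono)
      show "\<bar>q x\<bar> \<le> sqrt (2 * real N) *
        ((hermite1 (N - 1) x * hermite1 (N - 1) x + hermite1 N x * hermite1 N x) / 2)" for x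
      proof -
        have "\<bar>hermite1 (N - 1) x * hermite1 N x\<bar>
            \<le> (hermite1 (N - 1) x * hermite1 (N - 1) x + hermite1 N x * hermite1 N x) / 2"
          using sum_squares_bound[of "\<bar>hermite1 (N - 1) x\<bar>" "\<bar>hermite1 N x\<bar>"]
          by (simp add: power2_eq_square abs_mult)
        then show ?thesis
          unfolding q_def by (simp add: abs_mult mult_left_mono del: times_divide_eq_right)
      qed
    qed (use qint integrable_hermite1_mult in auto)
    also have "\<dots> = sqrt (2 * real N)"
      by (simp add: integrable_hermite1_mult hermite1_orthonormal)
    finally show ?thesis .
  qed
  have step: "Q t - Q s \<le> sqrt (2 * real N)" if "s \<le> t" for s
  proof -
    have "Q t - Q s = (\<integral>x. q x * indicator {s..t} x \<partial>lborel)"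
      by (rule integral_FTC_Icc_real[symmetric]) (use that Dq cont in auto)
    also have "\<dots> \<le> (\<integral>x. \<bar>q x\<bar> \<partial>lborel)"
    proof (rule integral_mono)
      show "integrable lborel (\<lambda>x. q x * indicator {s..t} x)"
        using integrable_mult_indicator[OF _ qint, of "{s..t}"] by (simp add: mult.commute)
    qed (use qint in \<open>auto simp: indicator_def\<close>)
    finally show ?thesis using qbound by linarith
  qed
  have "(\<lambda>n. Q t - Q (- real n)) \<longlonglongrightarrow> Q t - (\<Sum>k<N. 0\<^sup>2)"
    unfolding Q_def by (intro tendsto_intros hermite1_tendsto_0)
  moreover have "\<forall>\<^sub>F n in sequentially. Q t - Q (- real n) \<le> sqrt (2 * real N)"
  proof -
    obtain m :: nat where "- t \<le> real m" using real_arch_simple by blast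
    then show ?thesis unfolding eventually_sequentially
      by (intro exI[of _ m] allI impI step) (smt (verit) of_nat_le_iff)
  qed
  ultimately show ?thesis
    using tendsto_upperbound by (fastforce simp: Q_def)
qed

section \<open>Hermite functions on Euclidean space\<close>

lemma Basis_vec_real: "(Basis :: (real^'n) set) = range (\<lambda>i. axis i 1)"
  by (auto simp: Basis_vec_def)

lemma prod_Basis_vec:
  fixes g :: "(real^'n) \<Rightarrow> 'b::comm_monoid_mult"
  shows "(\<Prod>b\<in>Basis. g b) = (\<Prod>i\<in>UNIV. g (axis i 1))"
  unfolding Basis_vec_real by (subst prod.reindex) (auto simp: inj_on_def axis_eq_axis)

lemma nn_integral_lborel_vec_prod:
  fixes f :: "'n::finite \<Rightarrow> real \<Rightarrow> ennreal"
  assumes [measurable]: "\<And>i. f i \<in> borel_measurable borel"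
  shows "(\<integral>\<^sup>+x. (\<Prod>i\<in>UNIV. f i (x $ i)) \<partial>lborel) = (\<Prod>i\<in>UNIV. (\<integral>\<^sup>+t. f i t \<partial>lborel))"
proof -
  define e where "e b = (THE i. b = axis i (1::real))" for b :: "real^'n"
  have e [simp]: "e (axis i 1) = i" for i by (auto simp: e_def axis_eq_axis)
  have "(\<integral>\<^sup>+x. (\<Prod>b\<in>Basis. f (e b) (x \<bullet> b)) \<partial>lborel) = (\<Prod>b\<in>Basis. (\<integral>\<^sup>+t. f (e b) t \<partial>lborel))"
    by (rule nn_integral_lborel_prod) auto
  then show ?thesis by (simp add: prod_Basis_vec inner_axis)
qed

lemma borel_measurable_vec_nth' [measurable]: "(\<lambda>x::real^'n. x $ i) \<in> borel_measurable borel"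
  by (intro borel_measurable_continuous_onI continuous_intros)

text \<open>
  Lebesgue measure on \<open>real^'n\<close> is the image of the product measure indexed by the standard
  basis; this transports the product formula to coordinates indexed by \<open>'n\<close>.
\<close>

lemma lborel_vec_prod:
  fixes f :: "'n::finite \<Rightarrow> real \<Rightarrow> real"
  assumes f: "\<And>i. integrable lborel (f i)"
  shows "integrable lborel (\<lambda>x::real^'n. \<Prod>i\<in>UNIV. f i (x $ i))"
    and "(\<integral>x. (\<Prod>i\<in>UNIV. f i ((x::real^'n) $ i)) \<partial>lborel) = (\<Prod>i\<in>UNIV. (\<integral>t. f i t \<partial>lborel))"
proof -
  define e where "e b = (THE i. b = axis i (1::real))" for b :: "real^'n"
  have e [simp]: "e (axis i 1) = i" for i by (auto simp: e_def axis_eq_axis)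
  interpret product_sigma_finite "\<lambda>_::real^'n. lborel :: real measure" ..
  have [measurable]: "f i \<in> borel_measurable borel" for i using f by auto
  have m: "(\<lambda>g. \<Sum>b\<in>Basis. g b *\<^sub>R b) \<in> (\<Pi>\<^sub>M b\<in>Basis. lborel) \<rightarrow>\<^sub>M (borel :: (real^'n) measure)"
    by measurable
  have eq: "(\<Prod>i\<in>UNIV. f i ((\<Sum>b\<in>Basis. g b *\<^sub>R b) $ i)) = (\<Prod>b\<in>Basis. f (e b) (g b))" for g :: "real^'n \<Rightarrow> real"
  proof -
    have "(\<Sum>b\<in>Basis. g b *\<^sub>R b) $ i = g (axis i 1)" for i
    proof -
      have "(\<Sum>b\<in>Basis. g b *\<^sub>R b) $ i = (\<Sum>b\<in>Basis. g b *\<^sub>R b) \<bullet> axis i 1" by (simp add: inner_axis)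
      also have "\<dots> = g (axis i 1)" by (rule inner_sum_left_Basis) (auto simp: Basis_vec_real)
      finally show ?thesis .
    qed
    then show ?thesis by (simp add: prod_Basis_vec)
  qed
  have int: "integrable (\<Pi>\<^sub>M b\<in>Basis. lborel) (\<lambda>g. \<Prod>b\<in>(Basis::(real^'n) set). f (e b) (g b))"
    by (rule product_integrable_prod) (use f in auto)
  show "integrable lborel (\<lambda>x::real^'n. \<Prod>i\<in>UNIV. f i (x $ i))"
    unfolding lborel_eq[where 'a="real^'n"]
    using int by (subst integrable_distr_eq[OF m]) (simp_all only: eq, measurable)
  have "(\<integral>x. (\<Prod>i\<in>UNIV. f i ((x::real^'n) $ i)) \<partial>lborel)
      = (\<integral>g. (\<Prod>b\<in>(Basis::(real^'n) set). f (e b) (g b)) \<partial>(\<Pi>\<^sub>M b\<in>Basis. lborel))"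
    unfolding lborel_eq[where 'a="real^'n"]
    by (subst integral_distr[OF m]) (simp_all only: eq, measurable)
  also have "\<dots> = (\<Prod>b\<in>(Basis::(real^'n) set). (\<integral>t. f (e b) t \<partial>lborel))"
    by (rule product_integral_prod) (use f in auto)
  finally show "(\<integral>x. (\<Prod>i\<in>UNIV. f i ((x::real^'n) $ i)) \<partial>lborel) = (\<Prod>i\<in>UNIV. (\<integral>t. f i t \<partial>lborel))"
    by (simp add: prod_Basis_vec)
qed

lemma continuous_on_hermite [continuous_intros]: "continuous_on S (hermite \<xi>)"
  unfolding hermite_def[abs_def] by (intro continuous_intros)

lemma borel_measurable_hermite [measurable]: "hermite \<xi> \<in> borel_measurable borel"
  by (intro borel_measurable_continuous_onI continuous_intros)

lemma hermite_mult:
  "hermite \<xi> x * hermite \<eta> x = (\<Prod>j\<in>UNIV. hermite1 (\<xi> $ j) (x $ j) * hermite1 (\<eta> $ j) (x $ j))"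
  by (simp add: hermite_def prod.distrib)

lemma integrable_hermite_mult: "integrable lborel (\<lambda>x. hermite \<xi> x * hermite \<eta> x)"
  unfolding hermite_mult by (rule lborel_vec_prod) (rule integrable_hermite1_mult)

lemma hermite_orthonormal:
  "(\<integral>x. hermite \<xi> x * hermite \<eta> x \<partial>lborel) = (if \<xi> = \<eta> then 1 else 0)"
  unfolding hermite_mult
  by (subst lborel_vec_prod) (auto simp: integrable_hermite1_mult hermite1_orthonormal vec_eq_iff)

lemma hermite_split:
  "hermite \<xi> x = hermite1 (\<xi> $ i) (x $ i) * (\<Prod>j\<in>UNIV-{i}. hermite1 (\<xi> $ j) (x $ j))"
  unfolding hermite_def by (rule prod.remove) auto

text \<open>
  Moving the frequency in direction \<open>i\<close> changes only the \<open>i\<close>-th factor. In the second equation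
  truncated subtraction is harmless wherever it is applied: its coefficient vanishes for
  \<open>\<xi> $ i = 0\<close>.
\<close>

lemma hermite_shift:
  "hermite (\<xi> + axis i m) x = hermite1 (\<xi> $ i + m) (x $ i) * (\<Prod>j\<in>UNIV-{i}. hermite1 (\<xi> $ j) (x $ j))"
  "hermite (\<xi> - axis i m) x = hermite1 (\<xi> $ i - m) (x $ i) * (\<Prod>j\<in>UNIV-{i}. hermite1 (\<xi> $ j) (x $ j))"
  unfolding hermite_split[of _ x i] by (auto simp: axis_def intro!: prod.cong)

lemma hermite_derivative_aux:
  assumes "(hermite1 (\<xi> $ i) has_real_derivative d) (at (x $ i))"
  shows "((\<lambda>t. hermite \<xi> (x + t *\<^sub>R axis i 1)) has_real_derivative
     d * (\<Prod>j\<in>UNIV-{i}. hermite1 (\<xi> $ j) (x $ j))) (at 0)"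
proof -
  have "hermite \<xi> (x + t *\<^sub>R axis i 1)
      = hermite1 (\<xi> $ i) (x $ i + t) * (\<Prod>j\<in>UNIV-{i}. hermite1 (\<xi> $ j) (x $ j))" for t
    unfolding hermite_split[of _ _ i] by (auto simp: axis_def intro!: prod.cong)
  moreover have "((\<lambda>t. hermite1 (\<xi> $ i) (x $ i + t)) has_real_derivative d) (at 0)"
    using DERIV_shift[of "hermite1 (\<xi> $ i)" d 0 "x $ i"] assms by (simp add: add.commute)
  ultimately show ?thesis by (simp only: DERIV_cmult_right)
qed

lemma hermite_derivative_lower:
  "((\<lambda>t. hermite \<xi> (x + t *\<^sub>R axis i 1)) has_real_derivative
     sqrt (2 * real (\<xi> $ i)) * hermite (\<xi> - axis i 1) x - x $ i * hermite \<xi> x) (at 0)"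
  using hermite_derivative_aux[OF DERIV_hermite1_lower[of "\<xi> $ i" "x $ i"]]
  by (rule DERIV_cong) (simp add: hermite_shift hermite_split[of \<xi> x i] algebra_simps)

lemma hermite_derivative_raise:
  "((\<lambda>t. hermite \<xi> (x + t *\<^sub>R axis i 1)) has_real_derivative
     x $ i * hermite \<xi> x - sqrt (2 * real (\<xi> $ i + 1)) * hermite (\<xi> + axis i 1) x) (at 0)"
  using hermite_derivative_aux[OF DERIV_hermite1_raise[of "\<xi> $ i" "x $ i"]]
  by (rule DERIV_cong) (simp add: hermite_shift hermite_split[of \<xi> x i] algebra_simps)

lemma hermite_three_term:
  "x $ i * hermite \<xi> x = sqrt (real (\<xi> $ i) / 2) * hermite (\<xi> - axis i 1) x
     + sqrt (real (\<xi> $ i + 1) / 2) * hermite (\<xi> + axis i 1) x"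
  unfolding hermite_shift hermite_split[of \<xi> x i] mult.assoc[symmetric] hermite1_three_term
  by (simp add: algebra_simps)

text \<open>
  A common majorant, up to constants, for all Hermite functions and their products.
\<close>

definition decay :: "real^'n \<Rightarrow> real" where
  "decay x = (\<Prod>j\<in>UNIV. 1 / (1 + (x $ j)\<^sup>2))"

lemma decay_le_1: "decay x \<le> 1"
  unfolding decay_def by (rule prod_le_1) (auto simp: divide_le_eq)

lemma integrable_decay: "integrable lborel decay"
  unfolding decay_def[abs_def] by (rule lborel_vec_prod) (rule integrable_inverse_one_plus_square)

lemma decay_shift:
  fixes x :: "real^'n"
  assumes "0 \<le> s" "s \<le> 1"
  shows "decay (x + s *\<^sub>R axis i 1) \<le> 3 * decay x"
proof -
  have split: "decay y = 1 / (1 + (y $ i)\<^sup>2) * (\<Prod>j\<in>UNIV-{i}. 1 / (1 + (y $ j)\<^sup>2))" for y :: "real^'n"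
    unfolding decay_def by (rule prod.remove) auto
  have "decay (x + s *\<^sub>R axis i 1) = 1 / (1 + (x $ i + s)\<^sup>2) * (\<Prod>j\<in>UNIV-{i}. 1 / (1 + (x $ j)\<^sup>2))"
    unfolding split by (auto simp: axis_def intro!: prod.cong)
  also have "\<dots> \<le> 3 / (1 + (x $ i)\<^sup>2) * (\<Prod>j\<in>UNIV-{i}. 1 / (1 + (x $ j)\<^sup>2))"
    by (intro mult_right_mono inverse_one_plus_square_shift prod_nonneg) (use assms in auto)
  finally show ?thesis unfolding split by simp
qed

lemma hermite_decay: "\<exists>C>0. \<forall>x. \<bar>hermite \<xi> x\<bar> \<le> C * decay x"
proof -
  obtain c where c: "\<And>k. c k > 0" "\<And>k t. \<bar>hermite1 k t\<bar> \<le> c k / (1 + t\<^sup>2)"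
    using hermite1_decay by metis
  have "\<bar>hermite \<xi> x\<bar> \<le> (\<Prod>j\<in>UNIV. c (\<xi> $ j)) * decay x" for x
    unfolding hermite_def abs_prod decay_def prod.distrib[symmetric]
    by (rule prod_mono) (use c in auto)
  then show ?thesis using c by (intro exI[of _ "\<Prod>j\<in>UNIV. c (\<xi> $ j)"]) (auto intro: prod_pos)
qed

definition msize_ball :: "nat \<Rightarrow> (nat^'n) set" where
  "msize_ball N = {\<xi>. msize \<xi> \<le> N}"

lemma nth_le_msize: "\<xi> $ i \<le> msize \<xi>"
  unfolding msize_def by (rule member_le_sum) auto

lemma msize_add_axis [simp]: "msize (\<xi> + axis i m) = msize \<xi> + m"
proof -
  have "(\<Sum>j\<in>UNIV. axis i m $ j) = m"
    by (simp add: axis_def if_distrib cong: if_cong)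
  then show ?thesis by (simp add: msize_def sum.distrib)
qed

lemma finite_vec_bounded: "finite {\<xi> :: nat^'n. \<forall>i. \<xi> $ i \<le> N}"
proof -
  have "{\<xi> :: nat^'n. \<forall>i. \<xi> $ i \<le> N} \<subseteq> (\<lambda>g. \<chi> i. g i) ` (PiE UNIV (\<lambda>_. {..N}))"
  proof
    fix \<xi> :: "nat^'n" assume "\<xi> \<in> {\<xi>. \<forall>i. \<xi> $ i \<le> N}"
    then show "\<xi> \<in> (\<lambda>g. \<chi> i. g i) ` (PiE UNIV (\<lambda>_. {..N}))"
      by (intro image_eqI[of _ _ "\<lambda>i. \<xi> $ i"]) auto
  qed
  then show ?thesis by (rule finite_subset) (intro finite_imageI finite_PiE, auto)
qed

lemma msize_ball_subset: "msize_ball N \<subseteq> {\<xi> :: nat^'n. \<forall>i. \<xi> $ i \<le> N}"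
  using nth_le_msize order_trans by (fastforce simp: msize_ball_def)

lemma finite_msize_ball [simp]: "finite (msize_ball N)"
  by (rule finite_subset[OF msize_ball_subset finite_vec_bounded])

text \<open>
  The ball in \<open>|\<xi>|\<close> lies in a cube, where the sum factorises into one-dimensional sums.
\<close>

lemma sum_hermite_sq_le:
  fixes x :: "real^'n"
  shows "(\<Sum>\<xi>\<in>msize_ball N. (hermite \<xi> x)\<^sup>2) \<le> sqrt (2 * real (Suc N)) ^ CARD('n)"
proof -
  have "(\<Sum>\<xi>\<in>msize_ball N. (hermite \<xi> x)\<^sup>2) \<le> (\<Sum>\<xi>\<in>{\<xi>. \<forall>i. \<xi> $ i \<le> N}. (hermite \<xi> x)\<^sup>2)"
    by (rule sum_mono2[OF finite_vec_bounded msize_ball_subset]) auto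
  also have "\<dots> = (\<Sum>g\<in>PiE UNIV (\<lambda>_. {..N}). (hermite (\<chi> i. g i) x)\<^sup>2)"
    by (rule sum.reindex_bij_witness[of _ "\<lambda>g. \<chi> i. g i" "\<lambda>\<xi> i. \<xi> $ i"]) auto
  also have "\<dots> = (\<Sum>g\<in>PiE UNIV (\<lambda>_. {..N}). \<Prod>j\<in>UNIV. (hermite1 (g j) (x $ j))\<^sup>2)"
    by (simp add: hermite_def prod_power_distrib)
  also have "\<dots> = (\<Prod>j\<in>UNIV. \<Sum>k\<in>{..N}. (hermite1 k (x $ j))\<^sup>2)"
    by (rule prod_sum_PiE[symmetric]) auto
  also have "\<dots> \<le> (\<Prod>j\<in>(UNIV::'n set). sqrt (2 * real (Suc N)))"
    by (intro prod_mono conjI sum_nonneg)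
      (simp_all only: lessThan_Suc_atMost[symmetric] sum_hermite1_sq_le zero_le_power2)
  finally show ?thesis by simp
qed

text \<open>
  The frequencies are reindexed by an injection \<open>g\<close>, so that the identity also applies to sums
  of Hermite functions with shifted frequencies.
\<close>

lemma hermite_parseval:
  fixes g :: "'i \<Rightarrow> nat^'n" and b :: "'i \<Rightarrow> complex"
  assumes "finite S" and inj: "inj_on g S"
  shows "integrable lborel (\<lambda>y. (cmod (\<Sum>\<xi>\<in>S. b \<xi> * complex_of_real (hermite (g \<xi>) y)))\<^sup>2)"
    and "(\<integral>y. (cmod (\<Sum>\<xi>\<in>S. b \<xi> * complex_of_real (hermite (g \<xi>) y)))\<^sup>2 \<partial>lborel) = (\<Sum>\<xi>\<in>S. (cmod (b \<xi>))\<^sup>2)"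
proof -
  have eq: "(cmod (\<Sum>\<xi>\<in>S. b \<xi> * complex_of_real (hermite (g \<xi>) y)))\<^sup>2
      = (\<Sum>\<xi>\<in>S. \<Sum>\<eta>\<in>S. Re (b \<xi> * cnj (b \<eta>)) * (hermite (g \<xi>) y * hermite (g \<eta>) y))" for y
  proof -
    have "complex_of_real ((cmod (\<Sum>\<xi>\<in>S. b \<xi> * complex_of_real (hermite (g \<xi>) y)))\<^sup>2)
      = (\<Sum>\<xi>\<in>S. \<Sum>\<eta>\<in>S. b \<xi> * complex_of_real (hermite (g \<xi>) y) * (cnj (b \<eta>) * complex_of_real (hermite (g \<eta>) y)))"
      unfolding complex_norm_square by (simp add: sum_product)
    then have "(cmod (\<Sum>\<xi>\<in>S. b \<xi> * complex_of_real (hermite (g \<xi>) y)))\<^sup>2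
      = (\<Sum>\<xi>\<in>S. \<Sum>\<eta>\<in>S. Re (b \<xi> * complex_of_real (hermite (g \<xi>) y) * (cnj (b \<eta>) * complex_of_real (hermite (g \<eta>) y))))"
      by (metis (no_types, lifting) Re_complex_of_real Re_sum sum.cong)
    also have "\<dots> = (\<Sum>\<xi>\<in>S. \<Sum>\<eta>\<in>S. Re (b \<xi> * cnj (b \<eta>)) * (hermite (g \<xi>) y * hermite (g \<eta>) y))"
      by (intro sum.cong refl) (simp add: algebra_simps)
    finally show ?thesis .
  qed
  show "integrable lborel (\<lambda>y. (cmod (\<Sum>\<xi>\<in>S. b \<xi> * complex_of_real (hermite (g \<xi>) y)))\<^sup>2)"
    unfolding eq by (intro Bochner_Integration.integrable_sum integrable_mult_right integrable_hermite_mult)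
  have "(\<integral>y. (cmod (\<Sum>\<xi>\<in>S. b \<xi> * complex_of_real (hermite (g \<xi>) y)))\<^sup>2 \<partial>lborel)
    = (\<Sum>\<xi>\<in>S. \<Sum>\<eta>\<in>S. Re (b \<xi> * cnj (b \<eta>)) * (if g \<xi> = g \<eta> then 1 else 0))"
    unfolding eq by (simp add: integrable_hermite_mult hermite_orthonormal)
  also have "\<dots> = (\<Sum>\<xi>\<in>S. \<Sum>\<eta>\<in>S. if \<xi> = \<eta> then (cmod (b \<xi>))\<^sup>2 else 0)"
    using inj by (intro sum.cong refl) (auto simp: inj_on_eq_iff cmod_power2, auto simp: power2_eq_square)
  also have "\<dots> = (\<Sum>\<xi>\<in>S. (cmod (b \<xi>))\<^sup>2)" using assms(1) by simp
  finally show "(\<integral>y. (cmod (\<Sum>\<xi>\<in>S. b \<xi> * complex_of_real (hermite (g \<xi>) y)))\<^sup>2 \<partial>lborel) = (\<Sum>\<xi>\<in>S. (cmod (b \<xi>))\<^sup>2)" .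
qed

section \<open>The kernel and multiplication by a coordinate difference\<close>

text \<open>
  On \<open>G i j = H\<^sub>i(s) H\<^sub>j(t)\<close> this is the difference of the creation operators in \<open>t\<close> and in \<open>s\<close>,
  written on unnormalised Hermite polynomials, where creation is a plain index shift.
\<close>

definition dshift :: "(nat \<Rightarrow> nat \<Rightarrow> real) \<Rightarrow> nat \<Rightarrow> nat \<Rightarrow> real" where
  "dshift G i j = G i (Suc j) - G (Suc i) j"

definition hermite_shift_poly :: "nat \<Rightarrow> real \<Rightarrow> real \<Rightarrow> nat \<Rightarrow> nat \<Rightarrow> real" where
  "hermite_shift_poly p s t = (dshift ^^ p) (\<lambda>i j. hermite_poly i s * hermite_poly j t)"

lemma hermite_shift_poly_0: "hermite_shift_poly 0 s t i j = hermite_poly i s * hermite_poly j t"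
  by (simp add: hermite_shift_poly_def)

lemma hermite_shift_poly_Suc:
  "hermite_shift_poly (Suc p) s t i j = hermite_shift_poly p s t i (Suc j) - hermite_shift_poly p s t (Suc i) j"
  by (simp add: hermite_shift_poly_def dshift_def)

text \<open>
  Multiplication by a variable is half the sum of creation and annihilation. The annihilation
  terms are those with \<open>j - 1\<close> and \<open>i - 1\<close>, and the last term is the commutator of \<open>t - s\<close> with
  \<open>p\<close> differences of creation operators.
\<close>

lemma hermite_shift_poly_commutator:
  "2 * (t - s) * hermite_shift_poly p s t i j = hermite_shift_poly (Suc p) s t i j
     + 2 * real j * hermite_shift_poly p s t i (j - 1) - 2 * real i * hermite_shift_poly p s t (i - 1) j
     + 4 * real p * hermite_shift_poly (p - 1) s t i j"
proof (induction p arbitrary: i j)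
  case 0
  show ?case
    by (simp add: hermite_shift_poly_0 hermite_shift_poly_Suc hermite_poly_Suc algebra_simps)
next
  case (Suc p)
  let ?B = "\<lambda>p. hermite_shift_poly p s t"
  have j: "2 * real j * ?B (Suc p) i (j - 1) = 2 * real j * (?B p i j - ?B p (Suc i) (j - 1))"
    by (cases j) (auto simp: hermite_shift_poly_Suc)
  have i: "2 * real i * ?B (Suc p) (i - 1) j = 2 * real i * (?B p (i - 1) (Suc j) - ?B p i j)"
    by (cases i) (auto simp: hermite_shift_poly_Suc)
  have p: "4 * real p * ?B (p - 1) i (Suc j) - 4 * real p * ?B (p - 1) (Suc i) j = 4 * real p * ?B p i j"
    by (cases p) (auto simp: hermite_shift_poly_Suc algebra_simps)
  have "2 * (t - s) * ?B (Suc p) i j = 2 * (t - s) * ?B p i (Suc j) - 2 * (t - s) * ?B p (Suc i) j"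
    by (simp add: hermite_shift_poly_Suc algebra_simps)
  also have "\<dots> = ?B (Suc (Suc p)) i j + 2 * real (Suc j) * ?B p i j - 2 * real i * ?B p (i - 1) (Suc j)
      - 2 * real j * ?B p (Suc i) (j - 1) + 2 * real (Suc i) * ?B p i j
      + (4 * real p * ?B (p - 1) i (Suc j) - 4 * real p * ?B (p - 1) (Suc i) j)"
    unfolding Suc.IH[of i "Suc j"] Suc.IH[of "Suc i" j] hermite_shift_poly_Suc[of "Suc p"] by simp
  also have "\<dots> = ?B (Suc (Suc p)) i j + 2 * real j * ?B (Suc p) i (j - 1)
      - 2 * real i * ?B (Suc p) (i - 1) j + 4 * real (Suc p) * ?B p i j"
    unfolding i j p by (simp add: algebra_simps)
  finally show ?case by simp
qed

definition hermite_others :: "'n::finite \<Rightarrow> nat^'n \<Rightarrow> real^'n \<Rightarrow> real" where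
  "hermite_others i \<xi> x = (\<Prod>j\<in>UNIV-{i}. hermite1 (\<xi> $ j) (x $ j))"

text \<open>
  This is \<open>h\<^sub>\<xi>(x) h\<^sub>\<xi>(y)\<close> with \<open>p\<close> differences of creation operators applied in direction \<open>i\<close>,
  evaluated at indices shifted by \<open>r\<close> and \<open>r'\<close>. The shifts are carried along because estimating
  a difference separates its two halves.
\<close>

definition kernel_term :: "'n::finite \<Rightarrow> nat \<Rightarrow> nat \<Rightarrow> nat \<Rightarrow> nat^'n \<Rightarrow> real^'n \<Rightarrow> real^'n \<Rightarrow> real" where
  "kernel_term i p r r' \<xi> x y = (hermite_const (\<xi> $ i))\<^sup>2 * exp (- (x $ i)\<^sup>2 / 2) * exp (- (y $ i)\<^sup>2 / 2)
     * hermite_shift_poly p (x $ i) (y $ i) (\<xi> $ i + r) (\<xi> $ i + r')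
     * hermite_others i \<xi> x * hermite_others i \<xi> y"

definition kernel_sum ::
    "'n::finite \<Rightarrow> nat \<Rightarrow> nat \<Rightarrow> nat \<Rightarrow> (nat^'n \<Rightarrow> complex) \<Rightarrow> nat \<Rightarrow> real^'n \<Rightarrow> real^'n \<Rightarrow> complex" where
  "kernel_sum i p r r' a N x y = (\<Sum>\<xi>\<in>msize_ball N. a \<xi> * complex_of_real (kernel_term i p r r' \<xi> x y))"

lemma kernel_sum_Suc:
  "kernel_sum i (Suc p) r r' a N x y = kernel_sum i p r (Suc r') a N x y - kernel_sum i p (Suc r) r' a N x y"
  unfolding kernel_sum_def kernel_term_def hermite_shift_poly_Suc
  by (simp add: sum_subtractf[symmetric] algebra_simps)

text \<open>
  The factor produced by applying the creation operator \<open>r\<close> times to \<open>h\<^sub>k\<close>.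
\<close>

definition raise_const :: "nat \<Rightarrow> nat \<Rightarrow> real" where
  "raise_const k r = hermite_const k / hermite_const (k + r)"

lemma raise_const_0 [simp]: "raise_const k 0 = 1"
  using hermite_const_pos[of k] by (simp add: raise_const_def)

lemma raise_const_sq_le: "(raise_const k r)\<^sup>2 \<le> 2 ^ r * fact r * (1 + real k) ^ r"
proof (induction r)
  case (Suc r)
  have "raise_const k (Suc r) = raise_const k r * sqrt (2 * real (k + r + 1))"
    using hermite_const_pos[of "k + r"] hermite_const_pos[of "Suc (k + r)"]
    by (simp add: raise_const_def hermite_const_Suc[of "k + r"] del: of_nat_add of_nat_Suc)
  then have "(raise_const k (Suc r))\<^sup>2 = (raise_const k r)\<^sup>2 * (2 * real (k + r + 1))"
    by (simp add: power_mult_distrib)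
  also have "\<dots> \<le> (2 ^ r * fact r * (1 + real k) ^ r) * (2 * (real (r + 1) * (1 + real k)))"
    by (intro mult_mono Suc.IH) (auto simp: algebra_simps)
  finally show ?case by (simp add: algebra_simps)
qed simp

lemma kernel_term_0:
  "kernel_term i 0 r r' \<xi> x y = raise_const (\<xi> $ i) r * raise_const (\<xi> $ i) r'
     * hermite (\<xi> + axis i r) x * hermite (\<xi> + axis i r') y"
proof -
  have h: "hermite_const k * hermite_poly (k + r) s * exp (- s\<^sup>2 / 2) = raise_const k r * hermite1 (k + r) s" for k r s
    using hermite_const_pos[of "k + r"] by (simp add: raise_const_def hermite1_eq)
  have "kernel_term i 0 r r' \<xi> x y
      = (hermite_const (\<xi> $ i) * hermite_poly (\<xi> $ i + r) (x $ i) * exp (- (x $ i)\<^sup>2 / 2))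
        * (hermite_const (\<xi> $ i) * hermite_poly (\<xi> $ i + r') (y $ i) * exp (- (y $ i)\<^sup>2 / 2))
        * hermite_others i \<xi> x * hermite_others i \<xi> y"
    unfolding kernel_term_def hermite_shift_poly_0 power2_eq_square by (simp only: mult_ac)
  then show ?thesis
    unfolding h hermite_shift hermite_others_def by (simp only: mult_ac)
qed

lemma add_axis_0: "\<xi> + axis i (0::nat) = \<xi>"
  by (simp add: vec_eq_iff axis_def)

lemma kernel_sum_0:
  "kernel_sum i 0 0 0 a N x y = (\<Sum>\<xi>\<in>msize_ball N. a \<xi> * complex_of_real (hermite \<xi> x * hermite \<xi> y))"
  by (simp only: kernel_sum_def kernel_term_0 raise_const_0 mult_1 add_axis_0)

text \<open>
  On the diagonal \<open>i = j\<close> the two annihilation terms combine to one more difference of creation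
  operators at the preceding frequency, because \<open>2 k c\<^sub>k^2 = c\<^sub>(k-1)^2\<close> for the normalising
  constants.
\<close>

lemma kernel_term_commutator:
  "2 * (y $ i - x $ i) * kernel_term i p 0 0 \<xi> x y = kernel_term i (Suc p) 0 0 \<xi> x y
     - (if \<xi> $ i = 0 then 0 else kernel_term i (Suc p) 0 0 (\<xi> - axis i 1) x y)
     + 4 * real p * kernel_term i (p - 1) 0 0 \<xi> x y"
proof -
  let ?B = "\<lambda>p. hermite_shift_poly p (x $ i) (y $ i)" and ?k = "\<xi> $ i"
  define E where "E = exp (- (x $ i)\<^sup>2 / 2) * exp (- (y $ i)\<^sup>2 / 2) * hermite_others i \<xi> x * hermite_others i \<xi> y"
  have T: "kernel_term i p 0 0 \<xi> x y = (hermite_const ?k)\<^sup>2 * ?B p ?k ?k * E" for p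
    by (simp add: kernel_term_def E_def)
  \<comment> \<open>The two annihilation terms, collected at the preceding frequency.\<close>
  have low: "(if ?k = 0 then 0 else kernel_term i (Suc p) 0 0 (\<xi> - axis i 1) x y)
      = (hermite_const ?k)\<^sup>2 * (2 * real ?k * (?B p (?k - 1) ?k - ?B p ?k (?k - 1))) * E"
  proof (cases ?k)
    case (Suc k)
    have sh: "hermite_others i (\<xi> - axis i 1) z = hermite_others i \<xi> z" for z
      by (auto simp: hermite_others_def axis_def intro!: prod.cong)
    have c: "(hermite_const k)\<^sup>2 = (hermite_const ?k)\<^sup>2 * (2 * real ?k)"
      using Suc by (simp add: hermite_const_Suc[of k] power_mult_distrib)
    have "kernel_term i (Suc p) 0 0 (\<xi> - axis i 1) x y = (hermite_const k)\<^sup>2 * ?B (Suc p) k k * E"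
      using Suc by (simp add: kernel_term_def E_def sh del: One_nat_def)
    then show ?thesis using Suc by (simp add: c hermite_shift_poly_Suc del: One_nat_def)
  qed simp
  have "2 * (y $ i - x $ i) * kernel_term i p 0 0 \<xi> x y
      = (hermite_const ?k)\<^sup>2 * (2 * (y $ i - x $ i) * ?B p ?k ?k) * E"
    by (simp add: T)
  then show ?thesis
    unfolding hermite_shift_poly_commutator low T by (simp add: algebra_simps)
qed

text \<open>
  Summation by parts without boundary terms: the lowest layer carries no mass, and the sum may
  be taken over the same ball because the summand vanishes outside.
\<close>

lemma sum_msize_ball_shift:
  fixes g :: "nat^'n \<Rightarrow> 'b::comm_monoid_add"
  assumes "\<And>\<xi>. msize \<xi> > N \<Longrightarrow> g \<xi> = 0" and "\<And>\<xi>. \<xi> $ i = 0 \<Longrightarrow> g \<xi> = 0"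
  shows "(\<Sum>\<xi>\<in>msize_ball N. g \<xi>) = (\<Sum>\<xi>\<in>msize_ball N. g (\<xi> + axis i 1))"
proof -
  let ?f = "\<lambda>\<xi>. \<xi> + axis i 1"
  have inj: "inj_on ?f (msize_ball N)" by (rule inj_onI) simp
  have "(\<Sum>\<xi>\<in>msize_ball N. g \<xi>) = (\<Sum>\<xi>\<in>?f ` msize_ball N. g \<xi>)"
  proof (rule sum.mono_neutral_cong)
    fix \<xi> assume "\<xi> \<in> msize_ball N - ?f ` msize_ball N"
    moreover have "\<xi> \<in> ?f ` msize_ball N" if "\<xi> $ i > 0" "\<xi> \<in> msize_ball N"
    proof
      show "\<xi> = (\<xi> - axis i 1) + axis i 1" using that by (auto simp: vec_eq_iff axis_def)
      then have "msize \<xi> = msize (\<xi> - axis i 1) + 1" using msize_add_axis by metis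
      then show "\<xi> - axis i 1 \<in> msize_ball N" using that by (simp add: msize_ball_def)
    qed
    ultimately show "g \<xi> = 0" using assms(2) by blast
  next
    show "finite (msize_ball N)" "finite (?f ` msize_ball N)" by simp_all
  qed (use assms(1) in \<open>auto simp: msize_ball_def not_le\<close>)
  also have "\<dots> = (\<Sum>\<xi>\<in>msize_ball N. g (?f \<xi>))" using inj by (simp add: sum.reindex)
  finally show ?thesis .
qed

text \<open>
  After the shift of frequencies the two terms with one more creation difference combine to the
  finite difference of the coefficients.
\<close>

lemma kernel_sum_commutator:
  assumes a: "\<And>\<xi>. msize \<xi> > N \<Longrightarrow> a \<xi> = 0"
  shows "complex_of_real (y $ i - x $ i) * kernel_sum i p 0 0 a N x y
     = - (1 / 2) * kernel_sum i (Suc p) 0 0 (fdiff i a) N x y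
       + 2 * of_nat p * kernel_sum i (p - 1) 0 0 a N x y"
proof -
  define g where "g \<xi> = (if \<xi> $ i = 0 then 0 else a \<xi> * complex_of_real (kernel_term i (Suc p) 0 0 (\<xi> - axis i 1) x y))" for \<xi>
  have g: "(\<Sum>\<xi>\<in>msize_ball N. g \<xi>) = (\<Sum>\<xi>\<in>msize_ball N. a (\<xi> + axis i 1) * complex_of_real (kernel_term i (Suc p) 0 0 \<xi> x y))"
    by (subst sum_msize_ball_shift[of N g i]) (auto simp: g_def a axis_def)
  have "2 * (complex_of_real (y $ i - x $ i) * kernel_sum i p 0 0 a N x y)
      = (\<Sum>\<xi>\<in>msize_ball N. a \<xi> * complex_of_real (2 * (y $ i - x $ i) * kernel_term i p 0 0 \<xi> x y))"
    unfolding kernel_sum_def sum_distrib_left by (intro sum.cong refl) (simp add: mult_ac)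
  also have "\<dots> = (\<Sum>\<xi>\<in>msize_ball N. a \<xi> * complex_of_real (kernel_term i (Suc p) 0 0 \<xi> x y) - g \<xi>
      + 4 * of_nat p * (a \<xi> * complex_of_real (kernel_term i (p - 1) 0 0 \<xi> x y)))"
    unfolding kernel_term_commutator by (intro sum.cong refl) (simp add: g_def algebra_simps)
  also have "\<dots> = kernel_sum i (Suc p) 0 0 a N x y - (\<Sum>\<xi>\<in>msize_ball N. g \<xi>) + 4 * of_nat p * kernel_sum i (p - 1) 0 0 a N x y"
    by (simp add: kernel_sum_def sum.distrib sum_subtractf sum_distrib_left)
  also have "\<dots> = - kernel_sum i (Suc p) 0 0 (fdiff i a) N x y + 4 * of_nat p * kernel_sum i (p - 1) 0 0 a N x y"
    unfolding g by (simp add: kernel_sum_def fdiff_def sum_subtractf[symmetric] sum_negf[symmetric] algebra_simps)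
  finally show ?thesis by (simp add: field_simps)
qed

text \<open>
  The squared \<open>L^2\<close> norm, with value \<open>\<infinity>\<close> for functions outside \<open>L^2\<close>.
\<close>

definition sqn :: "('a::euclidean_space \<Rightarrow> complex) \<Rightarrow> ennreal" where
  "sqn f = (\<integral>\<^sup>+y. ennreal ((cmod (f y))\<^sup>2) \<partial>lborel)"

lemma norm_add_sq_le: "(norm (u + v))\<^sup>2 \<le> 2 * (norm u)\<^sup>2 + 2 * (norm v)\<^sup>2" for u v :: "'b::real_normed_vector"
proof -
  have "(norm (u + v))\<^sup>2 \<le> (norm u + norm v)\<^sup>2" by (intro power_mono norm_triangle_ineq) auto
  then show ?thesis using sum_squares_bound[of "norm u" "norm v"] by (simp add: power2_sum)
qed

lemma sqn_add_le:
  assumes [measurable]: "f \<in> borel_measurable borel" "g \<in> borel_measurable borel"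
  shows "sqn (\<lambda>y. f y + g y) \<le> 2 * sqn f + 2 * sqn g"
proof -
  have "sqn (\<lambda>y. f y + g y) \<le> (\<integral>\<^sup>+y. 2 * ennreal ((cmod (f y))\<^sup>2) + 2 * ennreal ((cmod (g y))\<^sup>2) \<partial>lborel)"
    unfolding sqn_def
  proof (rule nn_integral_mono)
    fix y
    have "ennreal ((cmod (f y + g y))\<^sup>2) \<le> ennreal (2 * (cmod (f y))\<^sup>2 + 2 * (cmod (g y))\<^sup>2)"
      by (rule ennreal_leI[OF norm_add_sq_le])
    then show "ennreal ((cmod (f y + g y))\<^sup>2) \<le> 2 * ennreal ((cmod (f y))\<^sup>2) + 2 * ennreal ((cmod (g y))\<^sup>2)"
      by (simp add: ennreal_mult)
  qed
  also have "\<dots> = 2 * sqn f + 2 * sqn g"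
    unfolding sqn_def by (simp add: nn_integral_add nn_integral_cmult)
  finally show ?thesis .
qed

lemma sqn_cmult:
  assumes [measurable]: "f \<in> borel_measurable borel"
  shows "sqn (\<lambda>y. c * f y) = ennreal ((cmod c)\<^sup>2) * sqn f"
  unfolding sqn_def by (simp add: norm_mult power_mult_distrib ennreal_mult nn_integral_cmult)

lemma borel_measurable_kernel_sum [measurable]: "kernel_sum i p r r' a N x \<in> borel_measurable borel"
proof (induction p arbitrary: r r')
  case 0
  show ?case unfolding kernel_sum_def[abs_def] kernel_term_0 by measurable
next
  case (Suc p)
  note Suc.IH [measurable]
  show ?case unfolding kernel_sum_Suc[abs_def] by measurable
qed

lemma jbracket_ge_1: "1 \<le> jbracket \<xi>" and jbracket_pos [simp]: "0 < jbracket \<xi>"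
  by (auto simp: jbracket_def)

text \<open>
  Each creation operator on \<open>h\<^sub>\<xi>\<close> costs at most the square root of \<open>1 + |\<xi>|\<close>, up to constants,
  and orthonormality in \<open>y\<close> removes the off-diagonal terms. The shifts \<open>q\<close> on the right record
  how many creation operators have fallen on \<open>x\<close>.
\<close>

lemma sqn_kernel_sum_le:
  "\<exists>C\<ge>0. \<forall>a N x. sqn (kernel_sum i p r r' a N x)
     \<le> ennreal (C * (\<Sum>\<xi>\<in>msize_ball N. (cmod (a \<xi>))\<^sup>2 * jbracket \<xi> ^ (p + r + r') * (\<Sum>q\<le>p + r. (hermite (\<xi> + axis i q) x)\<^sup>2)))"
proof (induction p arbitrary: r r')
  case 0
  define C :: real where "C = (2 ^ r * fact r) * (2 ^ r' * fact r')"
  have "sqn (kernel_sum i 0 r r' a N x)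
     \<le> ennreal (C * (\<Sum>\<xi>\<in>msize_ball N. (cmod (a \<xi>))\<^sup>2 * jbracket \<xi> ^ (r + r') * (\<Sum>q\<le>r. (hermite (\<xi> + axis i q) x)\<^sup>2)))" for a N x
  proof -
    define b where "b \<xi> = a \<xi> * complex_of_real (raise_const (\<xi> $ i) r * raise_const (\<xi> $ i) r' * hermite (\<xi> + axis i r) x)" for \<xi>
    have eq: "kernel_sum i 0 r r' a N x = (\<lambda>y. \<Sum>\<xi>\<in>msize_ball N. b \<xi> * complex_of_real (hermite (\<xi> + axis i r') y))"
      by (simp add: fun_eq_iff kernel_sum_def kernel_term_0 b_def mult_ac)
    have inj: "inj_on (\<lambda>\<xi>. \<xi> + axis i r') (msize_ball N)" by (rule inj_onI) simp
    have "sqn (kernel_sum i 0 r r' a N x) = ennreal (\<Sum>\<xi>\<in>msize_ball N. (cmod (b \<xi>))\<^sup>2)"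
      unfolding sqn_def eq hermite_parseval(2)[OF finite_msize_ball inj, symmetric]
      by (rule nn_integral_eq_integral[OF hermite_parseval(1)[OF finite_msize_ball inj]]) simp
    also have "\<dots> \<le> ennreal (C * (\<Sum>\<xi>\<in>msize_ball N. (cmod (a \<xi>))\<^sup>2 * jbracket \<xi> ^ (r + r') * (\<Sum>q\<le>r. (hermite (\<xi> + axis i q) x)\<^sup>2)))"
      unfolding sum_distrib_left[of C]
    proof (intro ennreal_leI sum_mono)
      fix \<xi>
      have k: "1 + real (\<xi> $ i) \<le> jbracket \<xi>" using nth_le_msize[of \<xi> i] by (simp add: jbracket_def)
      have w: "(raise_const (\<xi> $ i) r)\<^sup>2 \<le> 2 ^ r * fact r * jbracket \<xi> ^ r" for r
        by (rule order_trans[OF raise_const_sq_le]) (intro mult_left_mono power_mono k, auto)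
      have "(cmod (b \<xi>))\<^sup>2 = (cmod (a \<xi>))\<^sup>2 * ((raise_const (\<xi> $ i) r)\<^sup>2 * (raise_const (\<xi> $ i) r')\<^sup>2) * (hermite (\<xi> + axis i r) x)\<^sup>2"
        by (simp add: b_def norm_mult power_mult_distrib)
      also have "\<dots> \<le> (cmod (a \<xi>))\<^sup>2 * ((2 ^ r * fact r * jbracket \<xi> ^ r) * (2 ^ r' * fact r' * jbracket \<xi> ^ r'))
          * (\<Sum>q\<le>r. (hermite (\<xi> + axis i q) x)\<^sup>2)"
        by (intro mult_mono w order_refl member_le_sum mult_nonneg_nonneg) (auto intro: less_imp_le)
      also have "\<dots> = C * ((cmod (a \<xi>))\<^sup>2 * jbracket \<xi> ^ (r + r') * (\<Sum>q\<le>r. (hermite (\<xi> + axis i q) x)\<^sup>2))"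
        by (simp add: C_def power_add mult_ac)
      finally show "(cmod (b \<xi>))\<^sup>2 \<le> C * ((cmod (a \<xi>))\<^sup>2 * jbracket \<xi> ^ (r + r') * (\<Sum>q\<le>r. (hermite (\<xi> + axis i q) x)\<^sup>2))" .
    qed
    finally show ?thesis .
  qed
  then show ?case by (intro exI[of _ C]) (auto simp: C_def)
next
  case (Suc p)
  let ?b = "\<lambda>p r r' a N x. \<Sum>\<xi>\<in>msize_ball N. (cmod (a \<xi>))\<^sup>2 * jbracket \<xi> ^ (p + r + r') * (\<Sum>q\<le>p + r. (hermite (\<xi> + axis i q) x)\<^sup>2)"
  obtain C where C: "C \<ge> 0" "\<And>a N x. sqn (kernel_sum i p r (Suc r') a N x) \<le> ennreal (C * ?b p r (Suc r') a N x)"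
    using Suc.IH[of r "Suc r'"] by blast
  obtain D where D: "D \<ge> 0" "\<And>a N x. sqn (kernel_sum i p (Suc r) r' a N x) \<le> ennreal (D * ?b p (Suc r) r' a N x)"
    using Suc.IH[of "Suc r" r'] by blast
  show ?case
  proof (intro exI conjI allI)
    fix a N x
    have le: "?b p r (Suc r') a N x \<le> ?b (Suc p) r r' a N x" "?b p (Suc r) r' a N x \<le> ?b (Suc p) r r' a N x"
    proof -
      have m: "(\<Sum>q\<le>p + r. (hermite (\<xi> + axis i q) x)\<^sup>2) \<le> (\<Sum>q\<le>Suc p + r. (hermite (\<xi> + axis i q) x)\<^sup>2)" for \<xi>
        by (rule sum_mono2) auto
      show "?b p r (Suc r') a N x \<le> ?b (Suc p) r r' a N x"
        unfolding add_Suc_right add_Suc_shift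
        by (intro sum_mono mult_left_mono m[unfolded add_Suc_shift add_Suc_right] mult_nonneg_nonneg sum_nonneg zero_le_power2 zero_le_power[OF less_imp_le[OF jbracket_pos]])
      show "?b p (Suc r) r' a N x \<le> ?b (Suc p) r r' a N x" by simp
    qed
    have b0: "0 \<le> ?b p r (Suc r') a N x" "0 \<le> ?b p (Suc r) r' a N x"
      by (intro conjI sum_nonneg mult_nonneg_nonneg zero_le_power2 zero_le_power[OF less_imp_le[OF jbracket_pos]])+
    have "sqn (kernel_sum i (Suc p) r r' a N x)
        = sqn (\<lambda>y. kernel_sum i p r (Suc r') a N x y + (- 1) * kernel_sum i p (Suc r) r' a N x y)"
      by (simp add: kernel_sum_Suc[abs_def])
    also have "\<dots> \<le> 2 * sqn (kernel_sum i p r (Suc r') a N x) + 2 * sqn (\<lambda>y. (- 1) * kernel_sum i p (Suc r) r' a N x y)"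
      by (rule sqn_add_le) measurable
    also have "\<dots> = 2 * sqn (kernel_sum i p r (Suc r') a N x) + 2 * sqn (kernel_sum i p (Suc r) r' a N x)"
      by (subst sqn_cmult) (auto simp: borel_measurable_kernel_sum)
    also have "\<dots> \<le> 2 * ennreal (C * ?b p r (Suc r') a N x) + 2 * ennreal (D * ?b p (Suc r) r' a N x)"
      by (intro add_mono mult_left_mono C D) auto
    also have "\<dots> = ennreal (2 * (C * ?b p r (Suc r') a N x) + 2 * (D * ?b p (Suc r) r' a N x))"
      using C(1) D(1) b0 by (simp add: ennreal_mult ennreal_plus)
    also have "\<dots> \<le> ennreal (2 * (C * ?b (Suc p) r r' a N x) + 2 * (D * ?b (Suc p) r r' a N x))"
      using C(1) D(1) le by (intro ennreal_leI add_mono mult_left_mono) auto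
    also have "\<dots> = ennreal ((2 * C + 2 * D) * ?b (Suc p) r r' a N x)" by (simp add: algebra_simps)
    finally show "sqn (kernel_sum i (Suc p) r r' a N x) \<le> ennreal ((2 * C + 2 * D) * ?b (Suc p) r r' a N x)" .
  qed (use C D in auto)
qed

text \<open>
  Induction on \<open>M\<close> with the commutator identity. It trades a factor \<open>y\<^sub>i - x\<^sub>i\<close> either for a
  difference of \<open>a\<close> and one more creation operator, that is for the weight \<open>\<langle>\<xi>\<rangle>^(-1) \<langle>\<xi>\<rangle>^(1/2)\<close>,
  or for one creation operator less, again \<open>\<langle>\<xi>\<rangle>^(-1/2)\<close>. Formulated with an arbitrary majorant
  \<open>\<psi>\<close>, the hypothesis passes from \<open>a\<close> to its difference with \<open>\<psi> \<xi> / \<langle>\<xi>\<rangle>\<close> in place of \<open>\<psi>\<close>, so no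
  explicit expansion is needed.
\<close>

lemma sqn_weighted_kernel_sum_le:
  "\<exists>C\<ge>0. \<forall>a \<psi> N x. (\<forall>\<xi>. msize \<xi> > N \<longrightarrow> a \<xi> = 0) \<longrightarrow>
     (\<forall>l\<le>M. \<forall>\<xi>. cmod ((fdiff i ^^ l) a \<xi>) \<le> \<psi> \<xi> / jbracket \<xi> ^ l) \<longrightarrow>
     sqn (\<lambda>y. complex_of_real (y $ i - x $ i) ^ M * kernel_sum i p 0 0 a N x y)
     \<le> ennreal (C * (\<Sum>\<xi>\<in>msize_ball N. (\<psi> \<xi>)\<^sup>2 * jbracket \<xi> ^ p / jbracket \<xi> ^ M
          * (\<Sum>q\<le>p + M. (hermite (\<xi> + axis i q) x)\<^sup>2)))"
proof (induction M arbitrary: p)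
  case 0
  \<comment> \<open>Without a factor \<open>y\<^sub>i - x\<^sub>i\<close> this is the estimate for creation operators alone.\<close>
  obtain C where C: "C \<ge> 0" "\<And>a N x. sqn (kernel_sum i p 0 0 a N x)
     \<le> ennreal (C * (\<Sum>\<xi>\<in>msize_ball N. (cmod (a \<xi>))\<^sup>2 * jbracket \<xi> ^ (p + 0 + 0) * (\<Sum>q\<le>p + 0. (hermite (\<xi> + axis i q) x)\<^sup>2)))"
    using sqn_kernel_sum_le[of i p 0 0] by blast
  show ?case
  proof (intro exI conjI allI impI)
    fix a \<psi> N x
    assume "\<forall>l\<le>0. \<forall>\<xi>. cmod ((fdiff i ^^ l) a \<xi>) \<le> \<psi> \<xi> / jbracket \<xi> ^ l"
    then have a: "(cmod (a \<xi>))\<^sup>2 \<le> (\<psi> \<xi>)\<^sup>2" for \<xi> by (auto intro!: power_mono)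
    have "sqn (\<lambda>y. complex_of_real (y $ i - x $ i) ^ 0 * kernel_sum i p 0 0 a N x y)
      \<le> ennreal (C * (\<Sum>\<xi>\<in>msize_ball N. (cmod (a \<xi>))\<^sup>2 * jbracket \<xi> ^ p * (\<Sum>q\<le>p. (hermite (\<xi> + axis i q) x)\<^sup>2)))"
      using C(2)[of a N x] by simp
    also have "\<dots> \<le> ennreal (C * (\<Sum>\<xi>\<in>msize_ball N. (\<psi> \<xi>)\<^sup>2 * jbracket \<xi> ^ p * (\<Sum>q\<le>p. (hermite (\<xi> + axis i q) x)\<^sup>2)))"
      by (intro ennreal_leI mult_left_mono sum_mono mult_right_mono a C sum_nonneg zero_le_power2
          zero_le_power[OF less_imp_le[OF jbracket_pos]])
    finally show "sqn (\<lambda>y. complex_of_real (y $ i - x $ i) ^ 0 * kernel_sum i p 0 0 a N x y)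
      \<le> ennreal (C * (\<Sum>\<xi>\<in>msize_ball N. (\<psi> \<xi>)\<^sup>2 * jbracket \<xi> ^ p / jbracket \<xi> ^ 0 * (\<Sum>q\<le>p + 0. (hermite (\<xi> + axis i q) x)\<^sup>2)))"
      by simp
  qed (rule C)
next
  case (Suc M)
  let ?b = "\<lambda>\<psi> M p N x. \<Sum>\<xi>\<in>msize_ball N. (\<psi> \<xi>)\<^sup>2 * jbracket \<xi> ^ p / jbracket \<xi> ^ M
          * (\<Sum>q\<le>p + M. (hermite (\<xi> + axis i q) x)\<^sup>2)"
  let ?hyp = "\<lambda>a \<psi> N M. (\<forall>\<xi>. msize \<xi> > N \<longrightarrow> a \<xi> = 0) \<and> (\<forall>l\<le>M. \<forall>\<xi>. cmod ((fdiff i ^^ l) a \<xi>) \<le> \<psi> \<xi> / jbracket \<xi> ^ l)"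
  let ?F = "\<lambda>M p a N x y. complex_of_real (y $ i - x $ i) ^ M * kernel_sum i p 0 0 a N x y"
  obtain C where C: "C \<ge> 0" "\<And>a \<psi> N x. ?hyp a \<psi> N M \<Longrightarrow> sqn (?F M (Suc p) a N x) \<le> ennreal (C * ?b \<psi> M (Suc p) N x)"
    using Suc.IH[of "Suc p"] by blast
  obtain D where D: "D \<ge> 0" "\<And>a \<psi> N x. ?hyp a \<psi> N M \<Longrightarrow> sqn (?F M (p - 1) a N x) \<le> ennreal (D * ?b \<psi> M (p - 1) N x)"
    using Suc.IH[of "p - 1"] by blast
  let ?E = "C / 2 + 8 * (real p)\<^sup>2 * D"
  have "sqn (?F (Suc M) p a N x) \<le> ennreal (?E * ?b \<psi> (Suc M) p N x)" if hyp: "?hyp a \<psi> N (Suc M)" for a \<psi> N x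
  proof -
    have [measurable]: "(\<lambda>y. complex_of_real (y $ i - x $ i) ^ M * kernel_sum i p' 0 0 a' N x y) \<in> borel_measurable borel" for p' a'
      by measurable
    have b0: "0 \<le> ?b \<psi> M p N x" for \<psi> M p
      by (intro sum_nonneg mult_nonneg_nonneg divide_nonneg_nonneg zero_le_power2 zero_le_power[OF less_imp_le[OF jbracket_pos]])
    have "?F (Suc M) p a N x = (\<lambda>y. - (1 / 2) * ?F M (Suc p) (fdiff i a) N x y + (2 * of_nat p) * ?F M (p - 1) a N x y)"
    proof
      fix y
      have "?F (Suc M) p a N x y = complex_of_real (y $ i - x $ i) ^ M * (complex_of_real (y $ i - x $ i) * kernel_sum i p 0 0 a N x y)"
        by (simp only: power_Suc mult_ac)
      also have "\<dots> = - (1 / 2) * ?F M (Suc p) (fdiff i a) N x y + (2 * of_nat p) * ?F M (p - 1) a N x y"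
        using hyp by (subst kernel_sum_commutator) (auto simp: algebra_simps)
      finally show "?F (Suc M) p a N x y = - (1 / 2) * ?F M (Suc p) (fdiff i a) N x y + (2 * of_nat p) * ?F M (p - 1) a N x y" .
    qed
    then have "sqn (?F (Suc M) p a N x) \<le> 2 * sqn (\<lambda>y. - (1 / 2) * ?F M (Suc p) (fdiff i a) N x y) + 2 * sqn (\<lambda>y. (2 * of_nat p) * ?F M (p - 1) a N x y)"
      by (simp only:) (rule sqn_add_le, measurable)
    also have "\<dots> = 2 * (ennreal ((cmod (- (1/2)))\<^sup>2) * sqn (?F M (Suc p) (fdiff i a) N x)) + 2 * (ennreal ((cmod (2 * of_nat p))\<^sup>2) * sqn (?F M (p - 1) a N x))"
      by (subst (1 2) sqn_cmult) (auto simp del: of_nat_mult)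
    also have "\<dots> \<le> 2 * (ennreal ((cmod (- (1/2)))\<^sup>2) * ennreal (C * ?b (\<lambda>\<xi>. \<psi> \<xi> / jbracket \<xi>) M (Suc p) N x)) + 2 * (ennreal ((cmod (2 * of_nat p))\<^sup>2) * ennreal (D * ?b \<psi> M (p - 1) N x))"
    proof (intro add_mono mult_left_mono C(2) D(2) conjI allI impI)
      fix l \<xi> assume "l \<le> M"
      then have "cmod ((fdiff i ^^ Suc l) a \<xi>) \<le> \<psi> \<xi> / jbracket \<xi> ^ Suc l" using hyp by (metis Suc_le_mono)
      then show "cmod ((fdiff i ^^ l) (fdiff i a) \<xi>) \<le> \<psi> \<xi> / jbracket \<xi> / jbracket \<xi> ^ l"
        by (simp add: funpow_swap1)
    qed (use hyp in \<open>auto simp: fdiff_def\<close>)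
    also have "\<dots> = ennreal (2 * ((1/2)\<^sup>2 * (C * ?b (\<lambda>\<xi>. \<psi> \<xi> / jbracket \<xi>) M (Suc p) N x)) + 2 * ((2 * real p)\<^sup>2 * (D * ?b \<psi> M (p - 1) N x)))"
    proof -
      have c: "cmod (- (1/2)) = 1/2" "cmod (2 * of_nat p) = 2 * real p" by (simp_all add: norm_mult norm_divide)
      have h: "2 * (ennreal u * ennreal v) + 2 * (ennreal u' * ennreal v') = ennreal (2 * (u * v) + 2 * (u' * v'))"
        if "0 \<le> u" "0 \<le> v" "0 \<le> u'" "0 \<le> v'" for u v u' v'
        using that by (simp add: ennreal_mult)
      show ?thesis unfolding c
        by (rule h) (intro zero_le_power2 mult_nonneg_nonneg C(1) D(1) b0)+
    qed
    also have "\<dots> \<le> ennreal (?E * ?b \<psi> (Suc M) p N x)"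
    proof (rule ennreal_leI)
      have j: "(\<psi> \<xi> / jbracket \<xi>)\<^sup>2 * jbracket \<xi> ^ Suc p / jbracket \<xi> ^ M = (\<psi> \<xi>)\<^sup>2 * jbracket \<xi> ^ p / jbracket \<xi> ^ Suc M" for \<xi>
        using jbracket_pos[of \<xi>] by (simp add: field_simps power2_eq_square)
      have 1: "?b (\<lambda>\<xi>. \<psi> \<xi> / jbracket \<xi>) M (Suc p) N x = ?b \<psi> (Suc M) p N x"
        unfolding j by simp
      have 2: "(2 * real p)\<^sup>2 * (D * ?b \<psi> M (p - 1) N x) \<le> (2 * real p)\<^sup>2 * (D * ?b \<psi> (Suc M) p N x)"
      proof (cases p)
        case (Suc p')
        have j: "jbracket \<xi> ^ p' / jbracket \<xi> ^ M = jbracket \<xi> ^ p / jbracket \<xi> ^ Suc M" for \<xi>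
          using less_imp_neq[OF jbracket_pos[of \<xi>]] Suc by (simp add: field_simps)
        have "?b \<psi> M (p - 1) N x \<le> ?b \<psi> (Suc M) p N x"
        proof (rule sum_mono)
          fix \<xi>
          have "(\<Sum>q\<le>p - 1 + M. (hermite (\<xi> + axis i q) x)\<^sup>2) \<le> (\<Sum>q\<le>p + Suc M. (hermite (\<xi> + axis i q) x)\<^sup>2)"
            by (rule sum_mono2) auto
          then show "(\<psi> \<xi>)\<^sup>2 * jbracket \<xi> ^ (p - 1) / jbracket \<xi> ^ M * (\<Sum>q\<le>p - 1 + M. (hermite (\<xi> + axis i q) x)\<^sup>2)
              \<le> (\<psi> \<xi>)\<^sup>2 * jbracket \<xi> ^ p / jbracket \<xi> ^ Suc M * (\<Sum>q\<le>p + Suc M. (hermite (\<xi> + axis i q) x)\<^sup>2)"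
            unfolding times_divide_eq_right[symmetric] j[symmetric] using Suc
            by (intro mult_mono) (auto simp: sum_nonneg less_imp_le)
        qed
        then show ?thesis using D(1) by (intro mult_left_mono) auto
      qed simp
      show "2 * ((1/2)\<^sup>2 * (C * ?b (\<lambda>\<xi>. \<psi> \<xi> / jbracket \<xi>) M (Suc p) N x)) + 2 * ((2 * real p)\<^sup>2 * (D * ?b \<psi> M (p - 1) N x))
          \<le> ?E * ?b \<psi> (Suc M) p N x"
        unfolding 1 using 2 by (simp add: power2_eq_square algebra_simps)
    qed
    finally show ?thesis .
  qed
  then show ?case using C(1) D(1) by (intro exI[of _ ?E]) auto
qed

section \<open>Differences of products and cutoffs to a dyadic block\<close>

lemma fdiff_funpow_add:
  "(fdiff i ^^ l) (\<lambda>\<xi>. f \<xi> + g \<xi>) = (\<lambda>\<xi>. (fdiff i ^^ l) f \<xi> + (fdiff i ^^ l) g \<xi>)"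
  by (induction l) (auto simp: fdiff_def fun_eq_iff)

lemma fdiff_mult:
  "fdiff i (\<lambda>\<xi>. f \<xi> * g \<xi>) = (\<lambda>\<xi>. fdiff i f \<xi> * g (\<xi> + axis i 1) + f \<xi> * fdiff i g \<xi>)"
  by (auto simp: fdiff_def fun_eq_iff algebra_simps)

lemma add_axis_add_axis: "\<xi> + axis i a + axis i b = \<xi> + axis i (a + b)" for \<xi> :: "('a::monoid_add)^'n"
  by (auto simp: vec_eq_iff axis_def add.assoc)

lemma fdiff_translate:
  "fdiff i (\<lambda>\<xi>. f (\<xi> + axis i s)) = (\<lambda>\<xi>. fdiff i f (\<xi> + axis i s))"
  by (auto simp: fdiff_def fun_eq_iff add_axis_add_axis)

text \<open>
  The Leibniz rule shifts the argument of the second factor once for every difference on the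
  first one. Hence \<open>\<phi>\<close> is controlled at shifted points by a majorant at the original point.
\<close>

lemma fdiff_leibniz_bound:
  assumes \<tau>: "\<And>l \<xi>. l \<le> K \<Longrightarrow> cmod ((fdiff i ^^ l) \<tau> \<xi>) \<le> V \<xi> / jbracket \<xi> ^ l"
    and \<phi>: "\<And>l s \<xi>. l + s \<le> K \<Longrightarrow> cmod ((fdiff i ^^ l) \<phi> (\<xi> + axis i s)) \<le> \<omega> \<xi> / jbracket \<xi> ^ l"
    and l: "l \<le> K"
  shows "cmod ((fdiff i ^^ l) (\<lambda>\<xi>. \<tau> \<xi> * \<phi> \<xi>) \<xi>) \<le> 2 ^ l * V \<xi> * \<omega> \<xi> / jbracket \<xi> ^ l"
proof -
  have "cmod ((fdiff i ^^ l) (\<lambda>\<xi>. (fdiff i ^^ u) \<tau> \<xi> * (fdiff i ^^ v) \<phi> (\<xi> + axis i s)) \<xi>)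
      \<le> 2 ^ l * V \<xi> * \<omega> \<xi> / jbracket \<xi> ^ (l + u + v)" if "l + u + v \<le> K" "s \<le> u" for l u v s
    using that
  proof (induction l arbitrary: u v s)
    case 0
    have "cmod ((fdiff i ^^ u) \<tau> \<xi>) * cmod ((fdiff i ^^ v) \<phi> (\<xi> + axis i s))
        \<le> (V \<xi> / jbracket \<xi> ^ u) * (\<omega> \<xi> / jbracket \<xi> ^ v)"
      using 0 order_trans[OF norm_ge_zero \<tau>[of u \<xi>]] by (intro mult_mono \<tau> \<phi>) auto
    then show ?case by (simp add: norm_mult power_add)
  next
    case (Suc l)
    let ?f = "(fdiff i ^^ u) \<tau>" and ?g = "\<lambda>\<xi>. (fdiff i ^^ v) \<phi> (\<xi> + axis i s)"
    have "fdiff i (\<lambda>\<xi>. ?f \<xi> * ?g \<xi>) = (\<lambda>\<xi>. (fdiff i ^^ Suc u) \<tau> \<xi> * (fdiff i ^^ v) \<phi> (\<xi> + axis i (Suc s))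
        + ?f \<xi> * (fdiff i ^^ Suc v) \<phi> (\<xi> + axis i s))"
      unfolding fdiff_mult fdiff_translate by (simp add: add_axis_add_axis)
    then have "(fdiff i ^^ Suc l) (\<lambda>\<xi>. ?f \<xi> * ?g \<xi>) \<xi>
        = (fdiff i ^^ l) (\<lambda>\<xi>. (fdiff i ^^ Suc u) \<tau> \<xi> * (fdiff i ^^ v) \<phi> (\<xi> + axis i (Suc s))) \<xi>
        + (fdiff i ^^ l) (\<lambda>\<xi>. ?f \<xi> * (fdiff i ^^ Suc v) \<phi> (\<xi> + axis i s)) \<xi>"
      by (simp only: funpow_Suc_right o_apply fdiff_funpow_add)
    also have "cmod \<dots> \<le> 2 ^ l * V \<xi> * \<omega> \<xi> / jbracket \<xi> ^ (l + Suc u + v) + 2 ^ l * V \<xi> * \<omega> \<xi> / jbracket \<xi> ^ (l + u + Suc v)"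
      using Suc.prems by (intro norm_triangle_le add_mono Suc.IH) auto
    also have "\<dots> = 2 ^ Suc l * V \<xi> * \<omega> \<xi> / jbracket \<xi> ^ (Suc l + u + v)" by simp
    finally show ?case .
  qed
  from this[of l 0 0 0] l show ?thesis by (simp add: add_axis_0)
qed

definition ndiff :: "(nat \<Rightarrow> real) \<Rightarrow> nat \<Rightarrow> real" where
  "ndiff g m = g (Suc m) - g m"

lemma ndiff_Suc: "(ndiff ^^ Suc l) g m = (ndiff ^^ l) g (Suc m) - (ndiff ^^ l) g m"
  by (simp add: ndiff_def)

lemma fdiff_radial:
  "(fdiff i ^^ l) (\<lambda>\<xi>. complex_of_real (g (msize \<xi>))) = (\<lambda>\<xi>. complex_of_real ((ndiff ^^ l) g (msize \<xi>)))"
  by (induction l) (auto simp: fdiff_def ndiff_def fun_eq_iff)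

text \<open>
  A polynomial in \<open>m\<close> whose successive differences are again binomial coefficients. It is of
  size one for \<open>m\<close> comparable to \<open>R\<close> and at most \<open>C ((1 + m) / R)^k\<close> for smaller \<open>m\<close>; this
  smallness at low frequencies does the work of a cutoff there.
\<close>

definition low_cut :: "nat \<Rightarrow> nat \<Rightarrow> nat \<Rightarrow> real" where
  "low_cut k R m = real ((m + k) choose k) / real R ^ k"

text \<open>
  A discrete truncated power: truncated subtraction makes it vanish for large \<open>m\<close>, and its
  differences of order below \<open>k\<close> are binomial coefficients also across the edge of the support.
\<close>

definition high_cut :: "nat \<Rightarrow> nat \<Rightarrow> nat \<Rightarrow> real" where
  "high_cut k R m = real ((8 * R + k - m) choose k) / real R ^ k"

lemma ndiff_low_cut:
  assumes "l \<le> k"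
  shows "(ndiff ^^ l) (low_cut k R) m = real ((m + k) choose (k - l)) / real R ^ k"
  using assms
proof (induction l arbitrary: m)
  case (Suc l)
  then have "k - l = Suc (k - Suc l)" by simp
  then show ?case using Suc by (simp add: ndiff_def diff_divide_distrib[symmetric])
qed (simp add: low_cut_def)

text \<open>
  Pascal's rule. Where the truncated subtraction has reached zero both sides vanish, because the
  lower index \<open>k - l\<close> stays positive.
\<close>

lemma ndiff_high_cut:
  assumes "l < k"
  shows "(ndiff ^^ l) (high_cut k R) m = (- 1) ^ l * real ((8 * R + k - m - l) choose (k - l)) / real R ^ k"
  using assms
proof (induction l arbitrary: m)
  case (Suc l)
  define t where "t = 8 * R + k - m - l"
  have t: "8 * R + k - Suc m - l = t - 1" "8 * R + k - m - Suc l = t - 1" by (auto simp: t_def)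
  have "real ((t - 1) choose (k - l)) - real (t choose (k - l)) = - real ((t - 1) choose (k - Suc l))"
  proof (cases t)
    case 0
    then show ?thesis using Suc.prems by (simp add: binomial_eq_0)
  next
    case (Suc t')
    have "k - l = Suc (k - Suc l)" using \<open>Suc l < k\<close> by simp
    then show ?thesis using Suc by simp
  qed
  moreover have "(ndiff ^^ Suc l) (high_cut k R) m
     = (- 1) ^ l * (real ((t - 1) choose (k - l)) - real (t choose (k - l))) / real R ^ k"
    using Suc.IH[of m] Suc.IH[of "Suc m"] Suc.prems
    unfolding ndiff_Suc t t_def[symmetric] by (simp add: diff_divide_distrib right_diff_distrib)
  ultimately show ?case unfolding t by simp
qed (simp add: high_cut_def)

lemma binomial_le_power: "real (n choose r) \<le> real n ^ r"
proof (cases "r \<le> n")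
  case True
  have "n choose r \<le> n ^ r" by (rule binomial_le_pow[OF True])
  then show ?thesis by (metis of_nat_le_iff of_nat_power)
qed (simp add: binomial_eq_0)

lemma low_cut_bound:
  assumes "R \<ge> 1" "l + s < k"
  shows "cmod ((fdiff i ^^ l) (\<lambda>\<xi>. complex_of_real (low_cut k R (msize \<xi>))) (\<xi> + axis i s))
    \<le> (real (2 * k) ^ k * (jbracket \<xi> / real R) ^ k) / jbracket \<xi> ^ l"
proof -
  have "(ndiff ^^ l) (low_cut k R) (msize \<xi> + s) = real ((msize \<xi> + s + k) choose (k - l)) / real R ^ k"
    using assms by (intro ndiff_low_cut) auto
  also have "\<dots> \<le> real (msize \<xi> + s + k) ^ (k - l) / real R ^ k"
    by (intro divide_right_mono binomial_le_power) auto
  also have "\<dots> \<le> (real (2 * k) * jbracket \<xi>) ^ (k - l) / real R ^ k"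
  proof (intro divide_right_mono power_mono)
    have "real s \<le> real k" "1 \<le> real k" using assms by auto
    then have "real (msize \<xi>) * 1 \<le> real (msize \<xi>) * (2 * real k)" by (intro mult_left_mono) auto
    then show "real (msize \<xi> + s + k) \<le> real (2 * k) * jbracket \<xi>"
      using \<open>real s \<le> real k\<close> by (simp add: jbracket_def algebra_simps)
  qed auto
  also have "\<dots> \<le> real (2 * k) ^ k * jbracket \<xi> ^ (k - l) / real R ^ k"
    unfolding power_mult_distrib using assms
    by (intro divide_right_mono mult_right_mono power_increasing) (auto simp: less_imp_le)
  also have "jbracket \<xi> ^ (k - l) = jbracket \<xi> ^ k / jbracket \<xi> ^ l"
    using assms less_imp_neq[OF jbracket_pos[of \<xi>]] by (simp add: power_diff)
  finally have "(ndiff ^^ l) (low_cut k R) (msize \<xi> + s) \<le> (real (2 * k) ^ k * (jbracket \<xi> / real R) ^ k) / jbracket \<xi> ^ l"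
    by (simp add: power_divide mult.commute)
  moreover have "0 \<le> (ndiff ^^ l) (low_cut k R) (msize \<xi> + s)"
    using assms by (subst ndiff_low_cut) auto
  ultimately show ?thesis by (simp add: fdiff_radial)
qed

lemma high_cut_bound:
  assumes "R \<ge> 1" "l + s < k"
  shows "cmod ((fdiff i ^^ l) (\<lambda>\<xi>. complex_of_real (high_cut k R (msize \<xi>))) (\<xi> + axis i s))
    \<le> (if msize \<xi> \<le> 8 * R + k then real (9 + k) ^ k else 0) / jbracket \<xi> ^ l"
proof -
  let ?t = "8 * R + k - (msize \<xi> + s) - l"
  have eq: "\<bar>(ndiff ^^ l) (high_cut k R) (msize \<xi> + s)\<bar> = real (?t choose (k - l)) / real R ^ k"
    using assms by (subst ndiff_high_cut) (auto simp: abs_mult)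
  have "real (?t choose (k - l)) / real R ^ k \<le> real (9 + k) ^ k / jbracket \<xi> ^ l" if m: "msize \<xi> \<le> 8 * R + k"
  proof -
    have R: "1 + (8 * real R + real k) \<le> real (9 + k) * real R"
    proof -
      have "real k * 1 \<le> real k * real R" using assms by (intro mult_left_mono) auto
      moreover have "1 \<le> real R" using assms by simp
      ultimately have "1 + real k \<le> real R + real R * real k" by (simp add: mult.commute)
      then show ?thesis by (simp add: algebra_simps)
    qed
    have R0: "0 < real R" using assms by simp
    have j: "jbracket \<xi> \<le> real (9 + k) * real R" using m R unfolding jbracket_def by linarith
    have t: "real ?t \<le> real (9 + k) * real R" using R by linarith
    have "real (?t choose (k - l)) * jbracket \<xi> ^ l \<le> (real (9 + k) * real R) ^ (k - l) * (real (9 + k) * real R) ^ l"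
      by (intro mult_mono order_trans[OF binomial_le_power] power_mono t j) (auto simp: less_imp_le)
    also have "\<dots> = real (9 + k) ^ k * real R ^ k"
      using assms by (simp only: power_add[symmetric] power_mult_distrib[symmetric]) simp
    finally show ?thesis using R0 by (simp add: field_simps)
  qed
  note small = this
  have large: "?t choose (k - l) = 0" if "\<not> msize \<xi> \<le> 8 * R + k"
    using that assms by (intro binomial_eq_0) linarith
  show ?thesis
  proof (cases "msize \<xi> \<le> 8 * R + k")
    case True
    then show ?thesis unfolding fdiff_radial msize_add_axis norm_of_real eq using small by simp
  next
    case False
    then show ?thesis unfolding fdiff_radial msize_add_axis norm_of_real eq large[OF False] by simp
  qed
qed

text \<open>
  The product of the cutoffs is bounded below on the block, uniformly in \<open>R\<close>, so it can be
  divided out there.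
\<close>

lemma cut_lower_bound:
  assumes "R \<ge> 1" "k \<ge> 1" "real R \<le> 2 * jbracket \<xi>" "jbracket \<xi> \<le> 4 * real R"
  shows "(1 / (2 * real k)) ^ k * (1 / real k) ^ k \<le> low_cut k R (msize \<xi>) * high_cut k R (msize \<xi>)"
proof (rule mult_mono)
  let ?m = "msize \<xi>"
  have "(1 / (2 * real k)) ^ k \<le> (real (?m + k) / real k / real R) ^ k"
  proof (rule power_mono)
    have "real R \<le> 2 * real (?m + k)" using assms by (simp add: jbracket_def)
    then show "1 / (2 * real k) \<le> real (?m + k) / real k / real R" using assms by (simp add: field_simps)
  qed auto
  also have "\<dots> = (real (?m + k) / real k) ^ k / real R ^ k" by (simp add: power_divide power_mult_distrib)
  also have "\<dots> \<le> low_cut k R ?m"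
    unfolding low_cut_def by (intro divide_right_mono binomial_ge_n_over_k_pow_k) auto
  finally show "(1 / (2 * real k)) ^ k \<le> low_cut k R ?m" .
  have m: "?m < 4 * R" using assms by (simp add: jbracket_def)
  then have km: "k \<le> 8 * R + k - ?m" by simp
  have "(1 / real k) ^ k \<le> (real (8 * R + k - ?m) / real k / real R) ^ k"
  proof (rule power_mono)
    have "R \<le> 8 * R + k - ?m" using m by simp
    then have "real R \<le> real (8 * R + k - ?m)" by (simp only: of_nat_le_iff)
    then show "1 / real k \<le> real (8 * R + k - ?m) / real k / real R" using assms by (simp add: field_simps del: of_nat_diff)
  qed auto
  also have "\<dots> = (real (8 * R + k - ?m) / real k) ^ k / real R ^ k" by (simp add: power_divide power_mult_distrib)
  also have "\<dots> \<le> high_cut k R ?m"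
    unfolding high_cut_def by (intro divide_right_mono binomial_ge_n_over_k_pow_k[OF km]) auto
  finally show "(1 / real k) ^ k \<le> high_cut k R ?m" .
qed (auto simp: low_cut_def)

section \<open>Uniform boundedness of a dyadic block\<close>

lemma hermite_bilinear:
  fixes a b :: "nat^'n \<Rightarrow> complex"
  assumes S: "finite S"
  shows "(\<integral>y. (\<Sum>\<xi>\<in>S. a \<xi> * complex_of_real (hermite \<xi> y)) * (\<Sum>\<xi>\<in>S. b \<xi> * complex_of_real (hermite \<xi> y)) \<partial>lborel)
    = (\<Sum>\<xi>\<in>S. a \<xi> * b \<xi>)"
proof -
  have "(\<integral>y. (\<Sum>\<xi>\<in>S. a \<xi> * complex_of_real (hermite \<xi> y)) * (\<Sum>\<xi>\<in>S. b \<xi> * complex_of_real (hermite \<xi> y)) \<partial>lborel)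
    = (\<integral>y. (\<Sum>\<xi>\<in>S. \<Sum>\<eta>\<in>S. a \<xi> * b \<eta> * complex_of_real (hermite \<xi> y * hermite \<eta> y)) \<partial>lborel)"
    by (simp add: sum_product mult_ac)
  also have "\<dots> = (\<Sum>\<xi>\<in>S. \<Sum>\<eta>\<in>S. a \<xi> * b \<eta> * complex_of_real (if \<xi> = \<eta> then 1 else 0))"
  proof -
    have i: "integrable lborel (\<lambda>y. a \<xi> * b \<eta> * complex_of_real (hermite \<xi> y * hermite \<eta> y))" for \<xi> \<eta>
      by (intro integrable_mult_right integrable_of_real integrable_hermite_mult)
    show ?thesis
      by (subst Bochner_Integration.integral_sum, intro Bochner_Integration.integrable_sum i)
        (intro sum.cong refl, subst Bochner_Integration.integral_sum, intro i,
          simp only: integral_mult_right_zero integral_complex_of_real hermite_orthonormal)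
  qed
  also have "\<dots> = (\<Sum>\<xi>\<in>S. \<Sum>\<eta>\<in>S. if \<xi> = \<eta> then a \<xi> * b \<xi> else 0)"
    by (intro sum.cong refl) auto
  also have "\<dots> = (\<Sum>\<xi>\<in>S. a \<xi> * b \<xi>)" using S by simp
  finally show ?thesis .
qed

text \<open>
  This is the profile of the weight used below. Its integrability, for an exponent above 1, is
  where \<open>2 K > n\<close> enters.
\<close>

lemma nn_integral_bump_finite:
  assumes "q > 1"
  obtains I where "I \<ge> 0" "(\<integral>\<^sup>+t. ennreal (max 1 \<bar>t::real\<bar> powr (- q)) \<partial>lborel) = ennreal I"
proof -
  have tail: "(\<integral>\<^sup>+t. ennreal (t powr (- q)) * indicator {1..} t \<partial>lborel) = ennreal (1 / (q - 1))"
  proof -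
    have "(\<integral>\<^sup>+t. ennreal (t powr (- q)) * indicator {1..} t \<partial>lborel) = ennreal (0 - 1 powr (1 - q) / (1 - q))"
    proof (rule nn_integral_FTC_atLeast[where F="\<lambda>t. t powr (1 - q) / (1 - q)"])
      show "DERIV (\<lambda>t. t powr (1 - q) / (1 - q)) t :> t powr (- q)" if "1 \<le> t" for t
        using that assms by (intro DERIV_cong[OF DERIV_cdivide[OF has_real_derivative_powr]]) auto
      have "((\<lambda>t. t powr (1 - q)) \<longlongrightarrow> 0) at_top"
        using assms by (intro tendsto_neg_powr filterlim_ident) auto
      then show "((\<lambda>t. t powr (1 - q) / (1 - q)) \<longlongrightarrow> 0) at_top"
        using tendsto_divide[OF _ tendsto_const[of "1 - q"]] assms by fastforce
    qed auto
    also have "0 - 1 powr (1 - q) / (1 - q) = 1 / (q - 1)" using assms by (simp add: field_simps)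
    finally show ?thesis .
  qed
  have tail': "(\<integral>\<^sup>+t. ennreal ((- t) powr (- q)) * indicator {1..} (- t) \<partial>lborel) = ennreal (1 / (q - 1))"
    using nn_integral_real_affine[of "\<lambda>t. ennreal (t powr (- q)) * indicator {1..} t" "-1" 0] tail by simp
  have "(\<integral>\<^sup>+t. ennreal (max 1 \<bar>t\<bar> powr (- q)) \<partial>lborel)
    \<le> (\<integral>\<^sup>+t. indicator {-1..1} t + ennreal (t powr (- q)) * indicator {1..} t + ennreal ((- t) powr (- q)) * indicator {1..} (- t) \<partial>lborel)"
    by (intro nn_integral_mono) (auto simp: indicator_def max_def abs_if)
  also have "\<dots> = (\<integral>\<^sup>+t. indicator {-1..1::real} t \<partial>lborel) + (\<integral>\<^sup>+t. ennreal (t powr (- q)) * indicator {1..} t \<partial>lborel)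
      + (\<integral>\<^sup>+t. ennreal ((- t) powr (- q)) * indicator {1..} (- t) \<partial>lborel)"
    by (simp add: nn_integral_add)
  also have "\<dots> < \<infinity>" unfolding tail tail' by simp
  finally show ?thesis using that by (cases "\<integral>\<^sup>+t. ennreal (max 1 \<bar>t::real\<bar> powr (- q)) \<partial>lborel") auto
qed

text \<open>
  A product of one-dimensional weights in place of a radial one, so that its integral
  factorises.
\<close>

definition weight :: "real \<Rightarrow> real \<Rightarrow> real^'n \<Rightarrow> real" where
  "weight q R z = (\<Prod>j\<in>UNIV. max 1 (sqrt R * \<bar>z $ j\<bar>) powr (- q))"

lemma weight_pos: "0 < weight q R z"
  unfolding weight_def by (intro prod_pos) auto

lemma borel_measurable_weight [measurable]: "weight q R \<in> borel_measurable borel"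
  unfolding weight_def[abs_def] by measurable

text \<open>
  Scaling: each coordinate contributes a factor \<open>1 / sqrt R\<close>.
\<close>

lemma nn_integral_weight:
  fixes y :: "real^'n"
  assumes I: "I \<ge> 0" "(\<integral>\<^sup>+t. ennreal (max 1 \<bar>t::real\<bar> powr (- q)) \<partial>lborel) = ennreal I" and R: "R > 0"
  shows "(\<integral>\<^sup>+x. ennreal (weight q R (y - x)) \<partial>lborel) = ennreal ((I / sqrt R) ^ CARD('n))"
proof -
  have one: "(\<integral>\<^sup>+t. ennreal (max 1 (sqrt R * \<bar>s - t\<bar>) powr (- q)) \<partial>lborel) = ennreal (I / sqrt R)" for s
  proof -
    have s: "0 < sqrt R" using R by simp
    \<comment> \<open>Substitute \<open>sqrt R * (s - t)\<close> for the integration variable.\<close>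
    have abs: "\<bar>sqrt R * s + - sqrt R * t\<bar> = sqrt R * \<bar>s - t\<bar>" for t
    proof -
      have "sqrt R * s + - sqrt R * t = sqrt R * (s - t)" by (simp add: algebra_simps)
      then show ?thesis using s by (simp add: abs_mult)
    qed
    have e: "ennreal I = ennreal (sqrt R) * (\<integral>\<^sup>+t. ennreal (max 1 (sqrt R * \<bar>s - t\<bar>) powr (- q)) \<partial>lborel)"
      unfolding I(2)[symmetric] abs[symmetric]
      using nn_integral_real_affine[of "\<lambda>t. ennreal (max 1 \<bar>t\<bar> powr (- q))" "- sqrt R" "sqrt R * s"] s by simp
    have "ennreal (I / sqrt R) = ennreal I / ennreal (sqrt R)"
      using I s by (simp add: divide_ennreal)
    also have "\<dots> = (\<integral>\<^sup>+t. ennreal (max 1 (sqrt R * \<bar>s - t\<bar>) powr (- q)) \<partial>lborel)"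
      unfolding e using s by (subst mult.commute, subst ennreal_mult_divide_eq) auto
    finally show ?thesis by simp
  qed
  have "(\<integral>\<^sup>+x. ennreal (weight q R (y - x)) \<partial>lborel)
      = (\<integral>\<^sup>+x. (\<Prod>j\<in>UNIV. ennreal (max 1 (sqrt R * \<bar>y $ j - x $ j\<bar>) powr (- q))) \<partial>lborel)"
    by (simp add: weight_def prod_ennreal)
  also have "\<dots> = (\<Prod>j\<in>(UNIV::'n set). ennreal (I / sqrt R))"
    by (subst nn_integral_lborel_vec_prod) (simp_all add: one)
  also have "\<dots> = ennreal ((I / sqrt R) ^ CARD('n))"
    using I R by (simp add: ennreal_power)
  finally show ?thesis .
qed

text \<open>
  Each factor of the reciprocal is at most the \<open>q\<close>-th power of the largest
  \<open>max 1 (sqrt R |z\<^sub>j|)\<close>; as \<open>q n = 2 K\<close>, the product is at most the \<open>2K\<close>-th power of that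
  maximum.
\<close>

lemma inverse_weight_le:
  fixes z :: "real^'n"
  assumes R: "R > 0" and q: "q * real CARD('n) = 2 * real K" "q > 0"
  shows "1 / weight q R z \<le> 1 + R ^ K * (\<Sum>j\<in>UNIV. (z $ j) ^ (2 * K))"
proof -
  define u where "u j = max 1 (sqrt R * \<bar>z $ j\<bar>)" for j
  define U where "U = Max (range u)"
  have u1: "1 \<le> u j" for j by (simp add: u_def)
  have u0: "u j \<noteq> 0" for j using u1[of j] by linarith
  have uU: "u j \<le> U" for j unfolding U_def by (rule Max_ge) auto
  have "U \<in> range u" unfolding U_def by (rule Max_in) auto
  then obtain j where j: "U = u j" by auto
  have "1 / weight q R z = (\<Prod>j\<in>UNIV. u j powr q)"
  proof -
    have "weight q R z * (\<Prod>j\<in>UNIV. u j powr q) = (\<Prod>j\<in>UNIV. u j powr (- q) * u j powr q)"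
      by (simp add: weight_def u_def prod.distrib)
    also have "\<dots> = 1" by (intro prod.neutral ballI) (simp add: powr_minus u0)
    finally show ?thesis using weight_pos[of q R z] by (simp add: field_simps)
  qed
  also have "\<dots> \<le> (\<Prod>j\<in>(UNIV::'n set). U powr q)"
    using u1 uU q by (intro prod_mono conjI powr_mono2) (auto intro: order_trans[OF zero_le_one])
  also have "\<dots> = U ^ (2 * K)"
  proof -
    have "0 < U" using u1[of j] j by simp
    then have "(U powr q) ^ CARD('n) = U powr (q * real CARD('n))" by (simp add: powr_powr flip: powr_realpow)
    also have "\<dots> = U ^ (2 * K)" using \<open>0 < U\<close> unfolding q by (simp flip: powr_realpow)
    finally show ?thesis by simp
  qed
  also have "\<dots> \<le> 1 + R ^ K * (\<Sum>j\<in>UNIV. (z $ j) ^ (2 * K))"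
  proof (cases "sqrt R * \<bar>z $ j\<bar> \<le> 1")
    case True
    then have "U = 1" by (simp add: j u_def)
    then show ?thesis using R by (auto intro!: mult_nonneg_nonneg sum_nonneg simp: power_mult)
  next
    case False
    then have "U ^ (2 * K) = (sqrt R * \<bar>z $ j\<bar>) ^ (2 * K)" by (simp add: j u_def)
    also have "\<dots> = R ^ K * (z $ j) ^ (2 * K)"
      using R by (simp add: power_mult_distrib power_mult)
    also have "\<dots> \<le> R ^ K * (\<Sum>j\<in>UNIV. (z $ j) ^ (2 * K))"
      using R by (intro mult_left_mono member_le_sum) (auto simp: power_mult)
    finally show ?thesis by simp
  qed
  finally show ?thesis .
qed

definition cut_symbol :: "nat \<Rightarrow> nat \<Rightarrow> (nat^'n \<Rightarrow> complex) \<Rightarrow> nat^'n \<Rightarrow> complex" where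
  "cut_symbol k R \<tau> \<xi> = \<tau> \<xi> * complex_of_real (low_cut k R (msize \<xi>)) * complex_of_real (high_cut k R (msize \<xi>))"

text \<open>
  Two applications of the Leibniz bound. On the support of the upper cutoff
  \<open>1 + |\<xi>| \<le> 8 R + K + 2 \<le> (10 + K) R\<close>, which is the range where \<open>v\<close> is compared with \<open>V\<close>.
\<close>

lemma cut_symbol_bound:
  assumes R: "R \<ge> 1"
    and \<tau>: "\<And>l \<xi>. l \<le> K \<Longrightarrow> cmod ((fdiff i ^^ l) \<tau> \<xi>) \<le> v \<xi> / jbracket \<xi> ^ l"
    and V: "\<And>\<xi>. jbracket \<xi> \<le> real (10 + K) * real R \<Longrightarrow> v \<xi> \<le> V"
    and l: "l \<le> K"
  shows "cmod ((fdiff i ^^ l) (cut_symbol (Suc K) R \<tau>) \<xi>)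
    \<le> (if msize \<xi> \<le> 8 * R + Suc K
        then 4 ^ K * real (2 * Suc K) ^ Suc K * real (9 + Suc K) ^ Suc K * V * (jbracket \<xi> / real R) ^ Suc K else 0)
      / jbracket \<xi> ^ l"
proof -
  have v0: "0 \<le> v \<xi>" for \<xi> using order_trans[OF norm_ge_zero \<tau>[of 0 \<xi>]] by simp
  let ?L = "\<lambda>\<xi>::nat^'a. real (2 * Suc K) ^ Suc K * (jbracket \<xi> / real R) ^ Suc K"
  let ?H = "\<lambda>\<xi>::nat^'a. if msize \<xi> \<le> 8 * R + Suc K then real (9 + Suc K) ^ Suc K else 0"
  have L0: "0 \<le> ?L \<xi>" for \<xi>
    by (intro mult_nonneg_nonneg zero_le_power divide_nonneg_nonneg less_imp_le[OF jbracket_pos]) auto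
  have H0: "0 \<le> ?H \<xi>" for \<xi> by simp
  have 1: "cmod ((fdiff i ^^ l) (\<lambda>\<xi>. \<tau> \<xi> * complex_of_real (low_cut (Suc K) R (msize \<xi>))) \<xi>)
      \<le> (2 ^ K * v \<xi> * ?L \<xi>) / jbracket \<xi> ^ l" if "l \<le> K" for l \<xi>
  proof -
    have "cmod ((fdiff i ^^ l) (\<lambda>\<xi>. \<tau> \<xi> * complex_of_real (low_cut (Suc K) R (msize \<xi>))) \<xi>)
      \<le> 2 ^ l * v \<xi> * ?L \<xi> / jbracket \<xi> ^ l"
      by (rule fdiff_leibniz_bound[where K=K, OF \<tau> low_cut_bound[OF R] that]) auto
    also have "\<dots> \<le> (2 ^ K * v \<xi> * ?L \<xi>) / jbracket \<xi> ^ l"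
      using that by (intro divide_right_mono mult_right_mono L0 v0 power_increasing) (auto simp: less_imp_le)
    finally show ?thesis .
  qed
  have "cmod ((fdiff i ^^ l) (cut_symbol (Suc K) R \<tau>) \<xi>)
      \<le> 2 ^ l * (2 ^ K * v \<xi> * ?L \<xi>) * ?H \<xi> / jbracket \<xi> ^ l"
    unfolding cut_symbol_def[abs_def]
    by (rule fdiff_leibniz_bound[where K=K, OF 1 high_cut_bound[OF R] l]) auto
  also have "\<dots> \<le> 2 ^ K * (2 ^ K * v \<xi> * ?L \<xi>) * ?H \<xi> / jbracket \<xi> ^ l"
    using l by (intro divide_right_mono mult_right_mono L0 v0 H0 mult_nonneg_nonneg power_increasing) (auto simp: less_imp_le)
  also have "\<dots> \<le> (if msize \<xi> \<le> 8 * R + Suc K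
        then 4 ^ K * real (2 * Suc K) ^ Suc K * real (9 + Suc K) ^ Suc K * V * (jbracket \<xi> / real R) ^ Suc K else 0)
      / jbracket \<xi> ^ l"
  proof (cases "msize \<xi> \<le> 8 * R + Suc K")
    case True
    have "real K * 1 \<le> real K * real R" using R by (intro mult_left_mono) auto
    then have "jbracket \<xi> \<le> real (10 + K) * real R"
      using True R by (simp add: jbracket_def algebra_simps)
    then have "v \<xi> \<le> V" by (rule V)
    then have "2 ^ K * (2 ^ K * v \<xi> * ?L \<xi>) * real (9 + Suc K) ^ Suc K \<le> 2 ^ K * (2 ^ K * V * ?L \<xi>) * real (9 + Suc K) ^ Suc K"
      by (intro mult_right_mono mult_left_mono L0) auto
    also have "\<dots> = 4 ^ K * real (2 * Suc K) ^ Suc K * real (9 + Suc K) ^ Suc K * V * (jbracket \<xi> / real R) ^ Suc K"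
    proof -
      have "(4::real) ^ K = 2 ^ K * 2 ^ K" by (simp flip: power_mult_distrib)
      then show ?thesis by (simp only: mult_ac)
    qed
    finally show ?thesis using True by (simp only: if_True) (intro divide_right_mono zero_le_power less_imp_le[OF jbracket_pos])
  qed simp
  finally show ?thesis .
qed

lemma sum_hermite_shift_sq_le:
  fixes x :: "real^'n"
  assumes R: "R \<ge> 1"
  shows "(\<Sum>\<xi>\<in>msize_ball (8 * R + Suc K). \<Sum>q\<le>M. (hermite (\<xi> + axis i q) x)\<^sup>2)
    \<le> real (Suc M) * sqrt (real (2 * M + 20 + 4 * K)) ^ CARD('n) * sqrt (real R) ^ CARD('n)"
proof -
  let ?B = "8 * R + Suc K"
  have "(\<Sum>\<xi>\<in>msize_ball ?B. (hermite (\<xi> + axis i q) x)\<^sup>2) \<le> sqrt (real (2 * M + 20 + 4 * K) * real R) ^ CARD('n)"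
    if "q \<le> M" for q
  proof -
    have inj: "inj_on (\<lambda>\<xi>. \<xi> + axis i q) (msize_ball ?B)" by (rule inj_onI) simp
    have "(\<Sum>\<xi>\<in>msize_ball ?B. (hermite (\<xi> + axis i q) x)\<^sup>2)
        = (\<Sum>\<xi>\<in>(\<lambda>\<xi>. \<xi> + axis i q) ` msize_ball ?B. (hermite \<xi> x)\<^sup>2)"
      using inj by (simp add: sum.reindex)
    also have "\<dots> \<le> (\<Sum>\<xi>\<in>msize_ball (?B + M). (hermite \<xi> x)\<^sup>2)"
      using that by (intro sum_mono2) (auto simp: msize_ball_def[of "?B + M"], auto simp: msize_ball_def)
    also have "\<dots> \<le> sqrt (2 * real (Suc (?B + M))) ^ CARD('n)" by (rule sum_hermite_sq_le)
    also have "\<dots> \<le> sqrt (real (2 * M + 20 + 4 * K) * real R) ^ CARD('n)"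
    proof (intro power_mono real_sqrt_le_mono)
      have "2 * Suc (?B + M) = 16 * R + (2 * K + 2 * M + 4) * 1" by simp
      also have "\<dots> \<le> 16 * R + (2 * K + 2 * M + 4) * R" using R by (intro add_mono mult_left_mono) auto
      also have "\<dots> \<le> (2 * M + 20 + 4 * K) * R" by (simp add: algebra_simps)
      finally have "real (2 * Suc (?B + M)) \<le> real ((2 * M + 20 + 4 * K) * R)" by (simp only: of_nat_le_iff)
      then show "2 * real (Suc (?B + M)) \<le> real (2 * M + 20 + 4 * K) * real R" by simp
    qed auto
    finally show ?thesis .
  qed
  then have "(\<Sum>q\<le>M. \<Sum>\<xi>\<in>msize_ball ?B. (hermite (\<xi> + axis i q) x)\<^sup>2)
      \<le> (\<Sum>q\<le>M. sqrt (real (2 * M + 20 + 4 * K) * real R) ^ CARD('n))"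
    by (intro sum_mono) auto
  then show ?thesis
    by (subst sum.swap) (simp add: real_sqrt_mult power_mult_distrib)
qed

text \<open>
  The symbol obeys order-zero difference bounds with constant \<open>V\<close> at the frequencies seen by the
  cutoffs at scale \<open>R\<close>. With the majorant \<open>v\<close> left free, symbols of positive order are covered,
  with \<open>V\<close> a power of \<open>R\<close>.
\<close>

definition symbol_at_scale :: "nat \<Rightarrow> nat \<Rightarrow> real \<Rightarrow> (nat^'n \<Rightarrow> complex) \<Rightarrow> bool" where
  "symbol_at_scale K R V \<tau> \<longleftrightarrow> (\<exists>v. (\<forall>i l \<xi>. l \<le> K \<longrightarrow> cmod ((fdiff i ^^ l) \<tau> \<xi>) \<le> v \<xi> / jbracket \<xi> ^ l) \<and>
     (\<forall>\<xi>. jbracket \<xi> \<le> real (10 + K) * real R \<longrightarrow> v \<xi> \<le> V))"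

text \<open>
  The low cutoff contributes \<open>(\<langle>\<xi>\<rangle> / R)^(2K+2)\<close> to the sum, which compensates the negative power
  \<open>\<langle>\<xi>\<rangle>^(-M)\<close> at low frequencies and leaves \<open>R^(-M)\<close> times the sum of the squared Hermite
  functions.
\<close>

lemma weighted_cut_kernel_bound:
  fixes i :: "'n::finite"
  assumes M: "M \<le> K"
  shows "\<exists>C\<ge>0. \<forall>(\<tau> :: nat^'n \<Rightarrow> complex) V R x. R \<ge> 1 \<longrightarrow> symbol_at_scale K R V \<tau> \<longrightarrow>
     ennreal (real R ^ M) * sqn (\<lambda>y. complex_of_real (y $ i - x $ i) ^ M
         * kernel_sum i 0 0 0 (cut_symbol (Suc K) R \<tau>) (8 * R + Suc K) x y)
       \<le> ennreal (C * V\<^sup>2 * sqrt (real R) ^ CARD('n))"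
proof -
  obtain C where C: "C \<ge> 0" "\<And>a \<psi> N x. (\<forall>\<xi>. msize \<xi> > N \<longrightarrow> a \<xi> = 0) \<Longrightarrow>
     (\<forall>l\<le>M. \<forall>\<xi>. cmod ((fdiff i ^^ l) a \<xi>) \<le> \<psi> \<xi> / jbracket \<xi> ^ l) \<Longrightarrow>
     sqn (\<lambda>y. complex_of_real (y $ i - x $ i) ^ M * kernel_sum i 0 0 0 a N x y)
     \<le> ennreal (C * (\<Sum>\<xi>\<in>msize_ball N. (\<psi> \<xi>)\<^sup>2 * jbracket \<xi> ^ 0 / jbracket \<xi> ^ M
          * (\<Sum>q\<le>0 + M. (hermite (\<xi> + axis i q) x)\<^sup>2)))"
    using sqn_weighted_kernel_sum_le[of M i 0] by blast
  define A where "A = 4 ^ K * real (2 * Suc K) ^ Suc K * real (9 + Suc K) ^ Suc K"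
  define D where "D = real (10 + K)"
  define E where "E = real (Suc M) * sqrt (real (2 * M + 20 + 4 * K)) ^ CARD('n)"
  have E0: "0 \<le> E" by (simp add: E_def)
  have D1: "1 \<le> D" by (simp add: D_def)
  have "ennreal (real R ^ M) * sqn (\<lambda>y. complex_of_real (y $ i - x $ i) ^ M
         * kernel_sum i 0 0 0 (cut_symbol (Suc K) R \<tau>) (8 * R + Suc K) x y)
       \<le> ennreal (C * A\<^sup>2 * D ^ (2 * Suc K) * E * V\<^sup>2 * sqrt (real R) ^ CARD('n))"
    if R: "R \<ge> 1" and sym: "symbol_at_scale K R V \<tau>" for \<tau> :: "nat^'n \<Rightarrow> complex" and V R x
  proof -
    obtain v where \<tau>: "\<And>l \<xi>. l \<le> K \<Longrightarrow> cmod ((fdiff i ^^ l) \<tau> \<xi>) \<le> v \<xi> / jbracket \<xi> ^ l"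
      and V: "\<And>\<xi>. jbracket \<xi> \<le> real (10 + K) * real R \<Longrightarrow> v \<xi> \<le> V"
      using sym unfolding symbol_at_scale_def by metis
    let ?B = "8 * R + Suc K"
    define \<psi> where "\<psi> \<xi> = (if msize \<xi> \<le> ?B then A * V * (jbracket \<xi> / real R) ^ Suc K else 0)" for \<xi> :: "nat^'n"
    have R0: "0 < real R" using R by simp
    have "sqn (\<lambda>y. complex_of_real (y $ i - x $ i) ^ M * kernel_sum i 0 0 0 (cut_symbol (Suc K) R \<tau>) ?B x y)
      \<le> ennreal (C * (\<Sum>\<xi>\<in>msize_ball ?B. (\<psi> \<xi>)\<^sup>2 * jbracket \<xi> ^ 0 / jbracket \<xi> ^ M
          * (\<Sum>q\<le>0 + M. (hermite (\<xi> + axis i q) x)\<^sup>2)))"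
    proof (rule C(2); intro allI impI)
      fix \<xi> :: "nat^'n" assume "?B < msize \<xi>"
      then show "cut_symbol (Suc K) R \<tau> \<xi> = 0"
        by (simp add: cut_symbol_def high_cut_def)
    next
      fix l and \<xi> :: "nat^'n" assume "l \<le> M"
      then have l: "l \<le> K" using M by simp
      show "cmod ((fdiff i ^^ l) (cut_symbol (Suc K) R \<tau>) \<xi>) \<le> \<psi> \<xi> / jbracket \<xi> ^ l"
        unfolding \<psi>_def A_def by (rule cut_symbol_bound[OF R _ _ l]) (use \<tau> V in auto)
    qed
    then have "ennreal (real R ^ M) * sqn (\<lambda>y. complex_of_real (y $ i - x $ i) ^ M * kernel_sum i 0 0 0 (cut_symbol (Suc K) R \<tau>) ?B x y)
      \<le> ennreal (real R ^ M) * ennreal (C * (\<Sum>\<xi>\<in>msize_ball ?B. (\<psi> \<xi>)\<^sup>2 / jbracket \<xi> ^ M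
          * (\<Sum>q\<le>M. (hermite (\<xi> + axis i q) x)\<^sup>2)))"
      by (intro mult_left_mono) auto
    also have "\<dots> = ennreal (C * (\<Sum>\<xi>\<in>msize_ball ?B. (real R ^ M * ((\<psi> \<xi>)\<^sup>2 / jbracket \<xi> ^ M))
          * (\<Sum>q\<le>M. (hermite (\<xi> + axis i q) x)\<^sup>2)))"
    proof -
      have "r * (C * (\<Sum>\<xi>\<in>S. f \<xi> * g \<xi>)) = C * (\<Sum>\<xi>\<in>S. (r * f \<xi>) * g \<xi>)" for r S and f g :: "nat^'n \<Rightarrow> real"
        by (simp add: sum_distrib_left mult_ac)
      then show ?thesis by (subst ennreal_mult'[symmetric]) (simp_all only: zero_le_power of_nat_0_le_iff)
    qed
    also have "\<dots> \<le> ennreal (C * (\<Sum>\<xi>\<in>msize_ball ?B. (A\<^sup>2 * V\<^sup>2 * D ^ (2 * Suc K))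
          * (\<Sum>q\<le>M. (hermite (\<xi> + axis i q) x)\<^sup>2)))"
    proof (intro ennreal_leI mult_left_mono sum_mono mult_right_mono C(1) sum_nonneg zero_le_power2)
      fix \<xi> :: "nat^'n" assume "\<xi> \<in> msize_ball ?B"
      then have m: "msize \<xi> \<le> ?B" by (simp add: msize_ball_def)
      define w where "w = jbracket \<xi> / real R"
      have w0: "0 < w" using R0 by (simp add: w_def)
      have "real K * 1 \<le> real K * real R" using R by (intro mult_left_mono) auto
      then have "jbracket \<xi> \<le> D * real R"
        using m R by (simp add: jbracket_def D_def algebra_simps)
      then have wD: "w \<le> D" using R0 by (simp add: w_def field_simps)
      have "real R ^ M * ((\<psi> \<xi>)\<^sup>2 / jbracket \<xi> ^ M) = (A\<^sup>2 * V\<^sup>2) * (w ^ (2 * Suc K) / w ^ M)"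
        using m R0 less_imp_neq[OF jbracket_pos[of \<xi>]]
        by (simp add: \<psi>_def w_def[symmetric] power_mult_distrib power_even_eq)
          (simp add: w_def power_divide field_simps power2_eq_square)
      also have "w ^ (2 * Suc K) / w ^ M = w ^ (2 * Suc K - M)"
        using w0 M by (intro power_diff[symmetric]) auto
      also have "\<dots> \<le> D ^ (2 * Suc K - M)" using w0 wD by (intro power_mono) auto
      also have "\<dots> \<le> D ^ (2 * Suc K)" using D1 by (intro power_increasing) auto
      finally show "real R ^ M * ((\<psi> \<xi>)\<^sup>2 / jbracket \<xi> ^ M) \<le> A\<^sup>2 * V\<^sup>2 * D ^ (2 * Suc K)"
        by (simp add: mult_left_mono)
    qed
    also have "\<dots> = ennreal (C * (A\<^sup>2 * V\<^sup>2 * D ^ (2 * Suc K)) * (\<Sum>\<xi>\<in>msize_ball ?B. \<Sum>q\<le>M. (hermite (\<xi> + axis i q) x)\<^sup>2))"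
      by (simp only: sum_distrib_left[symmetric] mult.assoc)
    also have "\<dots> \<le> ennreal (C * (A\<^sup>2 * V\<^sup>2 * D ^ (2 * Suc K)) * (E * sqrt (real R) ^ CARD('n)))"
      unfolding E_def using C(1) D1 by (intro ennreal_leI mult_left_mono sum_hermite_shift_sq_le R) auto
    finally show ?thesis by (simp only: mult_ac)
  qed
  then show ?thesis using C(1) D1 E0 by (intro exI[of _ "C * A\<^sup>2 * D ^ (2 * Suc K) * E"]) auto
qed

lemma ennreal_plus_sum:
  assumes "0 \<le> u" "0 \<le> r" "\<And>i. 0 \<le> g i"
  shows "ennreal (u + (\<Sum>i\<in>A. r * g i)) = ennreal u + (\<Sum>i\<in>A. ennreal r * ennreal (g i))"
  using assms by (simp add: sum_nonneg flip: ennreal_mult)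

text \<open>
  The estimates for \<open>M = 0\<close> and for \<open>M = K\<close> in all directions add up to the reciprocal weight.
\<close>

lemma kernel_weight_bound:
  assumes K: "CARD('n) < 2 * K"
  defines "q \<equiv> 2 * real K / real CARD('n)"
  shows "\<exists>C\<ge>0. \<forall>(\<tau> :: nat^'n \<Rightarrow> complex) V R x. R \<ge> 1 \<longrightarrow>
     symbol_at_scale K R V \<tau> \<longrightarrow>
     (\<integral>\<^sup>+y. ennreal ((cmod (\<Sum>\<xi>\<in>msize_ball (8 * R + Suc K). cut_symbol (Suc K) R \<tau> \<xi> * complex_of_real (hermite \<xi> x * hermite \<xi> y)))\<^sup>2
        / weight q (real R) (y - x)) \<partial>lborel)
       \<le> ennreal (C * V\<^sup>2 * sqrt (real R) ^ CARD('n))"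
proof -
  let ?k = "\<lambda>\<tau> R x y. \<Sum>\<xi>\<in>msize_ball (8 * R + Suc K). cut_symbol (Suc K) R \<tau> \<xi> * complex_of_real (hermite \<xi> x * hermite \<xi> y)"
  let ?hyp = "\<lambda>\<tau> V R. R \<ge> 1 \<and> symbol_at_scale K R V \<tau>"
  have "\<exists>C\<ge>0. \<forall>(\<tau> :: nat^'n \<Rightarrow> complex) V R x. ?hyp \<tau> V R \<longrightarrow>
      ennreal (real R ^ 0) * sqn (\<lambda>y. complex_of_real (y $ i - x $ i) ^ 0 * ?k \<tau> R x y) \<le> ennreal (C * V\<^sup>2 * sqrt (real R) ^ CARD('n))" for i :: 'n
    using weighted_cut_kernel_bound[OF le0[of K], of i] unfolding kernel_sum_0 by blast
  then obtain C0 where C0: "C0 \<ge> 0" "\<And>(\<tau> :: nat^'n \<Rightarrow> complex) V R x. ?hyp \<tau> V R \<Longrightarrow> sqn (?k \<tau> R x) \<le> ennreal (C0 * V\<^sup>2 * sqrt (real R) ^ CARD('n))"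
    by (auto simp: simp del: sum.lessThan_Suc)
  define P where "P i C \<longleftrightarrow> 0 \<le> C \<and> (\<forall>(\<tau> :: nat^'n \<Rightarrow> complex) V R x. ?hyp \<tau> V R \<longrightarrow>
      ennreal (real R ^ K) * sqn (\<lambda>y. complex_of_real (y $ i - x $ i) ^ K * ?k \<tau> R x y) \<le> ennreal (C * V\<^sup>2 * sqrt (real R) ^ CARD('n)))"
    for i :: 'n and C
  have "\<exists>C. P i C" for i
    using weighted_cut_kernel_bound[OF order_refl[of K], of i] unfolding kernel_sum_0 P_def by blast
  then obtain c where "\<And>i. P i (c i)" by metis
  then have c: "\<And>i. c i \<ge> 0" "\<And>i (\<tau> :: nat^'n \<Rightarrow> complex) V R x. ?hyp \<tau> V R \<Longrightarrow>
      ennreal (real R ^ K) * sqn (\<lambda>y. complex_of_real (y $ i - x $ i) ^ K * ?k \<tau> R x y) \<le> ennreal (c i * V\<^sup>2 * sqrt (real R) ^ CARD('n))"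
    unfolding P_def by blast+
  let ?C = "C0 + (\<Sum>i\<in>UNIV. c i)"
  have main: "(\<integral>\<^sup>+y. ennreal ((cmod (?k \<tau> R x y))\<^sup>2 / weight q (real R) (y - x)) \<partial>lborel) \<le> ennreal (?C * V\<^sup>2 * sqrt (real R) ^ CARD('n))"
    if hyp: "?hyp \<tau> V R" for \<tau> :: "nat^'n \<Rightarrow> complex" and V R x
  proof -
    have R: "0 < real R" using hyp by simp
    have [measurable]: "?k \<tau> R x \<in> borel_measurable borel" by measurable
    have w: "ennreal ((cmod z)\<^sup>2 / weight q (real R) (y - x))
        \<le> ennreal ((cmod z)\<^sup>2) + (\<Sum>i\<in>UNIV. ennreal (real R ^ K) * ennreal ((cmod (complex_of_real (y $ i - x $ i) ^ K * z))\<^sup>2))" for y z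
    proof -
      have "(cmod z)\<^sup>2 / weight q (real R) (y - x) \<le> (cmod z)\<^sup>2 * (1 + real R ^ K * (\<Sum>j\<in>UNIV. ((y - x) $ j) ^ (2 * K)))"
        using mult_left_mono[OF inverse_weight_le[of "real R" q K "y - x"], of "(cmod z)\<^sup>2"] R K by (simp add: q_def)
      also have "\<dots> = (cmod z)\<^sup>2 + (\<Sum>i\<in>UNIV. real R ^ K * (cmod (complex_of_real (y $ i - x $ i) ^ K * z))\<^sup>2)"
      proof -
        have "(cmod (complex_of_real t ^ K * z))\<^sup>2 = t ^ (2 * K) * (cmod z)\<^sup>2" for t
          unfolding norm_mult norm_power norm_of_real power_mult_distrib
          by (simp add: power_mult[symmetric] mult.commute power_even_abs)
        then show ?thesis by (simp add: distrib_left sum_distrib_left mult_ac del: of_real_diff)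
      qed
      finally have "ennreal ((cmod z)\<^sup>2 / weight q (real R) (y - x))
          \<le> ennreal ((cmod z)\<^sup>2 + (\<Sum>i\<in>UNIV. real R ^ K * (cmod (complex_of_real (y $ i - x $ i) ^ K * z))\<^sup>2))"
        by (rule ennreal_leI)
      then show ?thesis by (simp only: ennreal_plus_sum zero_le_power2 zero_le_power of_nat_0_le_iff)
    qed
    have "(\<integral>\<^sup>+y. ennreal ((cmod (?k \<tau> R x y))\<^sup>2 / weight q (real R) (y - x)) \<partial>lborel)
      \<le> (\<integral>\<^sup>+y. ennreal ((cmod (?k \<tau> R x y))\<^sup>2) + (\<Sum>i\<in>UNIV. ennreal (real R ^ K) * ennreal ((cmod (complex_of_real (y $ i - x $ i) ^ K * ?k \<tau> R x y))\<^sup>2)) \<partial>lborel)"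
      by (intro nn_integral_mono w)
    also have "\<dots> = sqn (?k \<tau> R x) + (\<Sum>i\<in>UNIV. ennreal (real R ^ K) * sqn (\<lambda>y. complex_of_real (y $ i - x $ i) ^ K * ?k \<tau> R x y))"
      unfolding sqn_def by (simp add: nn_integral_add nn_integral_sum nn_integral_cmult)
    also have "\<dots> \<le> ennreal (C0 * V\<^sup>2 * sqrt (real R) ^ CARD('n)) + (\<Sum>i\<in>UNIV. ennreal (c i * V\<^sup>2 * sqrt (real R) ^ CARD('n)))"
      by (intro add_mono sum_mono C0(2)[OF hyp] c(2)[OF hyp])
    also have "\<dots> = ennreal (?C * V\<^sup>2 * sqrt (real R) ^ CARD('n))"
    proof -
      have "(\<Sum>i\<in>UNIV. ennreal (c i * V\<^sup>2 * sqrt (real R) ^ CARD('n))) = ennreal (\<Sum>i\<in>UNIV. c i * V\<^sup>2 * sqrt (real R) ^ CARD('n))"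
        using c(1) by (intro sum_ennreal) auto
      then show ?thesis
        using c(1) C0(1) by (simp add: sum_nonneg sum_distrib_right distrib_right flip: ennreal_plus)
    qed
    finally show ?thesis .
  qed
  show ?thesis
  proof (intro exI[of _ ?C] conjI allI impI)
    show "0 \<le> ?C" using c(1) C0(1) by (auto intro: add_nonneg_nonneg sum_nonneg)
  next
    fix \<tau> :: "nat^'n \<Rightarrow> complex" and V R x assume "1 \<le> R" "symbol_at_scale K R V \<tau>"
    then show "(\<integral>\<^sup>+y. ennreal ((cmod (?k \<tau> R x y))\<^sup>2 / weight q (real R) (y - x)) \<partial>lborel) \<le> ennreal (?C * V\<^sup>2 * sqrt (real R) ^ CARD('n))"
      by (intro main conjI)
  qed
qed

text \<open>
  The output at \<open>x\<close> is the integral of the cut kernel against the input divided by the cutoff.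
  Cauchy-Schwarz with the weight, Tonelli's theorem and the integral of the weight finish the
  proof: the factor \<open>R^(n/2)\<close> of the kernel cancels the factor \<open>R^(-n/2)\<close> of the weight.
\<close>

lemma dyadic_bound_untruncated:
  assumes K: "CARD('n) < 2 * K"
  shows "\<exists>C\<ge>0. \<forall>(\<tau>::real^'n \<Rightarrow> nat^'n \<Rightarrow> complex) V R c. R \<ge> 1 \<longrightarrow>
     (\<forall>\<xi>. (\<lambda>x. \<tau> x \<xi>) \<in> borel_measurable borel) \<longrightarrow>
     (\<forall>x. symbol_at_scale K R V (\<tau> x)) \<longrightarrow>
     (\<forall>\<xi>. c \<xi> \<noteq> 0 \<longrightarrow> real R \<le> 2 * jbracket \<xi> \<and> jbracket \<xi> \<le> 4 * real R) \<longrightarrow>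
     sqn (\<lambda>x. \<Sum>\<xi>\<in>msize_ball (8 * R + Suc K). \<tau> x \<xi> * c \<xi> * complex_of_real (hermite \<xi> x))
       \<le> ennreal (C * V\<^sup>2 * (\<Sum>\<xi>\<in>msize_ball (8 * R + Suc K). (cmod (c \<xi>))\<^sup>2))"
proof -
  define q where "q = 2 * real K / real CARD('n)"
  have "q > 1" using K by (simp add: q_def field_simps)
  then obtain I where I: "I \<ge> 0" "(\<integral>\<^sup>+t. ennreal (max 1 \<bar>t::real\<bar> powr (- q)) \<partial>lborel) = ennreal I"
    by (rule nn_integral_bump_finite)
  obtain C where C: "C \<ge> 0" "\<And>(\<tau> :: nat^'n \<Rightarrow> complex) V R x. R \<ge> 1 \<Longrightarrow>
     symbol_at_scale K R V \<tau> \<Longrightarrow>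
     (\<integral>\<^sup>+y. ennreal ((cmod (\<Sum>\<xi>\<in>msize_ball (8 * R + Suc K). cut_symbol (Suc K) R \<tau> \<xi> * complex_of_real (hermite \<xi> x * hermite \<xi> y)))\<^sup>2
        / weight q (real R) (y - x)) \<partial>lborel)
       \<le> ennreal (C * V\<^sup>2 * sqrt (real R) ^ CARD('n))"
    using kernel_weight_bound[OF K] unfolding q_def by blast
  \<comment> \<open>The lower bound for the cutoff on the support of the coefficients.\<close>
  define c0 where "c0 = (1 / (2 * real (Suc K))) ^ Suc K * (1 / real (Suc K)) ^ Suc K"
  have c0: "0 < c0" by (simp add: c0_def)
  let ?C = "C * I ^ CARD('n) / c0\<^sup>2"
  have main: "sqn (\<lambda>x. \<Sum>\<xi>\<in>msize_ball (8 * R + Suc K). \<tau> x \<xi> * c \<xi> * complex_of_real (hermite \<xi> x))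
       \<le> ennreal (?C * V\<^sup>2 * (\<Sum>\<xi>\<in>msize_ball (8 * R + Suc K). (cmod (c \<xi>))\<^sup>2))"
    if R: "R \<ge> 1" and meas: "\<forall>\<xi>. (\<lambda>x. \<tau> x \<xi>) \<in> borel_measurable borel"
      and \<tau>: "\<forall>x. symbol_at_scale K R V (\<tau> x)"
      and supp: "\<forall>\<xi>. c \<xi> \<noteq> 0 \<longrightarrow> real R \<le> 2 * jbracket \<xi> \<and> jbracket \<xi> \<le> 4 * real R"
    for \<tau> :: "real^'n \<Rightarrow> nat^'n \<Rightarrow> complex" and V R c
  proof -
    define S :: "(nat^'n) set" where "S = msize_ball (8 * R + Suc K)"
    have S: "finite S" by (simp add: S_def)
    have R0: "0 < real R" using R by simp
    define \<phi> where "\<phi> \<xi> = low_cut (Suc K) R (msize \<xi>) * high_cut (Suc K) R (msize \<xi>)" for \<xi> :: "nat^'n"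
    have \<phi>: "c0 \<le> \<phi> \<xi>" if "c \<xi> \<noteq> 0" for \<xi>
      using cut_lower_bound[of R "Suc K" \<xi>] R supp that by (simp add: c0_def \<phi>_def)
    \<comment> \<open>The kernel carries the cutoff, so the input is divided by it; where \<open>c\<close>
        vanishes the quotient is zero whatever the value of \<open>\<phi>\<close>.\<close>
    define b where "b \<xi> = c \<xi> / complex_of_real (\<phi> \<xi>)" for \<xi>
    define f where "f y = (\<Sum>\<xi>\<in>S. b \<xi> * complex_of_real (hermite \<xi> y))" for y
    define k where "k x y = (\<Sum>\<xi>\<in>S. cut_symbol (Suc K) R (\<tau> x) \<xi> * complex_of_real (hermite \<xi> x * hermite \<xi> y))" for x y
    define w where "w z = weight q (real R) z" for z :: "real^'n"
    have w0: "0 < w z" for z by (simp add: w_def weight_pos)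
    have [measurable]: "f \<in> borel_measurable borel" unfolding f_def[abs_def] by measurable
    have [measurable]: "k x \<in> borel_measurable borel" for x unfolding k_def[abs_def] by measurable
    have [measurable]: "w \<in> borel_measurable borel" unfolding w_def[abs_def] by measurable
    have fsq: "(\<integral>\<^sup>+y. ennreal ((cmod (f y))\<^sup>2) \<partial>lborel) \<le> ennreal ((\<Sum>\<xi>\<in>S. (cmod (c \<xi>))\<^sup>2) / c0\<^sup>2)"
    proof -
      have "(\<integral>\<^sup>+y. ennreal ((cmod (f y))\<^sup>2) \<partial>lborel) = ennreal (\<Sum>\<xi>\<in>S. (cmod (b \<xi>))\<^sup>2)"
        unfolding f_def hermite_parseval(2)[OF S inj_on_id, unfolded id_def, symmetric]
        by (rule nn_integral_eq_integral[OF hermite_parseval(1)[OF S inj_on_id, unfolded id_def]]) simp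
      also have "\<dots> \<le> ennreal ((\<Sum>\<xi>\<in>S. (cmod (c \<xi>))\<^sup>2) / c0\<^sup>2)"
        unfolding sum_divide_distrib
      proof (intro ennreal_leI sum_mono)
        fix \<xi>
        show "(cmod (b \<xi>))\<^sup>2 \<le> (cmod (c \<xi>))\<^sup>2 / c0\<^sup>2"
        proof (cases "c \<xi> = 0")
          case False
          have "(cmod (b \<xi>))\<^sup>2 = (cmod (c \<xi>))\<^sup>2 / (\<phi> \<xi>)\<^sup>2" by (simp add: b_def norm_divide power_divide)
          also have "\<dots> \<le> (cmod (c \<xi>))\<^sup>2 / c0\<^sup>2"
            using c0 \<phi>[OF False] by (intro divide_left_mono power_mono) auto
          finally show ?thesis .
        qed (simp add: b_def)
      qed
      finally show ?thesis .
    qed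
    have rep: "(\<Sum>\<xi>\<in>S. \<tau> x \<xi> * c \<xi> * complex_of_real (hermite \<xi> x)) = (\<integral>y. k x y * f y \<partial>lborel)" for x
    proof -
      have "(\<integral>y. k x y * f y \<partial>lborel) = (\<Sum>\<xi>\<in>S. (cut_symbol (Suc K) R (\<tau> x) \<xi> * complex_of_real (hermite \<xi> x)) * b \<xi>)"
        using hermite_bilinear[OF S, of "\<lambda>\<xi>. cut_symbol (Suc K) R (\<tau> x) \<xi> * complex_of_real (hermite \<xi> x)" b]
        unfolding k_def f_def by (simp add: mult.assoc)
      also have "\<dots> = (\<Sum>\<xi>\<in>S. \<tau> x \<xi> * c \<xi> * complex_of_real (hermite \<xi> x))"
      proof (rule sum.cong[OF refl])
        fix \<xi>
        show "(cut_symbol (Suc K) R (\<tau> x) \<xi> * complex_of_real (hermite \<xi> x)) * b \<xi> = \<tau> x \<xi> * c \<xi> * complex_of_real (hermite \<xi> x)"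
        proof (cases "c \<xi> = 0")
          case False
          then have "\<phi> \<xi> \<noteq> 0" using \<phi>[OF False] c0 by linarith
          moreover have "cut_symbol (Suc K) R (\<tau> x) \<xi> = \<tau> x \<xi> * complex_of_real (\<phi> \<xi>)"
            by (simp add: cut_symbol_def \<phi>_def)
          ultimately show ?thesis by (simp add: b_def)
        qed (simp add: b_def)
      qed
      finally show ?thesis by simp
    qed
    have pointwise: "ennreal ((cmod (\<Sum>\<xi>\<in>S. \<tau> x \<xi> * c \<xi> * complex_of_real (hermite \<xi> x)))\<^sup>2)
        \<le> ennreal (C * V\<^sup>2 * sqrt (real R) ^ CARD('n)) * (\<integral>\<^sup>+y. ennreal ((cmod (f y))\<^sup>2 * w (y - x)) \<partial>lborel)" for x
    proof -
      have "ennreal (cmod (\<integral>y. k x y * f y \<partial>lborel)) \<le> (\<integral>\<^sup>+y. ennreal (cmod (k x y / complex_of_real (sqrt (w (y - x))))) * ennreal (cmod (f y) * sqrt (w (y - x))) \<partial>lborel)"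
      proof (cases "integrable lborel (\<lambda>y. k x y * f y)")
        case True
        have "ennreal (cmod (\<integral>y. k x y * f y \<partial>lborel)) \<le> (\<integral>\<^sup>+y. ennreal (cmod (k x y * f y)) \<partial>lborel)"
          using integral_norm_bound_ennreal[OF True] by simp
        also have "\<dots> = (\<integral>\<^sup>+y. ennreal (cmod (k x y / complex_of_real (sqrt (w (y - x))))) * ennreal (cmod (f y) * sqrt (w (y - x))) \<partial>lborel)"
        proof (rule nn_integral_cong)
          fix y
          have "0 < sqrt (w (y - x))" using w0 by simp
          then have "cmod (k x y * f y) = cmod (k x y / complex_of_real (sqrt (w (y - x)))) * (cmod (f y) * sqrt (w (y - x)))"
            by (simp add: norm_mult norm_divide less_imp_le)
          then show "ennreal (cmod (k x y * f y)) = ennreal (cmod (k x y / complex_of_real (sqrt (w (y - x))))) * ennreal (cmod (f y) * sqrt (w (y - x)))"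
            using w0[of "y - x"] by (simp only:) (rule ennreal_mult, auto simp: less_imp_le)
        qed
        finally show ?thesis .
      qed (simp add: not_integrable_integral_eq)
      then have "(ennreal (cmod (\<integral>y. k x y * f y \<partial>lborel)))\<^sup>2 \<le> (\<integral>\<^sup>+y. ennreal (cmod (k x y / complex_of_real (sqrt (w (y - x))))) * ennreal (cmod (f y) * sqrt (w (y - x))) \<partial>lborel)\<^sup>2"
        by (intro power_mono) auto
      also have "\<dots> \<le> (\<integral>\<^sup>+y. (ennreal (cmod (k x y / complex_of_real (sqrt (w (y - x))))))\<^sup>2 \<partial>lborel) * (\<integral>\<^sup>+y. (ennreal (cmod (f y) * sqrt (w (y - x))))\<^sup>2 \<partial>lborel)"
        by (rule Cauchy_Schwarz_nn_integral) measurable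
      also have "\<dots> = (\<integral>\<^sup>+y. ennreal ((cmod (k x y))\<^sup>2 / w (y - x)) \<partial>lborel) * (\<integral>\<^sup>+y. ennreal ((cmod (f y))\<^sup>2 * w (y - x)) \<partial>lborel)"
        using w0 by (simp add: ennreal_power norm_divide power_divide power_mult_distrib less_imp_le)
      also have "\<dots> \<le> ennreal (C * V\<^sup>2 * sqrt (real R) ^ CARD('n)) * (\<integral>\<^sup>+y. ennreal ((cmod (f y))\<^sup>2 * w (y - x)) \<partial>lborel)"
        unfolding k_def w_def S_def by (intro mult_right_mono C(2)[OF R \<tau>[rule_format]]) auto
      finally show ?thesis unfolding rep by (simp add: ennreal_power)
    qed
    have "sqn (\<lambda>x. \<Sum>\<xi>\<in>S. \<tau> x \<xi> * c \<xi> * complex_of_real (hermite \<xi> x))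
        \<le> (\<integral>\<^sup>+x. ennreal (C * V\<^sup>2 * sqrt (real R) ^ CARD('n)) * (\<integral>\<^sup>+y. ennreal ((cmod (f y))\<^sup>2 * w (y - x)) \<partial>lborel) \<partial>lborel)"
      unfolding sqn_def by (intro nn_integral_mono pointwise)
    also have "\<dots> = ennreal (C * V\<^sup>2 * sqrt (real R) ^ CARD('n)) * (\<integral>\<^sup>+x. (\<integral>\<^sup>+y. ennreal ((cmod (f y))\<^sup>2 * w (y - x)) \<partial>lborel) \<partial>lborel)"
      by (rule nn_integral_cmult) measurable
    also have "(\<integral>\<^sup>+x. (\<integral>\<^sup>+y. ennreal ((cmod (f y))\<^sup>2 * w (y - x)) \<partial>lborel) \<partial>lborel)
        = (\<integral>\<^sup>+y. (\<integral>\<^sup>+x. ennreal ((cmod (f y))\<^sup>2 * w (y - x)) \<partial>lborel) \<partial>lborel)"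
      by (rule lborel_pair.Fubini') measurable
    also have "\<dots> = (\<integral>\<^sup>+y. ennreal ((cmod (f y))\<^sup>2) * ennreal ((I / sqrt (real R)) ^ CARD('n)) \<partial>lborel)"
    proof (rule nn_integral_cong)
      fix y
      have "(\<integral>\<^sup>+x. ennreal ((cmod (f y))\<^sup>2 * w (y - x)) \<partial>lborel) = (\<integral>\<^sup>+x. ennreal ((cmod (f y))\<^sup>2) * ennreal (w (y - x)) \<partial>lborel)"
        using w0 by (simp add: ennreal_mult less_imp_le)
      also have "\<dots> = ennreal ((cmod (f y))\<^sup>2) * (\<integral>\<^sup>+x. ennreal (w (y - x)) \<partial>lborel)"
        by (rule nn_integral_cmult) measurable
      finally show "(\<integral>\<^sup>+x. ennreal ((cmod (f y))\<^sup>2 * w (y - x)) \<partial>lborel) = ennreal ((cmod (f y))\<^sup>2) * ennreal ((I / sqrt (real R)) ^ CARD('n))"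
        unfolding w_def nn_integral_weight[OF I R0] .
    qed
    also have "\<dots> = ennreal ((I / sqrt (real R)) ^ CARD('n)) * (\<integral>\<^sup>+y. ennreal ((cmod (f y))\<^sup>2) \<partial>lborel)"
      by (subst mult.commute) (rule nn_integral_cmult, measurable)
    also have "ennreal (C * V\<^sup>2 * sqrt (real R) ^ CARD('n)) * (ennreal ((I / sqrt (real R)) ^ CARD('n)) * (\<integral>\<^sup>+y. ennreal ((cmod (f y))\<^sup>2) \<partial>lborel))
        \<le> ennreal (C * V\<^sup>2 * sqrt (real R) ^ CARD('n)) * (ennreal ((I / sqrt (real R)) ^ CARD('n)) * ennreal ((\<Sum>\<xi>\<in>S. (cmod (c \<xi>))\<^sup>2) / c0\<^sup>2))"
      by (intro mult_left_mono fsq) auto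
    also have "\<dots> = ennreal (?C * V\<^sup>2 * (\<Sum>\<xi>\<in>S. (cmod (c \<xi>))\<^sup>2))"
    proof -
      have "sqrt (real R) ^ CARD('n) * (I / sqrt (real R)) ^ CARD('n) = I ^ CARD('n)"
        using R0 by (simp flip: power_mult_distrib)
      then have "(C * V\<^sup>2 * sqrt (real R) ^ CARD('n)) * ((I / sqrt (real R)) ^ CARD('n) * ((\<Sum>\<xi>\<in>S. (cmod (c \<xi>))\<^sup>2) / c0\<^sup>2))
          = ?C * V\<^sup>2 * (\<Sum>\<xi>\<in>S. (cmod (c \<xi>))\<^sup>2)"
        using R c0 by (simp add: field_simps)
      then show ?thesis
        using C(1) I(1) by (subst ennreal_mult[symmetric], simp, simp add: sum_nonneg, subst ennreal_mult[symmetric]) (simp_all add: sum_nonneg)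
    qed
    finally show ?thesis unfolding S_def .
  qed
  show ?thesis
  proof (intro exI[of _ ?C] conjI allI impI)
    show "0 \<le> ?C" using C(1) I(1) by simp
  qed (rule main)
qed

definition hermite_op :: "nat \<Rightarrow> (real^'n \<Rightarrow> nat^'n \<Rightarrow> complex) \<Rightarrow> (nat^'n \<Rightarrow> complex) \<Rightarrow> real^'n \<Rightarrow> complex" where
  "hermite_op N \<tau> c x = (\<Sum>\<xi>\<in>msize_ball N. \<tau> x \<xi> * c \<xi> * complex_of_real (hermite \<xi> x))"

lemma borel_measurable_hermite_op:
  assumes [measurable]: "\<And>\<xi>. (\<lambda>x. \<tau> x \<xi>) \<in> borel_measurable borel"
  shows "hermite_op N \<tau> c \<in> borel_measurable borel"
  unfolding hermite_op_def[abs_def] by measurable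

lemma sum_msize_ball_truncate:
  fixes f :: "nat^'n \<Rightarrow> complex \<Rightarrow> 'b::comm_monoid_add"
  assumes f: "\<And>\<xi>. f \<xi> 0 = 0" and c: "\<And>\<xi>. \<xi> \<notin> msize_ball B \<Longrightarrow> c \<xi> = 0"
  shows "(\<Sum>\<xi>\<in>msize_ball N. f \<xi> (c \<xi>)) = (\<Sum>\<xi>\<in>msize_ball B. f \<xi> (if msize \<xi> \<le> N then c \<xi> else 0))"
proof -
  have "(\<Sum>\<xi>\<in>msize_ball N. f \<xi> (c \<xi>)) = (\<Sum>\<xi>\<in>msize_ball N \<inter> msize_ball B. f \<xi> (c \<xi>))"
    by (rule sum.mono_neutral_right) (auto simp: f c)
  also have "\<dots> = (\<Sum>\<xi>\<in>msize_ball B. f \<xi> (if msize \<xi> \<le> N then c \<xi> else 0))"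
    by (rule sum.mono_neutral_cong_left) (auto simp: msize_ball_def[of N] f)
  finally show ?thesis .
qed

lemma borel_measurable_cnj [measurable (raw)]:
  "f \<in> borel_measurable M \<Longrightarrow> (\<lambda>x. cnj (f x)) \<in> borel_measurable M"
  by (rule measurable_compose[where N=borel]) (auto intro!: borel_measurable_continuous_onI continuous_intros)

text \<open>
  As the coefficients live at scale \<open>R\<close>, changing the radius of the ball of summation amounts to
  discarding some of them.
\<close>

lemma dyadic_bound:
  assumes K: "CARD('n) < 2 * K"
  obtains C where "C \<ge> 0" "\<And>(\<tau>::real^'n \<Rightarrow> nat^'n \<Rightarrow> complex) V R N c. R \<ge> 1 \<Longrightarrow>
     (\<And>\<xi>. (\<lambda>x. \<tau> x \<xi>) \<in> borel_measurable borel) \<Longrightarrow>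
     (\<And>x. symbol_at_scale K R V (\<tau> x)) \<Longrightarrow>
     (\<And>\<xi>. c \<xi> \<noteq> 0 \<Longrightarrow> real R \<le> 2 * jbracket \<xi> \<and> jbracket \<xi> \<le> 4 * real R) \<Longrightarrow>
     sqn (hermite_op N \<tau> c) \<le> ennreal (C * V\<^sup>2 * (\<Sum>\<xi>\<in>msize_ball N. (cmod (c \<xi>))\<^sup>2))"
proof -
  obtain C where C: "C \<ge> 0" "\<And>(\<tau>::real^'n \<Rightarrow> nat^'n \<Rightarrow> complex) V R c. R \<ge> 1 \<Longrightarrow>
     (\<forall>\<xi>. (\<lambda>x. \<tau> x \<xi>) \<in> borel_measurable borel) \<Longrightarrow>
     (\<forall>x. symbol_at_scale K R V (\<tau> x)) \<Longrightarrow>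
     (\<forall>\<xi>. c \<xi> \<noteq> 0 \<longrightarrow> real R \<le> 2 * jbracket \<xi> \<and> jbracket \<xi> \<le> 4 * real R) \<Longrightarrow>
     sqn (\<lambda>x. \<Sum>\<xi>\<in>msize_ball (8 * R + Suc K). \<tau> x \<xi> * c \<xi> * complex_of_real (hermite \<xi> x))
       \<le> ennreal (C * V\<^sup>2 * (\<Sum>\<xi>\<in>msize_ball (8 * R + Suc K). (cmod (c \<xi>))\<^sup>2))"
    using dyadic_bound_untruncated[OF K] by blast
  show ?thesis
  proof (rule that[OF C(1)])
    fix \<tau> :: "real^'n \<Rightarrow> nat^'n \<Rightarrow> complex" and V R N and c :: "nat^'n \<Rightarrow> complex"
    assume R: "R \<ge> 1" and m: "\<And>\<xi>. (\<lambda>x. \<tau> x \<xi>) \<in> borel_measurable borel"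
      and \<tau>: "\<And>x. symbol_at_scale K R V (\<tau> x)"
      and supp: "\<And>\<xi>. c \<xi> \<noteq> 0 \<Longrightarrow> real R \<le> 2 * jbracket \<xi> \<and> jbracket \<xi> \<le> 4 * real R"
    define c' where "c' \<xi> = (if msize \<xi> \<le> N then c \<xi> else 0)" for \<xi>
    let ?B = "8 * R + Suc K"
    have zero: "c \<xi> = 0" if "\<xi> \<notin> msize_ball ?B" for \<xi>
    proof (rule ccontr)
      assume "c \<xi> \<noteq> 0"
      then have "jbracket \<xi> \<le> 4 * real R" using supp by blast
      then show False using that by (simp add: jbracket_def msize_ball_def)
    qed
    have op: "hermite_op N \<tau> c = (\<lambda>x. \<Sum>\<xi>\<in>msize_ball ?B. \<tau> x \<xi> * c' \<xi> * complex_of_real (hermite \<xi> x))"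
    proof
      show "hermite_op N \<tau> c x = (\<Sum>\<xi>\<in>msize_ball ?B. \<tau> x \<xi> * c' \<xi> * complex_of_real (hermite \<xi> x))" for x
        unfolding hermite_op_def c'_def by (rule sum_msize_ball_truncate) (simp_all add: zero)
    qed
    have sq: "(\<Sum>\<xi>\<in>msize_ball N. (cmod (c \<xi>))\<^sup>2) = (\<Sum>\<xi>\<in>msize_ball ?B. (cmod (c' \<xi>))\<^sup>2)"
      unfolding c'_def by (rule sum_msize_ball_truncate) (simp_all add: zero)
    show "sqn (hermite_op N \<tau> c) \<le> ennreal (C * V\<^sup>2 * (\<Sum>\<xi>\<in>msize_ball N. (cmod (c \<xi>))\<^sup>2))"
      unfolding op sq by (rule C(2)[OF R]) (use m \<tau> supp in \<open>auto simp: c'_def split: if_splits\<close>)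
  qed
qed

section \<open>Inner products of rapidly decreasing functions\<close>

text \<open>
  The class in which integration by parts has no boundary terms; it contains the Hermite
  functions and is closed under multiplication by bounded measurable functions.
\<close>

definition decaying :: "(real^'n \<Rightarrow> complex) \<Rightarrow> bool" where
  "decaying u \<longleftrightarrow> u \<in> borel_measurable borel \<and> (\<exists>C\<ge>0. \<forall>x. cmod (u x) \<le> C * decay x)"

lemma decaying_measurable [measurable_dest]: "decaying u \<Longrightarrow> u \<in> borel_measurable borel"
  by (simp add: decaying_def)

lemma decaying_hermite: "decaying (\<lambda>x. complex_of_real (hermite \<xi> x))"
  unfolding decaying_def using hermite_decay[of \<xi>] by (auto intro: less_imp_le)

lemma decaying_add:
  assumes "decaying u" "decaying v"
  shows "decaying (\<lambda>x. u x + v x)"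
proof -
  obtain C where C: "C \<ge> 0" "\<And>x. cmod (u x) \<le> C * decay x" using assms(1) by (auto simp: decaying_def)
  obtain D where D: "D \<ge> 0" "\<And>x. cmod (v x) \<le> D * decay x" using assms(2) by (auto simp: decaying_def)
  have "cmod (u x + v x) \<le> (C + D) * decay x" for x
    using norm_triangle_ineq[of "u x" "v x"] C(2)[of x] D(2)[of x] by (simp add: distrib_right)
  then show ?thesis using assms C(1) D(1) unfolding decaying_def
    by (intro conjI exI[of _ "C + D"]) auto
qed

lemma decaying_bounded_mult:
  assumes "decaying u" "b \<in> borel_measurable borel" "\<And>x. cmod (b x) \<le> B"
  shows "decaying (\<lambda>x. b x * u x)"
proof -
  obtain C where C: "C \<ge> 0" "\<And>x. cmod (u x) \<le> C * decay x" using assms(1) by (auto simp: decaying_def)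
  have B: "0 \<le> B" using order_trans[OF norm_ge_zero assms(3)] by blast
  have "cmod (b x * u x) \<le> (B * C) * decay x" for x
    unfolding norm_mult mult.assoc using assms(3) C B by (intro mult_mono) auto
  then show ?thesis using assms C(1) B unfolding decaying_def
    by (intro conjI exI[of _ "B * C"]) auto
qed

lemma decaying_cmult: "decaying u \<Longrightarrow> decaying (\<lambda>x. c * u x)"
  by (rule decaying_bounded_mult[where B="cmod c"]) auto

lemma decaying_sum: "(\<And>i. i \<in> S \<Longrightarrow> decaying (u i)) \<Longrightarrow> decaying (\<lambda>x. \<Sum>i\<in>S. u i x)"
proof (induction S rule: infinite_finite_induct)
  case empty
  have "decaying (\<lambda>x. 0)" unfolding decaying_def by (auto intro!: exI[of _ 0])
  then show ?case by simp
next
  case (infinite S)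
  have "decaying (\<lambda>x. 0)" unfolding decaying_def by (auto intro!: exI[of _ 0])
  then show ?case using infinite by simp
qed (simp add: decaying_add)

lemma decaying_coordinate_hermite: "decaying (\<lambda>x. complex_of_real (x $ i * hermite \<xi> x))"
  unfolding hermite_three_term of_real_add of_real_mult
  by (intro decaying_add decaying_cmult decaying_hermite)

lemma decaying_mult_bound:
  assumes "decaying u" "decaying v"
  obtains C where "C \<ge> 0" "\<And>x. cmod (cnj (u x) * v x) \<le> C * decay x"
proof -
  obtain C where C: "C \<ge> 0" "\<And>x. cmod (u x) \<le> C * decay x" using assms(1) by (auto simp: decaying_def)
  obtain D where D: "D \<ge> 0" "\<And>x. cmod (v x) \<le> D * decay x" using assms(2) by (auto simp: decaying_def)
  have "cmod (u x) \<le> C" for x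
    using C(2)[of x] mult_left_mono[OF decay_le_1 C(1)] by (rule order_trans[OF _ order_trans]) simp
  then have "cmod (cnj (u x) * v x) \<le> C * (D * decay x)" for x
    unfolding norm_mult complex_mod_cnj using D C(1) by (intro mult_mono) auto
  then show ?thesis using that[of "C * D"] C(1) D(1) by (simp add: mult.assoc)
qed

lemma decaying_integrable_mult:
  assumes "decaying u" "decaying v"
  shows "integrable lborel (\<lambda>x. cnj (u x) * v x)"
proof -
  obtain C where C: "C \<ge> 0" "\<And>x. cmod (cnj (u x) * v x) \<le> C * decay x"
    using decaying_mult_bound[OF assms] by blast
  note [measurable] = decaying_measurable[OF assms(1)] decaying_measurable[OF assms(2)]
  show ?thesis
  proof (rule Bochner_Integration.integrable_bound)
    show "integrable lborel (\<lambda>x. C * decay x)" by (intro integrable_mult_right integrable_decay)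
    show "AE x in lborel. norm (cnj (u x) * v x) \<le> norm (C * decay x)"
      by (rule AE_I2) (rule order_trans[OF C(2)], simp)
  qed measurable
qed

lemma decaying_L2:
  assumes "decaying u"
  shows "u \<in> L2"
proof -
  have "integrable lborel (\<lambda>x. cmod (cnj (u x) * u x))"
    by (intro integrable_norm decaying_integrable_mult assms)
  then show ?thesis
    using decaying_measurable[OF assms] by (simp add: L2_def norm_mult power2_eq_square)
qed

lemma L2_norm_nonneg: "0 \<le> L2_norm f"
  by (simp add: L2_norm_def)

lemma sqn_eq_L2_norm: "f \<in> L2 \<Longrightarrow> sqn f = ennreal ((L2_norm f)\<^sup>2)"
  by (simp add: L2_def sqn_def L2_norm_def nn_integral_eq_integral)

lemma L2_norm_le:
  assumes "f \<in> L2" "sqn f \<le> ennreal (B\<^sup>2)" "B \<ge> 0"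
  shows "L2_norm f \<le> B"
  using assms by (simp add: sqn_eq_L2_norm L2_norm_nonneg power2_le_iff_abs_le)

lemma L2_inner_bound:
  assumes "u \<in> L2" "v \<in> L2"
  shows "cmod (\<integral>x. cnj (u x) * v x \<partial>lborel) \<le> L2_norm u * L2_norm v"
proof (cases "integrable lborel (\<lambda>x. cnj (u x) * v x)")
  case True
  have [measurable]: "u \<in> borel_measurable borel" "v \<in> borel_measurable borel" using assms by (auto simp: L2_def)
  have "ennreal (cmod (\<integral>x. cnj (u x) * v x \<partial>lborel)) \<le> (\<integral>\<^sup>+x. ennreal (cmod (u x)) * ennreal (cmod (v x)) \<partial>lborel)"
    using integral_norm_bound_ennreal[OF True] by (simp add: norm_mult ennreal_mult)
  then have "(ennreal (cmod (\<integral>x. cnj (u x) * v x \<partial>lborel)))\<^sup>2 \<le> (\<integral>\<^sup>+x. ennreal (cmod (u x)) * ennreal (cmod (v x)) \<partial>lborel)\<^sup>2"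
    by (intro power_mono) auto
  also have "\<dots> \<le> (\<integral>\<^sup>+x. (ennreal (cmod (u x)))\<^sup>2 \<partial>lborel) * (\<integral>\<^sup>+x. (ennreal (cmod (v x)))\<^sup>2 \<partial>lborel)"
    by (rule Cauchy_Schwarz_nn_integral) measurable
  also have "\<dots> = sqn u * sqn v" by (simp add: sqn_def ennreal_power)
  also have "\<dots> = ennreal ((L2_norm u * L2_norm v)\<^sup>2)"
    using assms by (simp add: sqn_eq_L2_norm power_mult_distrib ennreal_mult)
  finally have "(cmod (\<integral>x. cnj (u x) * v x \<partial>lborel))\<^sup>2 \<le> (L2_norm u * L2_norm v)\<^sup>2"
    by (simp add: ennreal_power)
  then show ?thesis by (rule power2_le_imp_le) (simp add: L2_norm_nonneg)
qed (simp add: not_integrable_integral_eq L2_norm_nonneg)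

lemma integration_by_parts:
  assumes dec: "decaying u" "decaying v" "decaying u'" "decaying v'"
    and u: "\<And>x. ((\<lambda>t. u (x + t *\<^sub>R axis i 1)) has_vector_derivative u' x) (at 0)"
    and v: "\<And>x. ((\<lambda>t. v (x + t *\<^sub>R axis i 1)) has_vector_derivative v' x) (at 0)"
  shows "(\<integral>x. cnj (u x) * v' x \<partial>lborel) = - (\<integral>x. cnj (u' x) * v x \<partial>lborel)"
proof -
  obtain C where C: "C \<ge> 0" "\<And>x. cmod (cnj (u x) * v' x) \<le> C * decay x"
    using decaying_mult_bound[OF dec(1,4)] by blast
  obtain D where D: "D \<ge> 0" "\<And>x. cmod (cnj (u' x) * v x) \<le> D * decay x"
    using decaying_mult_bound[OF dec(3,2)] by blast
  have "(\<integral>x. cnj (u x) * v' x + cnj (u' x) * v x \<partial>lborel) = 0"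
  proof (rule integral_directional_derivative[where b="axis i 1" and g="\<lambda>x. (C + D) * (3 * decay x)"])
    show "integrable lborel (\<lambda>x. cnj (u x) * v x)" by (rule decaying_integrable_mult[OF dec(1,2)])
    show "integrable lborel (\<lambda>x. (C + D) * (3 * decay x))" by (intro integrable_mult_right integrable_decay)
    show "((\<lambda>t. cnj (u (x + t *\<^sub>R axis i 1)) * v (x + t *\<^sub>R axis i 1)) has_vector_derivative
        cnj (u x) * v' x + cnj (u' x) * v x) (at 0)" for x
      using has_vector_derivative_mult[OF has_vector_derivative_cnj[OF u[of x]] v[of x]] by simp
    show "norm (cnj (u (x + s *\<^sub>R axis i 1)) * v' (x + s *\<^sub>R axis i 1) + cnj (u' (x + s *\<^sub>R axis i 1)) * v (x + s *\<^sub>R axis i 1))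
        \<le> (C + D) * (3 * decay x)" if "0 \<le> s" "s \<le> 1" for x s
    proof -
      let ?y = "x + s *\<^sub>R axis i 1"
      have "norm (cnj (u ?y) * v' ?y + cnj (u' ?y) * v ?y) \<le> C * decay ?y + D * decay ?y"
        by (intro norm_triangle_le add_mono C D)
      also have "\<dots> \<le> (C + D) * (3 * decay x)"
        unfolding distrib_right[symmetric] using C(1) D(1) that by (intro mult_left_mono decay_shift) auto
      finally show ?thesis .
    qed
  qed
  moreover have "(\<integral>x. cnj (u x) * v' x + cnj (u' x) * v x \<partial>lborel) = (\<integral>x. cnj (u x) * v' x \<partial>lborel) + (\<integral>x. cnj (u' x) * v x \<partial>lborel)"
    by (intro Bochner_Integration.integral_add decaying_integrable_mult dec)
  ultimately show ?thesis by (simp add: add_eq_0_iff)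
qed

lemma decaying_hermite_op:
  assumes "\<And>\<xi>. (\<lambda>x. \<tau> x \<xi>) \<in> borel_measurable borel" "\<And>\<xi> x. cmod (\<tau> x \<xi>) \<le> B \<xi>"
  shows "decaying (hermite_op N \<tau> c)"
proof -
  have "decaying (\<lambda>x. \<tau> x \<xi> * (c \<xi> * complex_of_real (hermite \<xi> x)))" for \<xi>
    by (rule decaying_bounded_mult[OF decaying_cmult[OF decaying_hermite] assms])
  then show ?thesis unfolding hermite_op_def[abs_def] mult.assoc by (intro decaying_sum)
qed

section \<open>Creation and annihilation operators acting on the output\<close>

text \<open>
  The directional derivative of the output, by the product rule, with the derivative of \<open>h\<^sub>\<xi>\<close>
  expressed through the creation operator.
\<close>

definition hermite_op_deriv ::
    "'n::finite \<Rightarrow> nat \<Rightarrow> (real^'n \<Rightarrow> nat^'n \<Rightarrow> complex) \<Rightarrow> (real^'n \<Rightarrow> nat^'n \<Rightarrow> complex) \<Rightarrow> (nat^'n \<Rightarrow> complex) \<Rightarrow> real^'n \<Rightarrow> complex" where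
  "hermite_op_deriv i N \<tau> \<tau>' c x = (\<Sum>\<xi>\<in>msize_ball N. \<tau>' x \<xi> * c \<xi> * complex_of_real (hermite \<xi> x)
     + \<tau> x \<xi> * c \<xi> * complex_of_real (x $ i * hermite \<xi> x - sqrt (2 * real (\<xi> $ i + 1)) * hermite (\<xi> + axis i 1) x))"

lemma hermite_op_has_derivative:
  assumes "\<And>\<xi>. ((\<lambda>t. \<tau> (x + t *\<^sub>R axis i 1) \<xi>) has_vector_derivative \<tau>' x \<xi>) (at 0)"
  shows "((\<lambda>t. hermite_op N \<tau> c (x + t *\<^sub>R axis i 1)) has_vector_derivative hermite_op_deriv i N \<tau> \<tau>' c x) (at 0)"
  unfolding hermite_op_def hermite_op_deriv_def
proof (rule has_vector_derivative_sum)
  fix \<xi>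
  have h: "((\<lambda>t. complex_of_real (hermite \<xi> (x + t *\<^sub>R axis i 1))) has_vector_derivative
      complex_of_real (x $ i * hermite \<xi> x - sqrt (2 * real (\<xi> $ i + 1)) * hermite (\<xi> + axis i 1) x)) (at 0)"
    by (rule has_vector_derivative_of_real) (rule hermite_derivative_raise)
  show "((\<lambda>t. \<tau> (x + t *\<^sub>R axis i 1) \<xi> * c \<xi> * complex_of_real (hermite \<xi> (x + t *\<^sub>R axis i 1))) has_vector_derivative
      \<tau>' x \<xi> * c \<xi> * complex_of_real (hermite \<xi> x)
      + \<tau> x \<xi> * c \<xi> * complex_of_real (x $ i * hermite \<xi> x - sqrt (2 * real (\<xi> $ i + 1)) * hermite (\<xi> + axis i 1) x)) (at 0)"
    using has_vector_derivative_mult[OF has_vector_derivative_mult_left[OF assms[of \<xi>], of "c \<xi>"] h] by (simp add: add.commute)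
qed

lemma decaying_hermite_op_deriv:
  assumes "\<And>\<xi>. (\<lambda>x. \<tau> x \<xi>) \<in> borel_measurable borel" "\<And>\<xi> x. cmod (\<tau> x \<xi>) \<le> B \<xi>"
    "\<And>\<xi>. (\<lambda>x. \<tau>' x \<xi>) \<in> borel_measurable borel" "\<And>\<xi> x. cmod (\<tau>' x \<xi>) \<le> B' \<xi>"
  shows "decaying (hermite_op_deriv i N \<tau> \<tau>' c)"
proof -
  have 1: "decaying (\<lambda>x. \<tau>' x \<xi> * (c \<xi> * complex_of_real (hermite \<xi> x)))" for \<xi>
    by (rule decaying_bounded_mult[OF decaying_cmult[OF decaying_hermite] assms(3,4)])
  have "decaying (\<lambda>x. complex_of_real (x $ i * hermite \<xi> x) + (- complex_of_real (sqrt (2 * real (\<xi> $ i + 1)))) * complex_of_real (hermite (\<xi> + axis i 1) x))" for \<xi>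
    by (intro decaying_add decaying_coordinate_hermite decaying_cmult decaying_hermite)
  then have "decaying (\<lambda>x. complex_of_real (x $ i * hermite \<xi> x - sqrt (2 * real (\<xi> $ i + 1)) * hermite (\<xi> + axis i 1) x))" for \<xi>
    by simp
  then have 2: "decaying (\<lambda>x. \<tau> x \<xi> * (c \<xi> * complex_of_real (x $ i * hermite \<xi> x - sqrt (2 * real (\<xi> $ i + 1)) * hermite (\<xi> + axis i 1) x)))" for \<xi>
    by (intro decaying_bounded_mult[OF decaying_cmult assms(1,2)])
  show ?thesis unfolding hermite_op_deriv_def[abs_def] mult.assoc by (intro decaying_sum decaying_add 1 2)
qed

text \<open>
  Annihilation on the output falls on the symbol as a derivative and on \<open>h\<^sub>\<xi>\<close> as a shift of
  frequencies.
\<close>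

lemma hermite_op_lower:
  fixes x :: "real^'n"
  assumes c: "\<And>\<xi>. msize \<xi> > N \<Longrightarrow> c \<xi> = 0"
  shows "hermite_op_deriv i N \<tau> \<tau>' c x + complex_of_real (x $ i) * hermite_op N \<tau> c x
    = hermite_op N \<tau>' c x
      + hermite_op N (\<lambda>x \<eta>. \<tau> x (\<eta> + axis i 1)) (\<lambda>\<eta>. c (\<eta> + axis i 1) * complex_of_real (sqrt (2 * real (\<eta> $ i + 1)))) x"
proof -
  define g where "g \<xi> = \<tau> x \<xi> * (c \<xi> * complex_of_real (sqrt (2 * real (\<xi> $ i)))) * complex_of_real (hermite (\<xi> - axis i 1) x)" for \<xi>
  have h: "2 * (x $ i * hermite \<xi> x) - sqrt (2 * real (\<xi> $ i + 1)) * hermite (\<xi> + axis i 1) x = sqrt (2 * real (\<xi> $ i)) * hermite (\<xi> - axis i 1) x" for \<xi>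
    using DERIV_unique[OF hermite_derivative_raise[of \<xi> x i] hermite_derivative_lower[of \<xi> x i]] by linarith
  have cancel: "\<eta> + axis i 1 - axis i 1 = \<eta>" for \<eta> :: "nat^'n" by (simp add: vec_eq_iff)
  have "hermite_op_deriv i N \<tau> \<tau>' c x + complex_of_real (x $ i) * hermite_op N \<tau> c x
      = (\<Sum>\<xi>\<in>msize_ball N. \<tau>' x \<xi> * c \<xi> * complex_of_real (hermite \<xi> x)
         + \<tau> x \<xi> * c \<xi> * complex_of_real (2 * (x $ i * hermite \<xi> x) - sqrt (2 * real (\<xi> $ i + 1)) * hermite (\<xi> + axis i 1) x))"
    unfolding hermite_op_deriv_def hermite_op_def sum_distrib_left sum.distrib[symmetric]
    by (intro sum.cong refl) (simp add: algebra_simps)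
  also have "\<dots> = hermite_op N \<tau>' c x + (\<Sum>\<xi>\<in>msize_ball N. g \<xi>)"
    unfolding h by (simp add: hermite_op_def g_def sum.distrib mult_ac)
  also have "(\<Sum>\<xi>\<in>msize_ball N. g \<xi>) = (\<Sum>\<xi>\<in>msize_ball N. g (\<xi> + axis i 1))"
    by (rule sum_msize_ball_shift) (auto simp: g_def c)
  finally show ?thesis unfolding hermite_op_def g_def cancel by (simp add: axis_def)
qed

text \<open>
  The output in which the creation operator is applied to every \<open>h\<^sub>\<eta>\<close>, but not to the symbol.
\<close>

definition hermite_op_raise :: "'n::finite \<Rightarrow> nat \<Rightarrow> (real^'n \<Rightarrow> nat^'n \<Rightarrow> complex) \<Rightarrow> (nat^'n \<Rightarrow> complex) \<Rightarrow> real^'n \<Rightarrow> complex" where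
  "hermite_op_raise i N \<tau> d x = (\<Sum>\<eta>\<in>msize_ball N. \<tau> x \<eta> * d \<eta> * complex_of_real (sqrt (2 * real (\<eta> $ i + 1)) * hermite (\<eta> + axis i 1) x))"

text \<open>
  Creation on the Hermite functions alone differs from creation on the whole output by the term
  with the differentiated symbol.
\<close>

lemma hermite_op_raise_eq:
  "hermite_op_raise i N \<tau> d x = - hermite_op_deriv i N \<tau> \<tau>' d x + complex_of_real (x $ i) * hermite_op N \<tau> d x + hermite_op N \<tau>' d x"
proof -
  have "t * d * complex_of_real (r * h') = - (t' * d * complex_of_real h + t * d * complex_of_real (y * h - r * h'))
      + complex_of_real y * (t * d * complex_of_real h) + t' * d * complex_of_real h" for t t' d r h h' y
    by (simp add: algebra_simps)
  then show ?thesis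
    by (simp only: hermite_op_raise_def hermite_op_deriv_def hermite_op_def sum_distrib_left sum.distrib[symmetric] sum_negf[symmetric])
qed

text \<open>
  This is the identity \<open>2 |\<xi>| h\<^sub>\<xi> = \<Sum>i. A\<^sub>i A\<^sub>i\<^sup>* h\<^sub>\<xi>\<close>, divided by \<open>2 |\<xi>|\<close> and reindexed by
  \<open>\<xi> = \<eta> + e\<^sub>i\<close>; hence the symbol on the right is evaluated at a shifted frequency.
\<close>

lemma hermite_op_eq_sum_raise:
  fixes x :: "real^'n"
  assumes c: "\<And>\<xi>. msize \<xi> > N \<Longrightarrow> c \<xi> = 0" "\<And>\<xi>. msize \<xi> = 0 \<Longrightarrow> c \<xi> = 0"
  shows "hermite_op N \<sigma> c x = (\<Sum>i\<in>UNIV. hermite_op_raise i N (\<lambda>x \<eta>. \<sigma> x (\<eta> + axis i 1))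
      (\<lambda>\<eta>. c (\<eta> + axis i 1) * complex_of_real (sqrt (real (\<eta> $ i + 1) / 2) / real (msize \<eta> + 1))) x)"
proof -
  define g where "g i \<xi> = \<sigma> x \<xi> * c \<xi> * complex_of_real (real (\<xi> $ i) / real (msize \<xi>)) * complex_of_real (hermite \<xi> x)" for i \<xi>
  have "hermite_op N \<sigma> c x = (\<Sum>\<xi>\<in>msize_ball N. \<Sum>i\<in>UNIV. g i \<xi>)"
    unfolding hermite_op_def
  proof (rule sum.cong[OF refl])
    fix \<xi> :: "nat^'n"
    show "\<sigma> x \<xi> * c \<xi> * complex_of_real (hermite \<xi> x) = (\<Sum>i\<in>UNIV. g i \<xi>)"
    proof (cases "msize \<xi> = 0")
      case False
      have "(\<Sum>i\<in>UNIV. real (\<xi> $ i) / real (msize \<xi>)) = 1"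
        using False by (simp only: sum_divide_distrib[symmetric] of_nat_sum[symmetric] msize_def[symmetric]) simp
      then have "(\<Sum>i\<in>UNIV. complex_of_real (real (\<xi> $ i) / real (msize \<xi>))) = 1"
        by (metis of_real_1 of_real_sum)
      then show ?thesis by (simp only: g_def sum_distrib_left[symmetric] sum_distrib_right[symmetric]) simp
    qed (simp add: g_def c)
  qed
  also have "\<dots> = (\<Sum>i\<in>UNIV. \<Sum>\<xi>\<in>msize_ball N. g i \<xi>)" by (rule sum.swap)
  also have "\<dots> = (\<Sum>i\<in>UNIV. \<Sum>\<xi>\<in>msize_ball N. g i (\<xi> + axis i 1))"
    by (intro sum.cong refl sum_msize_ball_shift) (auto simp: g_def c)
  also have "\<dots> = (\<Sum>i\<in>UNIV. hermite_op_raise i N (\<lambda>x \<eta>. \<sigma> x (\<eta> + axis i 1))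
      (\<lambda>\<eta>. c (\<eta> + axis i 1) * complex_of_real (sqrt (real (\<eta> $ i + 1) / 2) / real (msize \<eta> + 1))) x)"
    unfolding hermite_op_raise_def
  proof (intro sum.cong refl)
    fix i and \<eta> :: "nat^'n"
    have "sqrt (a / 2) * sqrt (2 * a) = a" if "0 \<le> a" for a
      using that by (simp add: real_sqrt_mult[symmetric])
    then have s: "sqrt (real (\<eta> $ i + 1) / 2) * sqrt (2 * real (\<eta> $ i + 1)) = real (\<eta> $ i + 1)"
      by (simp only: of_nat_0_le_iff)
    have "complex_of_real (real ((\<eta> + axis i 1) $ i) / real (msize (\<eta> + axis i 1)))
        = complex_of_real (sqrt (real (\<eta> $ i + 1) / 2) / real (msize \<eta> + 1)) * complex_of_real (sqrt (2 * real (\<eta> $ i + 1)))"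
      unfolding msize_add_axis of_real_mult[symmetric] times_divide_eq_left s by (simp add: axis_def)
    then show "g i (\<eta> + axis i 1) = \<sigma> x (\<eta> + axis i 1) *
        (c (\<eta> + axis i 1) * complex_of_real (sqrt (real (\<eta> $ i + 1) / 2) / real (msize \<eta> + 1))) *
        complex_of_real (sqrt (2 * real (\<eta> $ i + 1)) * hermite (\<eta> + axis i 1) x)"
      unfolding g_def by (simp only: of_real_mult mult_ac)
  qed
  finally show ?thesis .
qed

text \<open>
  The creation operator is first commuted past the symbol \<open>\<tau>\<close> and then moved to the other factor
  by integration by parts.
\<close>

lemma inner_raise_lower:
  fixes \<sigma> \<sigma>' \<tau> \<tau>' :: "real^'n \<Rightarrow> nat^'n \<Rightarrow> complex"
  assumes c: "\<And>\<xi>. msize \<xi> > N \<Longrightarrow> c \<xi> = 0"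
    and \<sigma>: "\<And>\<xi>. (\<lambda>x. \<sigma> x \<xi>) \<in> borel_measurable borel" "\<And>\<xi> x. cmod (\<sigma> x \<xi>) \<le> B1 \<xi>"
    and \<sigma>': "\<And>\<xi>. (\<lambda>x. \<sigma>' x \<xi>) \<in> borel_measurable borel" "\<And>\<xi> x. cmod (\<sigma>' x \<xi>) \<le> B2 \<xi>"
    and \<tau>: "\<And>\<xi>. (\<lambda>x. \<tau> x \<xi>) \<in> borel_measurable borel" "\<And>\<xi> x. cmod (\<tau> x \<xi>) \<le> B3 \<xi>"
    and \<tau>': "\<And>\<xi>. (\<lambda>x. \<tau>' x \<xi>) \<in> borel_measurable borel" "\<And>\<xi> x. cmod (\<tau>' x \<xi>) \<le> B4 \<xi>"
    and D: "\<And>x \<xi>. ((\<lambda>t. \<sigma> (x + t *\<^sub>R axis i 1) \<xi>) has_vector_derivative \<sigma>' x \<xi>) (at 0)"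
      "\<And>x \<xi>. ((\<lambda>t. \<tau> (x + t *\<^sub>R axis i 1) \<xi>) has_vector_derivative \<tau>' x \<xi>) (at 0)"
  defines "c' \<equiv> \<lambda>\<eta>. c (\<eta> + axis i 1) * complex_of_real (sqrt (2 * real (\<eta> $ i + 1)))"
  shows "cmod (\<integral>x. cnj (hermite_op N \<sigma> c x) * hermite_op_raise i N \<tau> d x \<partial>lborel)
    \<le> (L2_norm (hermite_op N \<sigma>' c) + L2_norm (hermite_op N (\<lambda>x \<eta>. \<sigma> x (\<eta> + axis i 1)) c')) * L2_norm (hermite_op N \<tau> d)
      + L2_norm (hermite_op N \<sigma> c) * L2_norm (hermite_op N \<tau>' d)"
proof -
  let ?v = "hermite_op N \<sigma> c" and ?v' = "hermite_op_deriv i N \<sigma> \<sigma>' c"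
  let ?u = "hermite_op N \<tau> d" and ?u' = "hermite_op_deriv i N \<tau> \<tau>' d"
  let ?w = "hermite_op N \<tau>' d" and ?v1 = "hermite_op N \<sigma>' c" and ?v2 = "hermite_op N (\<lambda>x \<eta>. \<sigma> x (\<eta> + axis i 1)) c'"
  have dv: "decaying ?v" by (rule decaying_hermite_op[OF \<sigma>])
  have dv': "decaying ?v'" by (rule decaying_hermite_op_deriv[OF \<sigma> \<sigma>'])
  have du: "decaying ?u" by (rule decaying_hermite_op[OF \<tau>])
  have du': "decaying ?u'" by (rule decaying_hermite_op_deriv[OF \<tau> \<tau>'])
  have dw: "decaying ?w" by (rule decaying_hermite_op[OF \<tau>'])
  have dv1: "decaying ?v1" by (rule decaying_hermite_op[OF \<sigma>'])
  have dv2: "decaying ?v2" by (rule decaying_hermite_op[where \<tau>="\<lambda>x \<eta>. \<sigma> x (\<eta> + axis i 1)" and B="\<lambda>\<eta>. B1 (\<eta> + axis i 1)"]) (rule \<sigma>)+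
  have low: "?v1 x + ?v2 x = ?v' x + complex_of_real (x $ i) * ?v x" for x
    unfolding c'_def using hermite_op_lower[where i=i and \<tau>=\<sigma> and \<tau>'=\<sigma>' and x=x, OF c] by (simp only:)
  have "cnj (?v x) * hermite_op_raise i N \<tau> d x
      = - (cnj (?v x) * ?u' x) - cnj (?v' x) * ?u x + cnj (?v1 x) * ?u x + cnj (?v2 x) * ?u x + cnj (?v x) * ?w x" for x
  proof -
    have gen: "cnj v * (- u' + complex_of_real y * u + w) = - (cnj v * u') - cnj v' * u + cnj v1 * u + cnj v2 * u + cnj v * w"
      if "v1 + v2 = v' + complex_of_real y * v" for v v' v1 v2 u u' w y
    proof -
      have "cnj v1 + cnj v2 = cnj v' + complex_of_real y * cnj v"
        using arg_cong[OF that, of cnj] by simp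
      then have "(cnj v1 + cnj v2) * u = (cnj v' + complex_of_real y * cnj v) * u" by (rule arg_cong)
      then show ?thesis by (simp add: algebra_simps)
    qed
    show ?thesis unfolding hermite_op_raise_eq[of i N \<tau> d x \<tau>'] by (rule gen[OF low])
  qed
  then have "(\<integral>x. cnj (?v x) * hermite_op_raise i N \<tau> d x \<partial>lborel)
      = (\<integral>x. - (cnj (?v x) * ?u' x) - cnj (?v' x) * ?u x + cnj (?v1 x) * ?u x + cnj (?v2 x) * ?u x + cnj (?v x) * ?w x \<partial>lborel)"
    by (simp only:)
  also have "\<dots> = - (\<integral>x. cnj (?v x) * ?u' x \<partial>lborel) - (\<integral>x. cnj (?v' x) * ?u x \<partial>lborel) + (\<integral>x. cnj (?v1 x) * ?u x \<partial>lborel)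
      + (\<integral>x. cnj (?v2 x) * ?u x \<partial>lborel) + (\<integral>x. cnj (?v x) * ?w x \<partial>lborel)"
  proof -
    have split: "(\<integral>x. - f1 x - f2 x + f3 x + f4 x + f5 x \<partial>lborel) = - (\<integral>x. f1 x \<partial>lborel) - (\<integral>x. f2 x \<partial>lborel)
        + (\<integral>x. f3 x \<partial>lborel) + (\<integral>x. f4 x \<partial>lborel) + (\<integral>x. f5 x \<partial>lborel)"
      if "integrable lborel f1" "integrable lborel f2" "integrable lborel f3" "integrable lborel f4" "integrable lborel f5"
      for f1 f2 f3 f4 f5 :: "real^'n \<Rightarrow> complex"
      using that by simp
    show ?thesis by (rule split; intro decaying_integrable_mult dv dv' du du' dw dv1 dv2)
  qed
  also have "\<dots> = (\<integral>x. cnj (?v1 x) * ?u x \<partial>lborel) + (\<integral>x. cnj (?v2 x) * ?u x \<partial>lborel) + (\<integral>x. cnj (?v x) * ?w x \<partial>lborel)"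
    using integration_by_parts[OF dv du dv' du' hermite_op_has_derivative[OF D(1)] hermite_op_has_derivative[OF D(2)]] by simp
  finally have eq: "(\<integral>x. cnj (?v x) * hermite_op_raise i N \<tau> d x \<partial>lborel)
      = (\<integral>x. cnj (?v1 x) * ?u x \<partial>lborel) + (\<integral>x. cnj (?v2 x) * ?u x \<partial>lborel) + (\<integral>x. cnj (?v x) * ?w x \<partial>lborel)" .
  have "cmod (a + b + e) \<le> A * U + B * U + V * W"
    if "cmod a \<le> A * U" "cmod b \<le> B * U" "cmod e \<le> V * W" for a b e A B U V W
    using norm_triangle_ineq[of "a + b" e] norm_triangle_ineq[of a b] that by linarith
  from this[OF L2_inner_bound[OF decaying_L2[OF dv1] decaying_L2[OF du]] L2_inner_bound[OF decaying_L2[OF dv2] decaying_L2[OF du]]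
      L2_inner_bound[OF decaying_L2[OF dv] decaying_L2[OF dw]]]
  show ?thesis unfolding eq distrib_right .
qed

section \<open>Near orthogonality of dyadic blocks\<close>

definition l2 :: "nat \<Rightarrow> (nat^'n \<Rightarrow> complex) \<Rightarrow> real" where
  "l2 N c = sqrt (\<Sum>\<xi>\<in>msize_ball N. (cmod (c \<xi>))\<^sup>2)"

text \<open>
  A little wider than a dyadic block, so that the coefficients of a block may be shifted by one
  unit vector.
\<close>

definition at_scale :: "nat \<Rightarrow> (nat^'n \<Rightarrow> complex) \<Rightarrow> bool" where
  "at_scale R c \<longleftrightarrow> (\<forall>\<xi>. c \<xi> \<noteq> 0 \<longrightarrow> real R \<le> 2 * jbracket \<xi> \<and> jbracket \<xi> \<le> 4 * real R)"

lemma l2_nonneg: "0 \<le> l2 N c" and l2_sq: "(l2 N c)\<^sup>2 = (\<Sum>\<xi>\<in>msize_ball N. (cmod (c \<xi>))\<^sup>2)"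
  by (simp_all add: l2_def sum_nonneg)

lemma fdiff_funpow_translate:
  "(fdiff i ^^ l) (\<lambda>\<eta>. f (\<eta> + axis j 1)) = (\<lambda>\<eta>. (fdiff i ^^ l) f (\<eta> + axis j 1))"
  by (induction l) (auto simp: fdiff_def fun_eq_iff add_ac)

lemma l2_shift_le:
  assumes c: "\<And>\<xi>. msize \<xi> > N \<Longrightarrow> c \<xi> = 0"
    and d: "\<And>\<eta>. cmod (d \<eta>) \<le> B * cmod (c (\<eta> + axis i 1))" and B: "B \<ge> 0"
  shows "l2 N d \<le> B * l2 N c"
proof -
  define g where "g \<xi> = (if \<xi> $ i = 0 then 0 else (cmod (c \<xi>))\<^sup>2)" for \<xi>
  have "(l2 N d)\<^sup>2 \<le> (\<Sum>\<eta>\<in>msize_ball N. B\<^sup>2 * (cmod (c (\<eta> + axis i 1)))\<^sup>2)"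
    unfolding l2_sq power_mult_distrib[symmetric] by (intro sum_mono power_mono d) auto
  also have "\<dots> = B\<^sup>2 * (\<Sum>\<eta>\<in>msize_ball N. g (\<eta> + axis i 1))"
    by (simp add: sum_distrib_left g_def axis_def)
  also have "(\<Sum>\<eta>\<in>msize_ball N. g (\<eta> + axis i 1)) = (\<Sum>\<eta>\<in>msize_ball N. g \<eta>)"
    by (rule sum_msize_ball_shift[symmetric]) (auto simp: g_def c)
  also have "B\<^sup>2 * (\<Sum>\<eta>\<in>msize_ball N. g \<eta>) \<le> B\<^sup>2 * (l2 N c)\<^sup>2"
    unfolding l2_sq by (intro mult_left_mono sum_mono) (auto simp: g_def)
  finally have "(l2 N d)\<^sup>2 \<le> (B * l2 N c)\<^sup>2" by (simp add: power_mult_distrib)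
  then show ?thesis by (rule power2_le_imp_le) (simp add: B l2_nonneg)
qed

locale hermite_symbol =
  fixes \<sigma> :: "real^'n \<Rightarrow> nat^'n \<Rightarrow> complex" and \<sigma>' :: "'n \<Rightarrow> real^'n \<Rightarrow> nat^'n \<Rightarrow> complex"
    and \<delta> A :: real and K :: nat
  assumes K: "CARD('n) < 2 * K" and \<delta>: "0 \<le> \<delta>" "\<delta> < 1" and A: "0 \<le> A"
    and cont: "\<And>\<xi>. continuous_on UNIV (\<lambda>x. \<sigma> x \<xi>)" "\<And>i \<xi>. continuous_on UNIV (\<lambda>x. \<sigma>' i x \<xi>)"
    and deriv: "\<And>i x \<xi>. ((\<lambda>t. \<sigma> (x + t *\<^sub>R axis i 1) \<xi>) has_vector_derivative \<sigma>' i x \<xi>) (at 0)"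
    and bound: "\<And>i l x \<xi>. l \<le> K \<Longrightarrow> cmod ((fdiff i ^^ l) (\<sigma> x) \<xi>) \<le> A / jbracket \<xi> ^ l"
    and bound': "\<And>i j l x \<xi>. l \<le> K \<Longrightarrow>
        cmod ((fdiff i ^^ l) (\<sigma>' j x) \<xi>) \<le> A * jbracket \<xi> powr (\<delta> / 2) / jbracket \<xi> ^ l"
begin

lemma measurable_symbol [measurable]:
  "(\<lambda>x. \<sigma> x \<xi>) \<in> borel_measurable borel" "(\<lambda>x. \<sigma>' i x \<xi>) \<in> borel_measurable borel"
  by (intro borel_measurable_continuous_onI cont)+

lemma bounded_symbol: "cmod (\<sigma> x \<xi>) \<le> A" "cmod (\<sigma>' j x \<xi>) \<le> A * jbracket \<xi> powr (\<delta> / 2)"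
  using bound[of 0 undefined x \<xi>] bound'[of 0 undefined j x \<xi>] by simp_all

lemma decaying_op: "decaying (hermite_op N \<sigma> c)"
  by (rule decaying_hermite_op[where B="\<lambda>_. A"]) (rule measurable_symbol bounded_symbol)+

lemma symbol_at_scale_symbol: "symbol_at_scale K R A (\<sigma> x)"
  unfolding symbol_at_scale_def by (intro exI[of _ "\<lambda>_. A"]) (auto intro: bound order_refl)

lemma divide_jbracket_shift_le:
  assumes "0 \<le> a"
  shows "a / jbracket (\<xi> + axis j 1) ^ l \<le> a / jbracket \<xi> ^ l"
proof -
  have "jbracket \<xi> \<le> jbracket (\<xi> + axis j 1)" by (simp add: jbracket_def)
  then show ?thesis using assms by (auto intro!: divide_left_mono power_mono mult_pos_pos simp: less_imp_le)
qed

lemma symbol_at_scale_shift: "symbol_at_scale K R A (\<lambda>\<eta>. \<sigma> x (\<eta> + axis j 1))"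
  unfolding symbol_at_scale_def fdiff_funpow_translate
  by (intro exI[of _ "\<lambda>_. A"] conjI allI impI order_trans[OF bound divide_jbracket_shift_le] A order_refl)

lemma powr_scale_le:
  assumes "R \<ge> 1" "0 < y" "y \<le> real (2 * (10 + K)) * real R"
  shows "A * y powr (\<delta> / 2) \<le> real (2 * (10 + K)) * A * real R powr (\<delta> / 2)"
proof -
  have "y powr (\<delta> / 2) \<le> (real (2 * (10 + K)) * real R) powr (\<delta> / 2)"
    using assms \<delta> by (intro powr_mono2) auto
  also have "\<dots> = real (2 * (10 + K)) powr (\<delta> / 2) * real R powr (\<delta> / 2)"
    by (rule powr_mult)
  also have "\<dots> \<le> real (2 * (10 + K)) powr 1 * real R powr (\<delta> / 2)"
    using \<delta> by (intro mult_right_mono powr_mono) auto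
  finally show ?thesis using A by (simp add: mult_left_mono mult.left_commute mult.assoc)
qed

lemma symbol_at_scale_deriv:
  assumes R: "R \<ge> 1"
  shows "symbol_at_scale K R (real (2 * (10 + K)) * A * real R powr (\<delta> / 2)) (\<sigma>' j x)"
  unfolding symbol_at_scale_def
proof (intro exI[of _ "\<lambda>\<xi>. A * jbracket \<xi> powr (\<delta> / 2)"] conjI allI impI)
  fix \<xi> :: "nat^'n" assume "jbracket \<xi> \<le> real (10 + K) * real R"
  also have "\<dots> \<le> real (2 * (10 + K)) * real R" by (intro mult_right_mono) auto
  finally show "A * jbracket \<xi> powr (\<delta> / 2) \<le> real (2 * (10 + K)) * A * real R powr (\<delta> / 2)"
    by (intro powr_scale_le R) auto
qed (rule bound')

lemma symbol_at_scale_deriv_shift: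
  assumes R: "R \<ge> 1"
  shows "symbol_at_scale K R (real (2 * (10 + K)) * A * real R powr (\<delta> / 2)) (\<lambda>\<eta>. \<sigma>' j x (\<eta> + axis j 1))"
  unfolding symbol_at_scale_def fdiff_funpow_translate
proof (intro exI[of _ "\<lambda>\<xi>. A * jbracket (\<xi> + axis j 1) powr (\<delta> / 2)"] conjI allI impI
    order_trans[OF bound' divide_jbracket_shift_le] mult_nonneg_nonneg A)
  fix \<xi> :: "nat^'n" assume "jbracket \<xi> \<le> real (10 + K) * real R"
  moreover have "jbracket (\<xi> + axis j 1) = jbracket \<xi> + 1" by (simp add: jbracket_def)
  ultimately have "jbracket (\<xi> + axis j 1) \<le> real (2 * (10 + K)) * real R"
  proof -
    assume 1: "jbracket \<xi> \<le> real (10 + K) * real R" "jbracket (\<xi> + axis j 1) = jbracket \<xi> + 1"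
    have "real (2 * (10 + K)) * real R = 2 * (real (10 + K) * real R)" by simp
    then show ?thesis using 1 jbracket_ge_1[of \<xi>] by linarith
  qed
  then show "A * jbracket (\<xi> + axis j 1) powr (\<delta> / 2) \<le> real (2 * (10 + K)) * A * real R powr (\<delta> / 2)"
    by (intro powr_scale_le R) auto
qed auto

text \<open>
  The derivative \<open>\<sigma>'\<close> is a symbol of order \<open>\<delta> / 2\<close>, which at scale \<open>R\<close> costs \<open>R^(\<delta>/2)\<close>. The
  shifted symbols occur because creation and annihilation move the frequencies.
\<close>

lemma block_bounds:
  obtains M where "M \<ge> 0"
    "\<And>R N c. R \<ge> 1 \<Longrightarrow> at_scale R c \<Longrightarrow> L2_norm (hermite_op N \<sigma> c) \<le> M * l2 N c"
    "\<And>R N c j. R \<ge> 1 \<Longrightarrow> at_scale R c \<Longrightarrow> L2_norm (hermite_op N (\<lambda>x \<eta>. \<sigma> x (\<eta> + axis j 1)) c) \<le> M * l2 N c"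
    "\<And>R N c j. R \<ge> 1 \<Longrightarrow> at_scale R c \<Longrightarrow> L2_norm (hermite_op N (\<sigma>' j) c) \<le> M * real R powr (\<delta> / 2) * l2 N c"
    "\<And>R N c j. R \<ge> 1 \<Longrightarrow> at_scale R c \<Longrightarrow>
        L2_norm (hermite_op N (\<lambda>x \<eta>. \<sigma>' j x (\<eta> + axis j 1)) c) \<le> M * real R powr (\<delta> / 2) * l2 N c"
proof -
  obtain C where C: "C \<ge> 0" "\<And>(\<tau>::real^'n \<Rightarrow> nat^'n \<Rightarrow> complex) V R N c. R \<ge> 1 \<Longrightarrow>
     (\<And>\<xi>. (\<lambda>x. \<tau> x \<xi>) \<in> borel_measurable borel) \<Longrightarrow>
     (\<And>x. symbol_at_scale K R V (\<tau> x)) \<Longrightarrow>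
     (\<And>\<xi>. c \<xi> \<noteq> 0 \<Longrightarrow> real R \<le> 2 * jbracket \<xi> \<and> jbracket \<xi> \<le> 4 * real R) \<Longrightarrow>
     sqn (hermite_op N \<tau> c) \<le> ennreal (C * V\<^sup>2 * (\<Sum>\<xi>\<in>msize_ball N. (cmod (c \<xi>))\<^sup>2))"
    by (rule dyadic_bound[OF K]) blast
  define L where "L = real (2 * (10 + K))"
  have L: "1 \<le> L" by (simp add: L_def)
  have norm: "L2_norm (hermite_op N \<tau> c) \<le> sqrt C * V * l2 N c"
    if R: "R \<ge> 1" and m: "\<And>\<xi>. (\<lambda>x. \<tau> x \<xi>) \<in> borel_measurable borel" and b: "\<And>\<xi> x. cmod (\<tau> x \<xi>) \<le> B \<xi>"
      and \<tau>: "\<And>x. symbol_at_scale K R V (\<tau> x)" and c: "at_scale R c" and V: "0 \<le> V"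
    for \<tau> :: "real^'n \<Rightarrow> nat^'n \<Rightarrow> complex" and V R N c B
  proof (rule L2_norm_le)
    show "hermite_op N \<tau> c \<in> L2" by (rule decaying_L2[OF decaying_hermite_op[OF m b]])
    have "sqn (hermite_op N \<tau> c) \<le> ennreal (C * V\<^sup>2 * (\<Sum>\<xi>\<in>msize_ball N. (cmod (c \<xi>))\<^sup>2))"
      by (rule C(2)[OF R m \<tau>]) (use c in \<open>auto simp: at_scale_def\<close>)
    then show "sqn (hermite_op N \<tau> c) \<le> ennreal ((sqrt C * V * l2 N c)\<^sup>2)"
      using C(1) by (simp add: power_mult_distrib l2_sq)
    show "0 \<le> sqrt C * V * l2 N c" using C(1) V by (simp add: l2_nonneg)
  qed
  have small: "sqrt C * A * l2 N c \<le> sqrt C * (L * A) * l2 N c" for N and c :: "nat^'n \<Rightarrow> complex"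
    using C(1) A L by (intro mult_right_mono mult_left_mono l2_nonneg) (auto simp: mult_le_cancel_right1)
  show ?thesis
  proof (rule that[of "sqrt C * (L * A)"])
    show "0 \<le> sqrt C * (L * A)" using C(1) A L by simp
    fix R N and c :: "nat^'n \<Rightarrow> complex" and j assume R: "R \<ge> 1" and c: "at_scale R c"
    have V: "0 \<le> real (2 * (10 + K)) * A * real R powr (\<delta> / 2)" using A by simp
    show "L2_norm (hermite_op N \<sigma> c) \<le> sqrt C * (L * A) * l2 N c"
      by (rule order_trans[OF norm[where \<tau>=\<sigma> and B="\<lambda>_. A", OF R _ _ symbol_at_scale_symbol c A] small])
        (rule measurable_symbol bounded_symbol)+
    show "L2_norm (hermite_op N (\<lambda>x \<eta>. \<sigma> x (\<eta> + axis j 1)) c) \<le> sqrt C * (L * A) * l2 N c"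
      by (rule order_trans[OF norm[where \<tau>="\<lambda>x \<eta>. \<sigma> x (\<eta> + axis j 1)" and B="\<lambda>_. A", OF R _ _ symbol_at_scale_shift c A] small])
        (rule measurable_symbol bounded_symbol)+
    have "L2_norm (hermite_op N (\<sigma>' j) c) \<le> sqrt C * (real (2 * (10 + K)) * A * real R powr (\<delta> / 2)) * l2 N c"
      by (rule norm[where \<tau>="\<sigma>' j" and B="\<lambda>\<xi>. A * jbracket \<xi> powr (\<delta> / 2)", OF R _ _ symbol_at_scale_deriv[OF R] c V])
        (rule measurable_symbol bounded_symbol)+
    then show "L2_norm (hermite_op N (\<sigma>' j) c) \<le> sqrt C * (L * A) * real R powr (\<delta> / 2) * l2 N c"
      by (simp only: L_def mult.assoc)
    have "L2_norm (hermite_op N (\<lambda>x \<eta>. \<sigma>' j x (\<eta> + axis j 1)) c) \<le> sqrt C * (real (2 * (10 + K)) * A * real R powr (\<delta> / 2)) * l2 N c"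
      by (rule norm[where \<tau>="\<lambda>x \<eta>. \<sigma>' j x (\<eta> + axis j 1)" and B="\<lambda>\<xi>. A * jbracket (\<xi> + axis j 1) powr (\<delta> / 2)", OF R _ _ symbol_at_scale_deriv_shift[OF R] c V])
        (rule measurable_symbol bounded_symbol)+
    then show "L2_norm (hermite_op N (\<lambda>x \<eta>. \<sigma>' j x (\<eta> + axis j 1)) c) \<le> sqrt C * (L * A) * real R powr (\<delta> / 2) * l2 N c"
      by (simp only: L_def mult.assoc)
  qed
qed

end

lemma decaying_hermite_op_raise:
  assumes "\<And>\<xi>. (\<lambda>x. \<tau> x \<xi>) \<in> borel_measurable borel" "\<And>\<xi> x. cmod (\<tau> x \<xi>) \<le> B \<xi>"
  shows "decaying (hermite_op_raise i N \<tau> d)"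
proof -
  have "decaying (\<lambda>x. \<tau> x \<eta> * ((d \<eta> * complex_of_real (sqrt (2 * real (\<eta> $ i + 1)))) * complex_of_real (hermite (\<eta> + axis i 1) x)))" for \<eta>
    by (rule decaying_bounded_mult[OF decaying_cmult[OF decaying_hermite] assms])
  then show ?thesis unfolding hermite_op_raise_def[abs_def] of_real_mult mult.assoc by (intro decaying_sum)
qed

definition block :: "nat \<Rightarrow> (nat^'n \<Rightarrow> complex) \<Rightarrow> bool" where
  "block k c \<longleftrightarrow> (\<forall>\<xi>. c \<xi> \<noteq> 0 \<longrightarrow> 4 ^ k \<le> jbracket \<xi> \<and> jbracket \<xi> < 4 ^ Suc k)"

lemma at_scale_block: "block k c \<Longrightarrow> at_scale (4 ^ k) c"
  unfolding block_def at_scale_def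
proof (intro allI impI)
  fix \<xi> assume "\<forall>\<xi>. c \<xi> \<noteq> 0 \<longrightarrow> 4 ^ k \<le> jbracket \<xi> \<and> jbracket \<xi> < 4 ^ Suc k" "c \<xi> \<noteq> 0"
  then have "4 ^ k \<le> jbracket \<xi>" "jbracket \<xi> < 4 ^ Suc k" by blast+
  then show "real (4 ^ k) \<le> 2 * jbracket \<xi> \<and> jbracket \<xi> \<le> 4 * real (4 ^ k)"
    using jbracket_ge_1[of \<xi>] by simp
qed

lemma at_scale_block_shift:
  assumes c: "block k c" and d: "\<And>\<eta>. c (\<eta> + axis i 1) = 0 \<Longrightarrow> d \<eta> = 0"
  shows "at_scale (4 ^ k) d"
  unfolding at_scale_def
proof (intro allI impI)
  fix \<eta> assume "d \<eta> \<noteq> 0"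
  then have "4 ^ k \<le> jbracket (\<eta> + axis i 1)" "jbracket (\<eta> + axis i 1) < 4 ^ Suc k"
    using c d unfolding block_def by blast+
  moreover have "jbracket (\<eta> + axis i 1) = jbracket \<eta> + 1" by (simp add: jbracket_def)
  ultimately show "real (4 ^ k) \<le> 2 * jbracket \<eta> \<and> jbracket \<eta> \<le> 4 * real (4 ^ k)"
    using jbracket_ge_1[of \<eta>] by simp
qed

lemma powr_scale: "real (4 ^ k) powr (\<delta> / 2) = 2 powr (\<delta> * real k)"
proof -
  have "real (4 ^ k) = 2 powr (2 * real k)"
    by (simp add: powr_powr[symmetric] powr_realpow)
  then show ?thesis by (simp add: powr_powr mult.commute)
qed

text \<open>
  This is where one gains \<open>2^(-k)\<close>: the coefficient is at most \<open>|\<xi>|^(-1/2)\<close>.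
\<close>

lemma raise_coeff_le:
  assumes d: "block k d"
  shows "cmod (d (\<eta> + axis i 1) * complex_of_real (sqrt (real (\<eta> $ i + 1) / 2) / real (msize \<eta> + 1)))
    \<le> 2 powr (- real k) * cmod (d (\<eta> + axis i 1))"
proof (cases "d (\<eta> + axis i 1) = 0")
  case False
  define m where "m = real (msize \<eta> + 1)"
  have "4 ^ k \<le> jbracket (\<eta> + axis i 1)" using d False by (auto simp: block_def)
  then have "4 ^ k \<le> 2 * m" by (simp add: jbracket_def m_def)
  moreover have m: "real (\<eta> $ i + 1) \<le> m" "1 \<le> m" using nth_le_msize[of \<eta> i] by (simp_all add: m_def)
  ultimately have "real (\<eta> $ i + 1) / 2 * 4 ^ k \<le> m / 2 * (2 * m)" by (intro mult_mono) auto
  then have "real (\<eta> $ i + 1) / 2 * (2 ^ k)\<^sup>2 \<le> m\<^sup>2"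
    by (simp add: power2_eq_square flip: power_mult_distrib)
  then have "sqrt (real (\<eta> $ i + 1) / 2 * (2 ^ k)\<^sup>2) \<le> sqrt (m\<^sup>2)" by (rule real_sqrt_le_mono)
  moreover have "sqrt (a * (2 ^ k)\<^sup>2) = sqrt a * 2 ^ k" for a :: real by (simp add: real_sqrt_mult)
  moreover have "sqrt (m\<^sup>2) = m" using m by simp
  ultimately have "sqrt (real (\<eta> $ i + 1) / 2) * 2 ^ k \<le> m" by (simp only:)
  then have "sqrt (real (\<eta> $ i + 1) / 2) / m \<le> 2 powr (- real k)"
    using m by (simp add: powr_minus powr_realpow field_simps)
  then have "cmod (d (\<eta> + axis i 1)) * (sqrt (real (\<eta> $ i + 1) / 2) / m) \<le> cmod (d (\<eta> + axis i 1)) * 2 powr (- real k)"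
    by (rule mult_left_mono) simp
  moreover have "cmod (complex_of_real (sqrt (real (\<eta> $ i + 1) / 2) / m)) = sqrt (real (\<eta> $ i + 1) / 2) / m"
    using m by (simp only: norm_of_real) simp
  ultimately show ?thesis
    unfolding m_def[symmetric] norm_mult by (simp only: mult.commute)
qed simp

lemma lower_coeff_le:
  assumes c: "block j c"
  shows "cmod (c (\<eta> + axis i 1) * complex_of_real (sqrt (2 * real (\<eta> $ i + 1))))
    \<le> (4 * 2 powr real j) * cmod (c (\<eta> + axis i 1))"
proof (cases "c (\<eta> + axis i 1) = 0")
  case False
  have "jbracket (\<eta> + axis i 1) < 4 ^ Suc j" using c False by (auto simp: block_def)
  then have "2 * real (\<eta> $ i + 1) \<le> 2 * (4 * 4 ^ j)" using nth_le_msize[of \<eta> i] by (simp add: jbracket_def)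
  also have "\<dots> \<le> 16 * 4 ^ j" by simp
  also have "\<dots> = (4 * 2 ^ j)\<^sup>2" by (simp add: power2_eq_square flip: power_mult_distrib)
  finally have "sqrt (2 * real (\<eta> $ i + 1)) \<le> 4 * 2 ^ j" by (rule real_le_lsqrt[rotated -1]) auto
  then have "cmod (c (\<eta> + axis i 1)) * sqrt (2 * real (\<eta> $ i + 1)) \<le> cmod (c (\<eta> + axis i 1)) * (4 * 2 powr real j)"
    by (intro mult_left_mono) (auto simp: powr_realpow)
  moreover have "cmod (complex_of_real (sqrt (2 * real (\<eta> $ i + 1)))) = sqrt (2 * real (\<eta> $ i + 1))"
    by (simp only: norm_of_real) simp
  ultimately show ?thesis unfolding norm_mult by (simp only: mult.commute)
qed simp

context hermite_symbol
begin

text \<open>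
  The ratio of the geometric decay of inner products with the distance of the blocks.
\<close>

definition rate :: real where "rate = 2 powr (\<delta> - 1)"

lemma rate: "0 < rate" "rate < 1"
  using \<delta> powr_less_mono[of "\<delta> - 1" 0 2] by (simp_all add: rate_def)

text \<open>
  For \<open>j < k\<close> the boundary case \<open>\<xi> = 0\<close>, where one cannot divide by \<open>|\<xi>|\<close>, does not meet block
  \<open>k\<close>. Both gains, \<open>2^(j-k)\<close> and \<open>2^((\<delta>-1)k)\<close>, are at most \<open>2^((\<delta>-1)(k-j))\<close>.
\<close>

lemma inner_block_le:
  obtains B where "B \<ge> 0" "\<And>N c d j k. j \<le> k \<Longrightarrow> block j c \<Longrightarrow> block k d \<Longrightarrow>
      (\<And>\<xi>. msize \<xi> > N \<Longrightarrow> c \<xi> = 0) \<Longrightarrow> (\<And>\<xi>. msize \<xi> > N \<Longrightarrow> d \<xi> = 0) \<Longrightarrow>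
      cmod (\<integral>x. cnj (hermite_op N \<sigma> c x) * hermite_op N \<sigma> d x \<partial>lborel) \<le> B * rate ^ (k - j) * l2 N c * l2 N d"
proof (rule block_bounds)
  fix M assume M: "M \<ge> 0"
    and M1: "\<And>R N c. R \<ge> 1 \<Longrightarrow> at_scale R c \<Longrightarrow> L2_norm (hermite_op N \<sigma> c) \<le> M * l2 N c"
    and M2: "\<And>R N c j. R \<ge> 1 \<Longrightarrow> at_scale R c \<Longrightarrow> L2_norm (hermite_op N (\<lambda>x \<eta>. \<sigma> x (\<eta> + axis j 1)) c) \<le> M * l2 N c"
    and M3: "\<And>R N c j. R \<ge> 1 \<Longrightarrow> at_scale R c \<Longrightarrow> L2_norm (hermite_op N (\<sigma>' j) c) \<le> M * real R powr (\<delta> / 2) * l2 N c"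
    and M4: "\<And>R N c j. R \<ge> 1 \<Longrightarrow> at_scale R c \<Longrightarrow>
        L2_norm (hermite_op N (\<lambda>x \<eta>. \<sigma>' j x (\<eta> + axis j 1)) c) \<le> M * real R powr (\<delta> / 2) * l2 N c"
  let ?n = "real CARD('n)"
  show ?thesis
  proof (rule that[of "6 * ?n * M\<^sup>2"])
    show "0 \<le> 6 * ?n * M\<^sup>2" by simp
    fix N j k and c d :: "nat^'n \<Rightarrow> complex"
    assume jk: "j \<le> k" and c: "block j c" and d: "block k d"
      and cN: "\<And>\<xi>. msize \<xi> > N \<Longrightarrow> c \<xi> = 0" and dN: "\<And>\<xi>. msize \<xi> > N \<Longrightarrow> d \<xi> = 0"
    let ?I = "\<integral>x. cnj (hermite_op N \<sigma> c x) * hermite_op N \<sigma> d x \<partial>lborel"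
    have R: "1 \<le> (4::nat) ^ j" "1 \<le> (4::nat) ^ k" by simp_all
    have X4: "L2_norm (hermite_op N \<sigma> c) \<le> M * l2 N c" by (rule M1[OF R(1) at_scale_block[OF c]])
    have n1: "1 \<le> ?n" by (simp add: Suc_le_eq)
    show "cmod ?I \<le> 6 * ?n * M\<^sup>2 * rate ^ (k - j) * l2 N c * l2 N d"
    proof (cases "j = k")
      case True
      have "cmod ?I \<le> L2_norm (hermite_op N \<sigma> c) * L2_norm (hermite_op N \<sigma> d)"
        by (intro L2_inner_bound decaying_L2 decaying_op)
      also have "\<dots> \<le> (M * l2 N c) * (M * l2 N d)"
        by (intro mult_mono X4 M1[OF R(2) at_scale_block[OF d]] mult_nonneg_nonneg M l2_nonneg L2_norm_nonneg)
      also have "\<dots> = 1 * (M\<^sup>2 * l2 N c * l2 N d)" by (simp add: power2_eq_square)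
      also have "\<dots> \<le> (6 * ?n) * (M\<^sup>2 * l2 N c * l2 N d)"
        using n1 by (intro mult_right_mono mult_nonneg_nonneg zero_le_power2 l2_nonneg) linarith
      finally show ?thesis using True by (simp add: mult_ac)
    next
      case False
      then have jk': "j < k" using jk by simp
      define \<tau> where "\<tau> i = (\<lambda>x \<eta>. \<sigma> x (\<eta> + axis i 1))" for i :: 'n
      define \<tau>' where "\<tau>' i = (\<lambda>x \<eta>. \<sigma>' i x (\<eta> + axis i 1))" for i :: 'n
      define di where "di i = (\<lambda>\<eta>. d (\<eta> + axis i 1) * complex_of_real (sqrt (real (\<eta> $ i + 1) / 2) / real (msize \<eta> + 1)))" for i
      define ci where "ci i = (\<lambda>\<eta>. c (\<eta> + axis i 1) * complex_of_real (sqrt (2 * real (\<eta> $ i + 1))))" for i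
      have d0: "d \<xi> = 0" if "msize \<xi> = 0" for \<xi>
      proof (rule ccontr)
        assume "d \<xi> \<noteq> 0"
        then have "4 ^ k \<le> jbracket \<xi>" using d by (auto simp: block_def)
        moreover have "(4::real) ^ 1 \<le> 4 ^ k" using jk' by (intro power_increasing) auto
        ultimately show False using that by (simp add: jbracket_def)
      qed
      have dec: "decaying (hermite_op_raise i N (\<tau> i) (di i))" for i
        unfolding \<tau>_def by (rule decaying_hermite_op_raise[where B="\<lambda>_. A"]) (rule measurable_symbol bounded_symbol)+
      have "?I = (\<integral>x. (\<Sum>i\<in>UNIV. cnj (hermite_op N \<sigma> c x) * hermite_op_raise i N (\<tau> i) (di i) x) \<partial>lborel)"
      proof -
        have "hermite_op N \<sigma> d x = (\<Sum>i\<in>UNIV. hermite_op_raise i N (\<tau> i) (di i) x)" for x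
          unfolding \<tau>_def di_def by (rule hermite_op_eq_sum_raise[OF dN d0])
        then show ?thesis by (simp only: sum_distrib_left)
      qed
      also have "\<dots> = (\<Sum>i\<in>UNIV. \<integral>x. cnj (hermite_op N \<sigma> c x) * hermite_op_raise i N (\<tau> i) (di i) x \<partial>lborel)"
        by (intro Bochner_Integration.integral_sum decaying_integrable_mult decaying_op dec)
      also have "cmod \<dots> \<le> (\<Sum>i\<in>(UNIV::'n set). 6 * M\<^sup>2 * rate ^ (k - j) * l2 N c * l2 N d)"
      proof (rule sum_norm_le)
        fix i :: 'n
        have di: "at_scale (4 ^ k) (di i)" by (rule at_scale_block_shift[OF d, of i]) (simp add: di_def)
        have ci: "at_scale (4 ^ j) (ci i)" by (rule at_scale_block_shift[OF c, of i]) (simp add: ci_def)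
        have ldi: "l2 N (di i) \<le> 2 powr (- real k) * l2 N d"
          by (rule l2_shift_le[OF dN, where i=i]) (simp_all only: di_def raise_coeff_le[OF d] powr_ge_zero)
        have lci: "l2 N (ci i) \<le> (4 * 2 powr real j) * l2 N c"
          by (rule l2_shift_le[OF cN, where i=i]) (simp_all only: ci_def lower_coeff_le[OF c], simp)
        have X1: "L2_norm (hermite_op N (\<sigma>' i) c) \<le> M * 2 powr real j * l2 N c"
        proof -
          have "L2_norm (hermite_op N (\<sigma>' i) c) \<le> M * 2 powr (\<delta> * real j) * l2 N c"
            using M3[OF R(1) at_scale_block[OF c], of N i] by (simp only: powr_scale)
          also have "\<dots> \<le> M * 2 powr real j * l2 N c"
            using \<delta> M by (intro mult_right_mono mult_left_mono powr_mono l2_nonneg) (auto simp: mult_left_le_one_le)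
          finally show ?thesis .
        qed
        have X2: "L2_norm (hermite_op N (\<tau> i) (ci i)) \<le> M * ((4 * 2 powr real j) * l2 N c)"
          unfolding \<tau>_def by (rule order_trans[OF M2[OF R(1) ci] mult_left_mono[OF lci M]])
        have X3: "L2_norm (hermite_op N (\<tau> i) (di i)) \<le> M * (2 powr (- real k) * l2 N d)"
          unfolding \<tau>_def by (rule order_trans[OF M2[OF R(2) di] mult_left_mono[OF ldi M]])
        have X5: "L2_norm (hermite_op N (\<tau>' i) (di i)) \<le> M * 2 powr (\<delta> * real k) * (2 powr (- real k) * l2 N d)"
        proof -
          have "L2_norm (hermite_op N (\<tau>' i) (di i)) \<le> M * 2 powr (\<delta> * real k) * l2 N (di i)"
            unfolding \<tau>'_def using M4[OF R(2) di, of N i] by (simp only: powr_scale)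
          also have "\<dots> \<le> M * 2 powr (\<delta> * real k) * (2 powr (- real k) * l2 N d)"
            using M by (intro mult_left_mono ldi) auto
          finally show ?thesis .
        qed
        have "cmod (\<integral>x. cnj (hermite_op N \<sigma> c x) * hermite_op_raise i N (\<tau> i) (di i) x \<partial>lborel)
          \<le> (L2_norm (hermite_op N (\<sigma>' i) c) + L2_norm (hermite_op N (\<lambda>x \<eta>. \<sigma> x (\<eta> + axis i 1)) (ci i))) * L2_norm (hermite_op N (\<tau> i) (di i))
            + L2_norm (hermite_op N \<sigma> c) * L2_norm (hermite_op N (\<tau>' i) (di i))"
          unfolding ci_def
        proof (rule inner_raise_lower[where \<sigma>=\<sigma> and \<sigma>'="\<sigma>' i" and \<tau>="\<tau> i" and \<tau>'="\<tau>' i"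
              and ?B1.0="\<lambda>_. A" and ?B2.0="\<lambda>\<xi>. A * jbracket \<xi> powr (\<delta> / 2)"
              and ?B3.0="\<lambda>_. A" and ?B4.0="\<lambda>\<xi>. A * jbracket (\<xi> + axis i 1) powr (\<delta> / 2)"])
          show "((\<lambda>t. \<tau> i (x + t *\<^sub>R axis i 1) \<xi>) has_vector_derivative \<tau>' i x \<xi>) (at 0)" for x \<xi>
            unfolding \<tau>_def \<tau>'_def by (rule deriv)
        qed (simp_all only: \<tau>_def \<tau>'_def measurable_symbol bounded_symbol deriv cN)
        also have "\<dots> \<le> (M * 2 powr real j * l2 N c + M * ((4 * 2 powr real j) * l2 N c)) * (M * (2 powr (- real k) * l2 N d))
            + (M * l2 N c) * (M * 2 powr (\<delta> * real k) * (2 powr (- real k) * l2 N d))"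
          unfolding \<tau>_def[symmetric]
          by (intro add_mono mult_mono X1 X2 X3 X4 X5 add_nonneg_nonneg mult_nonneg_nonneg M l2_nonneg L2_norm_nonneg) auto
        also have "\<dots> = M\<^sup>2 * l2 N c * l2 N d * (5 * (2 powr real j * 2 powr (- real k)) + 2 powr (\<delta> * real k) * 2 powr (- real k))"
          by (simp add: algebra_simps power2_eq_square)
        also have "\<dots> = M\<^sup>2 * l2 N c * l2 N d * (5 * 2 powr (real j - real k) + 2 powr ((\<delta> - 1) * real k))"
          by (simp add: powr_add[symmetric] algebra_simps)
        also have "\<dots> \<le> M\<^sup>2 * l2 N c * l2 N d * (5 * 2 powr ((\<delta> - 1) * (real k - real j)) + 2 powr ((\<delta> - 1) * (real k - real j)))"
        proof -
          have "0 \<le> \<delta> * (real k - real j)" using \<delta> jk by simp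
          then have 1: "2 powr (real j - real k) \<le> 2 powr ((\<delta> - 1) * (real k - real j))"
            by (intro powr_mono) (simp_all add: algebra_simps)
          have "(\<delta> - 1) * real j \<le> 0" using \<delta> by (simp add: mult_le_0_iff)
          then have 2: "2 powr ((\<delta> - 1) * real k) \<le> 2 powr ((\<delta> - 1) * (real k - real j))"
            by (intro powr_mono) (simp_all add: algebra_simps)
          show ?thesis using 1 2
            by (intro mult_left_mono add_mono mult_nonneg_nonneg l2_nonneg zero_le_power2) auto
        qed
        also have "2 powr ((\<delta> - 1) * (real k - real j)) = rate ^ (k - j)"
          using rate jk by (simp add: rate_def powr_powr[symmetric] powr_realpow of_nat_diff flip: of_nat_diff)
        finally show "cmod (\<integral>x. cnj (hermite_op N \<sigma> c x) * hermite_op_raise i N (\<tau> i) (di i) x \<partial>lborel)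
            \<le> 6 * M\<^sup>2 * rate ^ (k - j) * l2 N c * l2 N d" by (simp add: algebra_simps)
      qed
      also have "\<dots> = 6 * ?n * M\<^sup>2 * rate ^ (k - j) * l2 N c * l2 N d" by simp
      finally show ?thesis .
    qed
  qed
qed

end

section \<open>Summation over the blocks\<close>

lemma sum_power_inj_le:
  fixes \<rho> :: real
  assumes "0 < \<rho>" "\<rho> < 1" "finite F" "inj_on f F"
  shows "(\<Sum>k\<in>F. \<rho> ^ f k) \<le> 1 / (1 - \<rho>)"
proof -
  have "(\<Sum>k\<in>F. \<rho> ^ f k) = (\<Sum>m\<in>f ` F. \<rho> ^ m)" using assms by (simp add: sum.reindex)
  also have "\<dots> \<le> (\<Sum>m. \<rho> ^ m)" using assms by (intro sum_le_suminf summable_geometric) auto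
  also have "\<dots> = 1 / (1 - \<rho>)" using assms by (intro suminf_geometric) auto
  finally show ?thesis .
qed

text \<open>
  The exponent \<open>(j - k) + (k - j)\<close> with truncated subtraction is the distance of \<open>j\<close> and \<open>k\<close>.
\<close>

lemma schur_geometric:
  fixes \<rho> :: real and a :: "nat \<Rightarrow> real"
  assumes \<rho>: "0 < \<rho>" "\<rho> < 1"
  shows "(\<Sum>j\<le>N. \<Sum>k\<le>N. \<rho> ^ ((j - k) + (k - j)) * (a j * a k)) \<le> 2 / (1 - \<rho>) * (\<Sum>j\<le>N. (a j)\<^sup>2)"
proof -
  have row: "(\<Sum>k\<le>N. \<rho> ^ ((j - k) + (k - j))) \<le> 2 / (1 - \<rho>)" for j
  proof -
    have "(\<Sum>k\<le>N. \<rho> ^ ((j - k) + (k - j))) \<le> (\<Sum>k\<in>{..j} \<union> {j..N}. \<rho> ^ ((j - k) + (k - j)))"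
      using \<rho> by (intro sum_mono2) auto
    also have "\<dots> \<le> (\<Sum>k\<le>j. \<rho> ^ ((j - k) + (k - j))) + (\<Sum>k\<in>{j..N}. \<rho> ^ ((j - k) + (k - j)))"
      using \<rho> by (subst sum_Un) (auto intro!: sum_nonneg)
    also have "\<dots> \<le> 1 / (1 - \<rho>) + 1 / (1 - \<rho>)"
      by (intro add_mono sum_power_inj_le \<rho>) (auto intro!: inj_onI)
    finally show ?thesis by simp
  qed
  let ?w = "\<lambda>j k. \<rho> ^ ((j - k) + (k - j))"
  have "(\<Sum>j\<le>N. \<Sum>k\<le>N. ?w j k * (a j * a k)) \<le> (\<Sum>j\<le>N. \<Sum>k\<le>N. ?w j k * (((a j)\<^sup>2 + (a k)\<^sup>2) / 2))"
  proof (intro sum_mono mult_left_mono)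
    show "a j * a k \<le> ((a j)\<^sup>2 + (a k)\<^sup>2) / 2" for j k using sum_squares_bound[of "a j" "a k"] by simp
  qed (use \<rho> in auto)
  also have "\<dots> = (\<Sum>j\<le>N. \<Sum>k\<le>N. ?w j k * (a j)\<^sup>2) / 2 + (\<Sum>j\<le>N. \<Sum>k\<le>N. ?w j k * (a k)\<^sup>2) / 2"
    by (simp add: sum.distrib[symmetric] sum_divide_distrib add_divide_distrib distrib_left)
  also have "(\<Sum>j\<le>N. \<Sum>k\<le>N. ?w j k * (a k)\<^sup>2) = (\<Sum>j\<le>N. \<Sum>k\<le>N. ?w j k * (a j)\<^sup>2)"
    by (subst sum.swap) (simp add: add.commute)
  also have "(\<Sum>j\<le>N. \<Sum>k\<le>N. ?w j k * (a j)\<^sup>2) / 2 + (\<Sum>j\<le>N. \<Sum>k\<le>N. ?w j k * (a j)\<^sup>2) / 2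
      = (\<Sum>j\<le>N. (\<Sum>k\<le>N. ?w j k) * (a j)\<^sup>2)"
    by (simp add: sum_distrib_right)
  also have "\<dots> \<le> (\<Sum>j\<le>N. 2 / (1 - \<rho>) * (a j)\<^sup>2)" by (intro sum_mono mult_right_mono row) auto
  finally show ?thesis by (simp add: sum_distrib_left)
qed

definition block_part :: "nat \<Rightarrow> nat \<Rightarrow> (nat^'n \<Rightarrow> complex) \<Rightarrow> nat^'n \<Rightarrow> complex" where
  "block_part N k c \<xi> = (if msize \<xi> \<le> N \<and> 4 ^ k \<le> jbracket \<xi> \<and> jbracket \<xi> < 4 ^ Suc k then c \<xi> else 0)"

lemma block_block_part: "block k (block_part N k c)"
  by (auto simp: block_def block_part_def)

lemma dyadic_index:
  assumes "msize \<xi> \<le> N"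
  obtains k where "k \<le> N" "\<And>j. (4 ^ j \<le> jbracket \<xi> \<and> jbracket \<xi> < 4 ^ Suc j) \<longleftrightarrow> j = k"
proof -
  have ex: "jbracket \<xi> < 4 ^ Suc N"
  proof -
    have "N + 1 < 4 ^ Suc N" by (induction N) auto
    then have "real (N + 1) < real (4 ^ Suc N)" by (simp only: of_nat_less_iff)
    then show ?thesis using assms by (simp add: jbracket_def)
  qed
  define k where "k = (LEAST k. jbracket \<xi> < 4 ^ Suc k)"
  have k: "jbracket \<xi> < 4 ^ Suc k" unfolding k_def by (rule LeastI[of "\<lambda>k. jbracket \<xi> < 4 ^ Suc k", OF ex])
  have kN: "k \<le> N" unfolding k_def by (rule Least_le[of "\<lambda>k. jbracket \<xi> < 4 ^ Suc k", OF ex])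
  have low: "4 ^ k \<le> jbracket \<xi>"
  proof (cases k)
    case 0
    then show ?thesis using jbracket_ge_1 by simp
  next
    case (Suc m)
    then have "\<not> jbracket \<xi> < 4 ^ Suc m" unfolding k_def by (metis lessI not_less_Least)
    then show ?thesis using Suc by simp
  qed
  show ?thesis
  proof (rule that[OF kN])
    fix j
    show "(4 ^ j \<le> jbracket \<xi> \<and> jbracket \<xi> < 4 ^ Suc j) \<longleftrightarrow> j = k"
    proof
      assume j: "4 ^ j \<le> jbracket \<xi> \<and> jbracket \<xi> < 4 ^ Suc j"
      have "(4::real) ^ j < 4 ^ Suc k" "(4::real) ^ k < 4 ^ Suc j" using j k low by linarith+
      then have "j < Suc k" "k < Suc j" by (simp_all only: power_strict_increasing_iff[of "4::real"] one_less_numeral_iff semiring_norm)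
      then show "j = k" by simp
    qed (use k low in auto)
  qed
qed

lemma sum_block_part:
  fixes f :: "complex \<Rightarrow> 'b::comm_monoid_add"
  assumes "\<xi> \<in> msize_ball N" "f 0 = 0"
  shows "(\<Sum>k\<le>N. f (block_part N k c \<xi>)) = f (c \<xi>)"
proof -
  have N: "msize \<xi> \<le> N" using assms by (simp add: msize_ball_def)
  then obtain k where k: "k \<le> N" "\<And>j. (4 ^ j \<le> jbracket \<xi> \<and> jbracket \<xi> < 4 ^ Suc j) \<longleftrightarrow> j = k"
    by (rule dyadic_index) blast
  have "(\<Sum>j\<le>N. f (block_part N j c \<xi>)) = (\<Sum>j\<le>N. if j = k then f (c \<xi>) else 0)"
    unfolding block_part_def using N k(2) assms(2) by (intro sum.cong refl) auto
  then show ?thesis using k(1) by simp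
qed

lemma L2_norm_sq_eq:
  assumes "decaying f"
  shows "(L2_norm f)\<^sup>2 = cmod (\<integral>x. cnj (f x) * f x \<partial>lborel)"
proof -
  have "(\<integral>x. cnj (f x) * f x \<partial>lborel) = (\<integral>x. complex_of_real ((cmod (f x))\<^sup>2) \<partial>lborel)"
    by (simp only: complex_norm_square mult.commute)
  also have "\<dots> = complex_of_real (\<integral>x. (cmod (f x))\<^sup>2 \<partial>lborel)" by (rule integral_complex_of_real)
  also have "cmod \<dots> = (\<integral>x. (cmod (f x))\<^sup>2 \<partial>lborel)" by (simp only: norm_of_real) simp
  finally show ?thesis by (simp add: L2_norm_def)
qed

text \<open>
  The squared norm of the sum of all pieces is the double sum of their inner products.
\<close>

lemma (in hermite_symbol) op_bound:
  obtains B where "B \<ge> 0" "\<And>N c. L2_norm (hermite_op N \<sigma> c) \<le> B * l2 N c"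
proof (rule inner_block_le)
  fix B assume B: "B \<ge> 0" "\<And>N c d j k. j \<le> k \<Longrightarrow> block j c \<Longrightarrow> block k d \<Longrightarrow>
      (\<And>\<xi>. msize \<xi> > N \<Longrightarrow> c \<xi> = 0) \<Longrightarrow> (\<And>\<xi>. msize \<xi> > N \<Longrightarrow> d \<xi> = 0) \<Longrightarrow>
      cmod (\<integral>x. cnj (hermite_op N \<sigma> c x) * hermite_op N \<sigma> d x \<partial>lborel) \<le> B * rate ^ (k - j) * l2 N c * l2 N d"
  have "L2_norm (hermite_op N \<sigma> c) \<le> sqrt (B * (2 / (1 - rate))) * l2 N c" for N c
  proof -
    \<comment> \<open>As \<open>4^(N+1) > N + 1\<close>, the blocks \<open>k \<le> N\<close> exhaust the ball of radius \<open>N\<close>.\<close>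
    define u where "u k = hermite_op N \<sigma> (block_part N k c)" for k
    define a where "a k = l2 N (block_part N k c)" for k
    let ?ip = "\<lambda>j k. \<integral>x. cnj (u j x) * u k x \<partial>lborel"
    have sum_u: "hermite_op N \<sigma> c x = (\<Sum>k\<le>N. u k x)" for x
    proof -
      have "(\<Sum>k\<le>N. u k x) = (\<Sum>\<xi>\<in>msize_ball N. \<Sum>k\<le>N. \<sigma> x \<xi> * block_part N k c \<xi> * complex_of_real (hermite \<xi> x))"
        unfolding u_def hermite_op_def by (rule sum.swap)
      also have "\<dots> = hermite_op N \<sigma> c x"
        unfolding hermite_op_def
        by (intro sum.cong refl sum_block_part[where f="\<lambda>z. \<sigma> x _ * z * complex_of_real (hermite _ x)"]) auto
      finally show ?thesis by simp
    qed
    have sum_a: "(\<Sum>k\<le>N. (a k)\<^sup>2) = (l2 N c)\<^sup>2"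
    proof -
      have "(\<Sum>k\<le>N. (a k)\<^sup>2) = (\<Sum>\<xi>\<in>msize_ball N. \<Sum>k\<le>N. (cmod (block_part N k c \<xi>))\<^sup>2)"
        unfolding a_def l2_sq by (rule sum.swap)
      also have "\<dots> = (l2 N c)\<^sup>2"
        unfolding l2_sq by (intro sum.cong refl sum_block_part[where f="\<lambda>z. (cmod z)\<^sup>2"]) auto
      finally show ?thesis .
    qed
    have dec: "decaying (u k)" for k unfolding u_def by (rule decaying_op)
    have le: "cmod (?ip j k) \<le> B * rate ^ (k - j) * a j * a k" if "j \<le> k" for j k
      unfolding u_def a_def by (rule B(2)[OF that block_block_part block_block_part]) (auto simp: block_part_def)
    have sym: "cmod (?ip j k) = cmod (?ip k j)" for j k
    proof -
      have "cnj (?ip k j) = (\<integral>x. cnj (cnj (u k x) * u j x) \<partial>lborel)"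
        by (rule Bochner_Integration.integral_cnj[symmetric])
      also have "\<dots> = ?ip j k" by (simp add: mult.commute)
      finally show ?thesis by (metis complex_mod_cnj)
    qed
    have ip: "cmod (?ip j k) \<le> B * (rate ^ ((j - k) + (k - j)) * (a j * a k))" for j k
      using le[of j k] le[of k j] sym[of j k] by (cases "j \<le> k") (auto simp: mult_ac)
    have "(L2_norm (hermite_op N \<sigma> c))\<^sup>2 = cmod (\<integral>x. cnj (hermite_op N \<sigma> c x) * hermite_op N \<sigma> c x \<partial>lborel)"
      by (rule L2_norm_sq_eq[OF decaying_op])
    also have "(\<integral>x. cnj (hermite_op N \<sigma> c x) * hermite_op N \<sigma> c x \<partial>lborel)
        = (\<integral>x. (\<Sum>j\<le>N. \<Sum>k\<le>N. cnj (u j x) * u k x) \<partial>lborel)"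
      unfolding sum_u cnj_sum sum_product ..
    also have "\<dots> = (\<Sum>j\<le>N. \<Sum>k\<le>N. ?ip j k)"
    proof -
      have i: "integrable lborel (\<lambda>x. cnj (u j x) * u k x)" for j k by (intro decaying_integrable_mult dec)
      have "(\<integral>x. (\<Sum>j\<le>N. \<Sum>k\<le>N. cnj (u j x) * u k x) \<partial>lborel) = (\<Sum>j\<le>N. \<integral>x. (\<Sum>k\<le>N. cnj (u j x) * u k x) \<partial>lborel)"
        by (intro Bochner_Integration.integral_sum Bochner_Integration.integrable_sum i)
      also have "\<dots> = (\<Sum>j\<le>N. \<Sum>k\<le>N. ?ip j k)"
        by (intro sum.cong refl Bochner_Integration.integral_sum i)
      finally show ?thesis .
    qed
    also have "cmod (\<Sum>j\<le>N. \<Sum>k\<le>N. ?ip j k) \<le> (\<Sum>j\<le>N. \<Sum>k\<le>N. B * (rate ^ ((j - k) + (k - j)) * (a j * a k)))"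
      by (intro sum_norm_le ip)
    also have "\<dots> = B * (\<Sum>j\<le>N. \<Sum>k\<le>N. rate ^ ((j - k) + (k - j)) * (a j * a k))"
      by (simp only: sum_distrib_left)
    also have "\<dots> \<le> B * (2 / (1 - rate) * (l2 N c)\<^sup>2)"
      unfolding sum_a[symmetric] by (intro mult_left_mono schur_geometric rate B)
    also have "\<dots> = (sqrt (B * (2 / (1 - rate))) * l2 N c)\<^sup>2"
      using B(1) rate by (simp add: power_mult_distrib)
    finally show ?thesis
      by (rule power2_le_imp_le) (use B(1) rate in \<open>auto simp: l2_nonneg\<close>)
  qed
  then show ?thesis using that[of "sqrt (B * (2 / (1 - rate)))"] B(1) rate by simp
qed

section \<open>Limits in the space of square-integrable functions\<close>

lemma L2_measurable: "f \<in> L2 \<Longrightarrow> f \<in> borel_measurable borel"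
  by (simp add: L2_def)

lemma L2_iff: "f \<in> L2 \<longleftrightarrow> f \<in> borel_measurable borel \<and> sqn f < \<infinity>"
  by (auto simp: L2_def integrable_iff_bounded sqn_def)

lemma L2_add:
  assumes "f \<in> L2" "g \<in> L2"
  shows "(\<lambda>x. f x + g x) \<in> L2"
proof -
  have "sqn (\<lambda>x. f x + g x) \<le> 2 * sqn f + 2 * sqn g"
    by (rule sqn_add_le) (use assms in \<open>auto simp: L2_measurable\<close>)
  also have "\<dots> < \<infinity>" using assms by (simp add: L2_iff ennreal_mult_less_top)
  finally show ?thesis
    using borel_measurable_add[OF L2_measurable[OF assms(1)] L2_measurable[OF assms(2)]] by (simp add: L2_iff)
qed

lemma L2_cmult: "f \<in> L2 \<Longrightarrow> (\<lambda>x. c * f x) \<in> L2"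
  using borel_measurable_times[OF borel_measurable_const[of c] L2_measurable, of f]
  by (simp add: L2_iff sqn_cmult ennreal_mult_less_top)

lemma sqn_eq_0_imp_AE:
  assumes [measurable]: "f \<in> borel_measurable borel" and "sqn f = 0"
  shows "AE x in lborel. f x = 0"
  using assms(2) unfolding sqn_def by (subst (asm) nn_integral_0_iff_AE) auto

text \<open>
  Convergence in \<open>L^2\<close>, witnessed by a real null sequence so that errors can be added and
  compared without infinite values.
\<close>

definition L2_limit :: "(nat \<Rightarrow> real^'n \<Rightarrow> complex) \<Rightarrow> (real^'n \<Rightarrow> complex) \<Rightarrow> bool" where
  "L2_limit F g \<longleftrightarrow> g \<in> L2 \<and> (\<exists>e::nat \<Rightarrow> real. e \<longlonglongrightarrow> 0 \<and> (\<forall>n. 0 \<le> e n \<and> sqn (\<lambda>x. F n x - g x) \<le> ennreal (e n)))"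

lemma le_ennreal_null_sequence:
  fixes e :: "nat \<Rightarrow> real"
  assumes e: "e \<longlonglongrightarrow> 0" and le: "\<And>n. n \<ge> N \<Longrightarrow> s \<le> ennreal (b + e n)" and b: "b \<ge> 0"
  shows "s \<le> ennreal b"
proof -
  have "(\<lambda>n. ennreal (b + e n)) \<longlonglongrightarrow> ennreal (b + 0)"
    by (intro tendsto_ennrealI tendsto_intros e)
  then show ?thesis
    by (intro tendsto_lowerbound[of "\<lambda>n. ennreal (b + e n)"]) (auto simp: eventually_sequentially intro!: exI[of _ N] le)
qed

text \<open>
  Along a subsequence with \<open>\<parallel>u\<^sub>m\<parallel>^2 \<le> 4^(-m)\<close> for the increments \<open>u\<^sub>m\<close>, the series of
  \<open>2^m |u\<^sub>m(x)|^2\<close> is finite almost everywhere, which forces absolute convergence of the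
  increments. Fatou's lemma identifies the pointwise limit as the limit in \<open>L^2\<close>.
\<close>

lemma riesz_fischer:
  fixes F :: "nat \<Rightarrow> real^'n \<Rightarrow> complex" and t :: "nat \<Rightarrow> real"
  assumes F: "\<And>n. F n \<in> L2"
    and cauchy: "\<And>m n. m \<le> n \<Longrightarrow> sqn (\<lambda>x. F n x - F m x) \<le> ennreal (t m)"
    and t: "t \<longlonglongrightarrow> 0" "\<And>n. 0 \<le> t n"
  shows "\<exists>g. L2_limit F g"
proof -
  have [measurable]: "F n \<in> borel_measurable borel" for n using F by (rule L2_measurable)
  have "\<exists>N. \<forall>n\<ge>N. t n \<le> (1 / 4) ^ m" for m
  proof -
    have "\<forall>\<^sub>F n in sequentially. t n < (1 / 4) ^ m" by (rule order_tendstoD(2)[OF t(1)]) simp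
    then show ?thesis by (auto simp: eventually_sequentially intro: less_imp_le)
  qed
  then obtain N where N: "\<And>m n. n \<ge> N m \<Longrightarrow> t n \<le> (1 / 4) ^ m" by metis
  \<comment> \<open>Summing the thresholds makes the subsequence monotone; the summand \<open>m\<close> makes it
      unbounded.\<close>
  define r where "r m = m + (\<Sum>i\<le>m. N i)" for m
  have rN: "N m \<le> r m" for m unfolding r_def by (rule trans_le_add2[OF member_le_sum]) auto
  have rm: "m \<le> r m" for m by (simp add: r_def)
  have rS: "r m \<le> r (Suc m)" for m by (simp add: r_def)
  define u where "u m x = F (r (Suc m)) x - F (r m) x" for m x
  have [measurable]: "u m \<in> borel_measurable borel" for m unfolding u_def[abs_def] by measurable
  have um: "sqn (u m) \<le> ennreal ((1 / 4) ^ m)" for m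
    unfolding u_def[abs_def] by (rule order_trans[OF cauchy[OF rS] ennreal_leI[OF N[OF rN]]])
  define G where "G x = (\<Sum>m. ennreal (2 ^ m * (cmod (u m x))\<^sup>2))" for x
  have "(\<integral>\<^sup>+x. G x \<partial>lborel) = (\<Sum>m. \<integral>\<^sup>+x. ennreal (2 ^ m * (cmod (u m x))\<^sup>2) \<partial>lborel)"
    unfolding G_def by (rule nn_integral_suminf) measurable
  also have "\<dots> = (\<Sum>m. ennreal (2 ^ m) * sqn (u m))"
    unfolding sqn_def by (simp add: ennreal_mult nn_integral_cmult)
  also have "\<dots> \<le> (\<Sum>m. ennreal ((1 / 2) ^ m))"
  proof (intro suminf_le)
    fix m
    have "ennreal (2 ^ m) * sqn (u m) \<le> ennreal (2 ^ m) * ennreal ((1 / 4) ^ m)" by (intro mult_left_mono um) auto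
    also have "\<dots> = ennreal ((1 / 2) ^ m)" by (simp flip: ennreal_mult power_mult_distrib)
    finally show "ennreal (2 ^ m) * sqn (u m) \<le> ennreal ((1 / 2) ^ m)" .
  qed auto
  also have "\<dots> < \<infinity>"
  proof -
    have s: "summable (\<lambda>m. (1 / 2 :: real) ^ m)" by (rule summable_geometric) simp
    then show ?thesis by (subst suminf_ennreal2) (auto simp: less_top)
  qed
  finally have "(\<integral>\<^sup>+x. G x \<partial>lborel) \<noteq> \<infinity>" by simp
  moreover have [measurable]: "G \<in> borel_measurable lborel" unfolding G_def[abs_def] by measurable
  ultimately have fin: "AE x in lborel. G x \<noteq> \<infinity>" by (intro nn_integral_noteq_infinite) auto
  define g where "g x = lim (\<lambda>m. F (r m) x)" for x
  have [measurable]: "g \<in> borel_measurable borel" unfolding g_def[abs_def] by measurable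
  have conv: "AE x in lborel. (\<lambda>m. F (r m) x) \<longlonglongrightarrow> g x"
    using fin
  proof eventually_elim
    fix x assume x: "G x \<noteq> \<infinity>"
    have s1: "summable (\<lambda>m. 2 ^ m * (cmod (u m x))\<^sup>2)"
      by (rule summable_suminf_not_top) (use x in \<open>auto simp: G_def\<close>)
    have s2: "summable (\<lambda>m. (1 / 2 :: real) ^ m + 2 ^ m * (cmod (u m x))\<^sup>2)"
      by (intro summable_add summable_geometric s1) simp
    have "summable (\<lambda>m. u m x)"
    proof (rule summable_comparison_test'[OF s2])
      fix m :: nat
      define y where "y = cmod (u m x)"
      \<comment> \<open>The arithmetic-geometric mean inequality bounds \<open>y\<close> by a summable quantity.\<close>
      have "0 \<le> (1 / 2) ^ m * (1 - 2 ^ m * y)\<^sup>2" by simp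
      also have "\<dots> = (1 / 2) ^ m - 2 * y * ((1 / 2) ^ m * 2 ^ m) + ((1 / 2) ^ m * 2 ^ m) * (2 ^ m * y\<^sup>2)"
        by (simp add: power2_eq_square algebra_simps)
      also have "(1 / 2) ^ m * 2 ^ m = (1::real)" by (simp flip: power_mult_distrib)
      finally have "2 * y \<le> (1 / 2) ^ m + 2 ^ m * y\<^sup>2" by simp
      then show "norm (u m x) \<le> (1 / 2) ^ m + 2 ^ m * (cmod (u m x))\<^sup>2"
        unfolding y_def using norm_ge_zero[of "u m x"] by linarith
    qed
    then have "convergent (\<lambda>m. \<Sum>i<m. u i x)" by (simp add: summable_iff_convergent)
    moreover have "(\<Sum>i<m. u i x) = F (r m) x - F (r 0) x" for m
      unfolding u_def by (rule sum_lessThan_telescope)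
    ultimately have "convergent (\<lambda>m. F (r m) x - F (r 0) x)" by simp
    then have "convergent (\<lambda>m. F (r m) x)" by (simp add: convergent_diff_const_right_iff)
    then show "(\<lambda>m. F (r m) x) \<longlonglongrightarrow> g x" by (simp add: g_def convergent_LIMSEQ_iff)
  qed
  have lim: "sqn (\<lambda>x. F n x - g x) \<le> ennreal (t n)" for n
  proof -
    have "sqn (\<lambda>x. F n x - g x) \<le> (\<integral>\<^sup>+x. liminf (\<lambda>m. ennreal ((cmod (F (r m) x - F n x))\<^sup>2)) \<partial>lborel)"
      unfolding sqn_def
    proof (rule nn_integral_mono_AE)
      show "AE x in lborel. ennreal ((cmod (F n x - g x))\<^sup>2) \<le> liminf (\<lambda>m. ennreal ((cmod (F (r m) x - F n x))\<^sup>2))"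
        using conv
      proof eventually_elim
        fix x assume "(\<lambda>m. F (r m) x) \<longlonglongrightarrow> g x"
        then have "(\<lambda>m. ennreal ((cmod (F (r m) x - F n x))\<^sup>2)) \<longlonglongrightarrow> ennreal ((cmod (g x - F n x))\<^sup>2)"
          by (intro tendsto_ennrealI tendsto_intros)
        then have "liminf (\<lambda>m. ennreal ((cmod (F (r m) x - F n x))\<^sup>2)) = ennreal ((cmod (g x - F n x))\<^sup>2)"
          by (rule lim_imp_Liminf[rotated]) simp
        then show "ennreal ((cmod (F n x - g x))\<^sup>2) \<le> liminf (\<lambda>m. ennreal ((cmod (F (r m) x - F n x))\<^sup>2))"
          by (simp add: norm_minus_commute)
      qed
    qed
    also have "\<dots> \<le> liminf (\<lambda>m. sqn (\<lambda>x. F (r m) x - F n x))"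
      unfolding sqn_def by (rule nn_integral_liminf) measurable
    also have "\<dots> \<le> liminf (\<lambda>m. ennreal (t n))"
    proof (rule Liminf_mono)
      show "\<forall>\<^sub>F m in sequentially. sqn (\<lambda>x. F (r m) x - F n x) \<le> ennreal (t n)"
        using eventually_ge_at_top[of n] by eventually_elim (rule cauchy, rule order_trans[OF _ rm])
    qed
    also have "\<dots> = ennreal (t n)" by (rule Liminf_const) simp
    finally show ?thesis .
  qed
  have "sqn (\<lambda>x. F 0 x - g x) < \<infinity>" using lim[of 0] by (simp add: le_less_trans)
  then have "(\<lambda>x. F 0 x - g x) \<in> L2" by (simp add: L2_iff)
  from L2_add[OF F[of 0] L2_cmult[OF this, of "-1"]] have "g \<in> L2" by simp
  then show ?thesis using lim t unfolding L2_limit_def by blast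
qed

lemma L2_limit_unique:
  assumes "L2_limit F g" "L2_limit F' g'" and F: "\<And>n. F n \<in> borel_measurable borel"
    and eq: "\<And>n. n \<ge> N \<Longrightarrow> F n = F' n"
  shows "AE x in lborel. g x = g' x"
proof -
  obtain e where e: "e \<longlonglongrightarrow> 0" "\<And>n. 0 \<le> e n" "\<And>n. sqn (\<lambda>x. F n x - g x) \<le> ennreal (e n)"
    using assms(1) by (auto simp: L2_limit_def)
  obtain e' where e': "e' \<longlonglongrightarrow> 0" "\<And>n. 0 \<le> e' n" "\<And>n. sqn (\<lambda>x. F' n x - g' x) \<le> ennreal (e' n)"
    using assms(2) by (auto simp: L2_limit_def)
  have [measurable]: "g \<in> borel_measurable borel" "g' \<in> borel_measurable borel" "F n \<in> borel_measurable borel" for n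
    using assms(1,2) F by (auto simp: L2_limit_def L2_measurable)
  have "sqn (\<lambda>x. g x - g' x) \<le> ennreal 0"
  proof (rule le_ennreal_null_sequence[where e="\<lambda>n. 2 * e n + 2 * e' n"])
    show "(\<lambda>n. 2 * e n + 2 * e' n) \<longlonglongrightarrow> 0" using e(1) e'(1) by (auto intro!: tendsto_eq_intros)
    fix n assume n: "n \<ge> N"
    have "sqn (\<lambda>x. g x - g' x) = sqn (\<lambda>x. (-1) * (F n x - g x) + (F n x - g' x))" by (simp add: algebra_simps)
    also have "\<dots> \<le> 2 * sqn (\<lambda>x. (-1) * (F n x - g x)) + 2 * sqn (\<lambda>x. F n x - g' x)" by (rule sqn_add_le) measurable
    also have "\<dots> = 2 * sqn (\<lambda>x. F n x - g x) + 2 * sqn (\<lambda>x. F n x - g' x)" by (subst sqn_cmult) auto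
    also have "\<dots> \<le> 2 * ennreal (e n) + 2 * ennreal (e' n)"
      using e'(3)[of n] eq[OF n] by (intro add_mono mult_left_mono e(3)) auto
    also have "\<dots> = ennreal (0 + (2 * e n + 2 * e' n))" using e(2)[of n] e'(2)[of n] by (simp add: ennreal_mult)
    finally show "sqn (\<lambda>x. g x - g' x) \<le> ennreal (0 + (2 * e n + 2 * e' n))" .
  qed simp
  then have "AE x in lborel. g x - g' x = 0" by (intro sqn_eq_0_imp_AE) auto
  then show ?thesis by simp
qed

lemma L2_limit_linear:
  assumes "L2_limit F f" "L2_limit G g" and F: "\<And>n. F n \<in> borel_measurable borel" "\<And>n. G n \<in> borel_measurable borel"
  shows "L2_limit (\<lambda>n x. a * F n x + b * G n x) (\<lambda>x. a * f x + b * g x)"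
proof -
  obtain e where e: "e \<longlonglongrightarrow> 0" "\<And>n. 0 \<le> e n" "\<And>n. sqn (\<lambda>x. F n x - f x) \<le> ennreal (e n)"
    using assms(1) by (auto simp: L2_limit_def)
  obtain e' where e': "e' \<longlonglongrightarrow> 0" "\<And>n. 0 \<le> e' n" "\<And>n. sqn (\<lambda>x. G n x - g x) \<le> ennreal (e' n)"
    using assms(2) by (auto simp: L2_limit_def)
  have fg: "f \<in> L2" "g \<in> L2" using assms(1,2) by (auto simp: L2_limit_def)
  have [measurable]: "f \<in> borel_measurable borel" "g \<in> borel_measurable borel" "F n \<in> borel_measurable borel" "G n \<in> borel_measurable borel" for n
    using fg F by (auto simp: L2_measurable)
  let ?e = "\<lambda>n. 2 * ((cmod a)\<^sup>2 * e n) + 2 * ((cmod b)\<^sup>2 * e' n)"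
  have "sqn (\<lambda>x. (a * F n x + b * G n x) - (a * f x + b * g x)) \<le> ennreal (?e n)" for n
  proof -
    have "sqn (\<lambda>x. (a * F n x + b * G n x) - (a * f x + b * g x)) = sqn (\<lambda>x. a * (F n x - f x) + b * (G n x - g x))"
      by (simp add: algebra_simps)
    also have "\<dots> \<le> 2 * sqn (\<lambda>x. a * (F n x - f x)) + 2 * sqn (\<lambda>x. b * (G n x - g x))" by (rule sqn_add_le) measurable
    also have "\<dots> = 2 * (ennreal ((cmod a)\<^sup>2) * sqn (\<lambda>x. F n x - f x)) + 2 * (ennreal ((cmod b)\<^sup>2) * sqn (\<lambda>x. G n x - g x))"
      by (subst (1 2) sqn_cmult) auto
    also have "\<dots> \<le> 2 * (ennreal ((cmod a)\<^sup>2) * ennreal (e n)) + 2 * (ennreal ((cmod b)\<^sup>2) * ennreal (e' n))"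
      by (intro add_mono mult_left_mono e(3) e'(3)) auto
    also have "\<dots> = ennreal (?e n)" using e(2)[of n] e'(2)[of n] by (simp add: ennreal_mult)
    finally show ?thesis .
  qed
  moreover have "?e \<longlonglongrightarrow> 0" using e(1) e'(1) by (auto intro!: tendsto_eq_intros)
  moreover have "0 \<le> ?e n" for n using e(2)[of n] e'(2)[of n] by simp
  ultimately show ?thesis
    unfolding L2_limit_def by (intro conjI L2_add L2_cmult fg exI[of _ ?e] allI)
qed

section \<open>Extension to all square-integrable functions\<close>

lemma integrable_L2_mult:
  assumes "f \<in> L2" "g \<in> L2"
  shows "integrable lborel (\<lambda>x. f x * g x)"
proof (rule Bochner_Integration.integrable_bound)
  show "integrable lborel (\<lambda>x. (cmod (f x))\<^sup>2 + (cmod (g x))\<^sup>2)" using assms by (simp add: L2_def)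
  show "(\<lambda>x. f x * g x) \<in> borel_measurable lborel"
    using borel_measurable_times[OF L2_measurable[OF assms(1)] L2_measurable[OF assms(2)]] by simp
  have "norm (f x * g x) \<le> norm ((cmod (f x))\<^sup>2 + (cmod (g x))\<^sup>2)" for x
    using sum_squares_bound[of "cmod (f x)" "cmod (g x)"] mult_nonneg_nonneg[OF norm_ge_zero[of "f x"] norm_ge_zero[of "g x"]]
    unfolding norm_mult real_norm_def by linarith
  then show "AE x in lborel. norm (f x * g x) \<le> norm ((cmod (f x))\<^sup>2 + (cmod (g x))\<^sup>2)" by simp
qed

lemma hermite_L2: "(\<lambda>x. complex_of_real (hermite \<xi> x)) \<in> L2"
  by (rule decaying_L2[OF decaying_hermite])

lemma hermite_coeff_linear:
  assumes "f \<in> L2" "g \<in> L2"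
  shows "hermite_coeff (\<lambda>x. a * f x + b * g x) \<xi> = a * hermite_coeff f \<xi> + b * hermite_coeff g \<xi>"
  unfolding hermite_coeff_def
  using integrable_L2_mult[OF assms(1) hermite_L2[of \<xi>]] integrable_L2_mult[OF assms(2) hermite_L2[of \<xi>]]
  by (simp add: distrib_right mult.assoc)

lemma hermite_coeff_cong_AE:
  assumes "f \<in> L2" "g \<in> L2" "AE x in lborel. f x = g x"
  shows "hermite_coeff f = hermite_coeff g"
proof
  fix \<xi>
  note [measurable] = L2_measurable[OF assms(1)] L2_measurable[OF assms(2)]
  show "hermite_coeff f \<xi> = hermite_coeff g \<xi>"
    unfolding hermite_coeff_def by (rule integral_cong_AE) (use assms(3) in auto)
qed

text \<open>
  Pairing \<open>f\<close> with its own partial sum gives the squared norm of the partial sum; then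
  Cauchy-Schwarz.
\<close>

lemma bessel:
  assumes f: "f \<in> L2"
  shows "l2 N (hermite_coeff f) \<le> L2_norm f"
proof -
  let ?c = "hermite_coeff f" and ?S = "msize_ball N"
  define P where "P x = (\<Sum>\<xi>\<in>?S. ?c \<xi> * complex_of_real (hermite \<xi> x))" for x
  have P: "P \<in> L2" unfolding P_def[abs_def] by (intro decaying_L2 decaying_sum decaying_cmult decaying_hermite)
  have nP: "L2_norm P = l2 N ?c"
    unfolding L2_norm_def l2_def P_def hermite_parseval(2)[OF finite_msize_ball inj_on_id, unfolded id_def] ..
  have "(\<integral>x. cnj (P x) * f x \<partial>lborel) = (\<integral>x. (\<Sum>\<xi>\<in>?S. cnj (?c \<xi>) * (f x * complex_of_real (hermite \<xi> x))) \<partial>lborel)"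
    by (simp add: P_def sum_distrib_left sum_distrib_right mult_ac)
  also have "\<dots> = (\<Sum>\<xi>\<in>?S. cnj (?c \<xi>) * ?c \<xi>)"
    unfolding hermite_coeff_def using integrable_L2_mult[OF f hermite_L2] by (subst Bochner_Integration.integral_sum) simp_all
  also have "\<dots> = complex_of_real ((l2 N ?c)\<^sup>2)"
    unfolding l2_sq of_real_sum complex_norm_square by (simp only: mult.commute)
  finally have "(l2 N ?c)\<^sup>2 = cmod (\<integral>x. cnj (P x) * f x \<partial>lborel)" by (simp only: norm_of_real) simp
  also have "\<dots> \<le> l2 N ?c * L2_norm f" using L2_inner_bound[OF P f] by (simp only: nP)
  finally have "l2 N ?c * l2 N ?c \<le> l2 N ?c * L2_norm f" by (simp only: power2_eq_square)
  then show ?thesis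
    using l2_nonneg[of N ?c] L2_norm_nonneg[of f] by (cases "l2 N ?c = 0") (auto simp: mult_le_cancel_left)
qed

text \<open>
  Choosing a limit for every \<open>f\<close> gives an operator: limits are unique almost everywhere, which
  gives linearity and compatibility with equality almost everywhere.
\<close>

lemma bounded_L2_operatorI:
  fixes F :: "(real^'n \<Rightarrow> complex) \<Rightarrow> nat \<Rightarrow> real^'n \<Rightarrow> complex"
  assumes meas: "\<And>f n. F f n \<in> borel_measurable borel"
    and lim: "\<And>f. f \<in> L2 \<Longrightarrow> \<exists>g. L2_limit (F f) g"
    and cong: "\<And>f g :: real^'n \<Rightarrow> complex. f \<in> L2 \<Longrightarrow> g \<in> L2 \<Longrightarrow> AE x in lborel. f x = g x \<Longrightarrow> F f = F g"
    and lin: "\<And>(f :: real^'n \<Rightarrow> complex) g a b n x. f \<in> L2 \<Longrightarrow> g \<in> L2 \<Longrightarrow> F (\<lambda>y. a * f y + b * g y) n x = a * F f n x + b * F g n x"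
    and B: "B \<ge> 0" "\<And>f n. f \<in> L2 \<Longrightarrow> sqn (F f n) \<le> ennreal ((B * L2_norm f)\<^sup>2)"
  obtains T where "bounded_L2_operator T" "\<And>f. f \<in> L2 \<Longrightarrow> L2_limit (F f) (T f)"
proof -
  define T where "T f = (SOME g. L2_limit (F f) g)" for f
  have T: "L2_limit (F f) (T f)" if "f \<in> L2" for f
    unfolding T_def by (rule someI_ex[OF lim[OF that]])
  have T_L2: "T f \<in> L2" if "f \<in> L2" for f using T[OF that] by (simp add: L2_limit_def)
  have norm: "L2_norm (T f) \<le> (2 * B) * L2_norm f" if f: "f \<in> L2" for f
  proof (rule L2_norm_le[OF T_L2[OF f]])
    show "0 \<le> (2 * B) * L2_norm f" using B(1) by (simp add: L2_norm_nonneg)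
    obtain e where e: "e \<longlonglongrightarrow> 0" "\<And>n. 0 \<le> e n" "\<And>n. sqn (\<lambda>x. F f n x - T f x) \<le> ennreal (e n)"
      using T[OF f] by (auto simp: L2_limit_def)
    have [measurable]: "T f \<in> borel_measurable borel" "F f n \<in> borel_measurable borel" for n
      using meas T_L2[OF f] by (auto simp: L2_measurable)
    have "sqn (T f) \<le> ennreal (2 * (B * L2_norm f)\<^sup>2)"
    proof (rule le_ennreal_null_sequence[where e="\<lambda>n. 2 * e n" and N=0])
      show "(\<lambda>n. 2 * e n) \<longlonglongrightarrow> 0" using e(1) by (auto intro!: tendsto_eq_intros)
      fix n
      have "sqn (T f) = sqn (\<lambda>x. F f n x + (-1) * (F f n x - T f x))" by simp
      also have "\<dots> \<le> 2 * sqn (F f n) + 2 * sqn (\<lambda>x. (-1) * (F f n x - T f x))" by (rule sqn_add_le) measurable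
      also have "\<dots> = 2 * sqn (F f n) + 2 * sqn (\<lambda>x. F f n x - T f x)" by (subst sqn_cmult) auto
      also have "\<dots> \<le> 2 * ennreal ((B * L2_norm f)\<^sup>2) + 2 * ennreal (e n)"
        by (intro add_mono mult_left_mono e(3) B(2)[OF f]) auto
      also have "\<dots> = ennreal (2 * (B * L2_norm f)\<^sup>2 + 2 * e n)" using e(2)[of n] by (simp add: ennreal_mult)
      finally show "sqn (T f) \<le> ennreal (2 * (B * L2_norm f)\<^sup>2 + 2 * e n)" .
    qed simp
    also have "\<dots> \<le> ennreal (((2 * B) * L2_norm f)\<^sup>2)"
    proof (rule ennreal_leI)
      have "((2 * B) * L2_norm f)\<^sup>2 = 4 * (B * L2_norm f)\<^sup>2" by (simp add: power2_eq_square)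
      then show "2 * (B * L2_norm f)\<^sup>2 \<le> ((2 * B) * L2_norm f)\<^sup>2" by simp
    qed
    finally show "sqn (T f) \<le> ennreal (((2 * B) * L2_norm f)\<^sup>2)" .
  qed
  have "bounded_L2_operator T"
    unfolding bounded_L2_operator_def
  proof (intro conjI ballI allI impI)
    fix f g :: "real^'n \<Rightarrow> complex" assume fg: "f \<in> L2" "g \<in> L2"
    { assume ae: "AE x in lborel. f x = g x"
      show "AE x in lborel. T f x = T g x"
        by (rule L2_limit_unique[OF T[OF fg(1)] T[OF fg(2)] meas]) (simp add: cong[OF fg ae]) }
    fix a b
    have h: "(\<lambda>y. a * f y + b * g y) \<in> L2" by (intro L2_add L2_cmult fg)
    show "AE x in lborel. T (\<lambda>y. a * f y + b * g y) x = a * T f x + b * T g x"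
      by (rule L2_limit_unique[OF T[OF h] L2_limit_linear[OF T[OF fg(1)] T[OF fg(2)] meas meas] meas])
        (simp add: fun_eq_iff lin[OF fg])
  next
    show "\<exists>C. \<forall>f\<in>L2. L2_norm (T f) \<le> C * L2_norm f" using norm by blast
  qed (rule T_L2)
  then show ?thesis using that T by blast
qed

lemma hermite_span_L2: "f \<in> hermite_span \<Longrightarrow> f \<in> L2"
  unfolding hermite_span_def by (auto intro!: decaying_L2 decaying_sum decaying_cmult decaying_hermite)

lemma hermite_coeff_span:
  fixes f :: "real^'n \<Rightarrow> complex"
  assumes "f \<in> hermite_span"
  obtains N where "\<And>\<xi>. msize \<xi> > N \<Longrightarrow> hermite_coeff f \<xi> = 0"
proof -
  obtain S c where S: "finite S" and f: "f = (\<lambda>x. \<Sum>\<xi>\<in>S. c \<xi> * complex_of_real (hermite \<xi> x))"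
    using assms by (auto simp: hermite_span_def)
  have i: "integrable lborel (\<lambda>x. c \<eta> * complex_of_real (hermite \<eta> x * hermite \<xi> x))" for \<eta> \<xi>
    by (intro integrable_mult_right integrable_of_real integrable_hermite_mult)
  have coeff: "hermite_coeff f \<xi> = (\<Sum>\<eta>\<in>S. if \<eta> = \<xi> then c \<eta> else 0)" for \<xi>
  proof -
    have "hermite_coeff f \<xi> = (\<integral>x. (\<Sum>\<eta>\<in>S. c \<eta> * complex_of_real (hermite \<eta> x * hermite \<xi> x)) \<partial>lborel)"
      unfolding hermite_coeff_def f by (simp add: sum_distrib_left sum_distrib_right mult_ac)
    also have "\<dots> = (\<Sum>\<eta>\<in>S. \<integral>x. c \<eta> * complex_of_real (hermite \<eta> x * hermite \<xi> x) \<partial>lborel)"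
      by (intro Bochner_Integration.integral_sum i)
    also have "\<dots> = (\<Sum>\<eta>\<in>S. if \<eta> = \<xi> then c \<eta> else 0)"
      by (intro sum.cong refl) (simp only: integral_mult_right_zero integral_complex_of_real hermite_orthonormal, simp)
    finally show ?thesis .
  qed
  show ?thesis
  proof (rule that[of "\<Sum>\<eta>\<in>S. msize \<eta>"])
    fix \<xi> :: "nat^'n" assume "(\<Sum>\<eta>\<in>S. msize \<eta>) < msize \<xi>"
    then have "\<xi> \<notin> S" using member_le_sum[of \<xi> S msize] S by auto
    then show "hermite_coeff f \<xi> = 0" by (auto simp: coeff intro!: sum.neutral)
  qed
qed

lemma pseudo_multiplier_eq_op:
  assumes "\<And>\<xi>. msize \<xi> > N \<Longrightarrow> hermite_coeff f \<xi> = 0" "N \<le> n"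
  shows "hermite_op n \<sigma> (hermite_coeff f) x = pseudo_multiplier \<sigma> f x"
proof -
  have "pseudo_multiplier \<sigma> f x = (\<Sum>\<^sub>\<infinity>\<xi>\<in>msize_ball n. \<sigma> x \<xi> * hermite_coeff f \<xi> * complex_of_real (hermite \<xi> x))"
    unfolding pseudo_multiplier_def
    by (rule infsum_cong_neutral) (use assms in \<open>auto simp: msize_ball_def\<close>)
  then show ?thesis by (simp add: hermite_op_def)
qed

text \<open>
  The approximants depend on \<open>f\<close> only through its Hermite coefficients. Their increments are
  controlled by tails of the series of squared coefficients, which converges by Bessel's
  inequality.
\<close>

lemma (in hermite_symbol) pseudo_multiplier_bounded:
  "\<exists>T. bounded_L2_operator T \<and> (\<forall>f\<in>hermite_span. AE x in lborel. T f x = pseudo_multiplier \<sigma> f x)"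
proof -
  obtain B where B: "B \<ge> 0" "\<And>N c. L2_norm (hermite_op N \<sigma> c) \<le> B * l2 N c" by (rule op_bound) blast
  define F where "F f n = hermite_op n \<sigma> (hermite_coeff f)" for f n
  have meas: "F f n \<in> borel_measurable borel" for f n
    unfolding F_def by (rule borel_measurable_hermite_op) (rule measurable_symbol)
  have sq: "sqn (hermite_op N \<sigma> c) \<le> ennreal ((B * l2 N c)\<^sup>2)" for N c
    unfolding sqn_eq_L2_norm[OF decaying_L2[OF decaying_op]]
    by (intro ennreal_leI power_mono B L2_norm_nonneg)
  have lim: "\<exists>g. L2_limit (F f) g" if f: "f \<in> L2" for f
  proof -
    let ?c = "hermite_coeff f"
    define s where "s n = (l2 n ?c)\<^sup>2" for n
    have mono: "incseq s"
      unfolding s_def l2_sq by (intro incseq_SucI sum_mono2 finite_msize_ball) (auto simp: msize_ball_def)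
    have bdd: "s n \<le> (L2_norm f)\<^sup>2" for n
      unfolding s_def by (intro power_mono bessel f l2_nonneg)
    obtain L where L: "s \<longlonglongrightarrow> L" "\<And>n. s n \<le> L"
      by (rule incseq_convergent[OF mono, of "(L2_norm f)\<^sup>2"]) (use bdd in auto)
    show ?thesis
    proof (rule riesz_fischer[where t="\<lambda>m. B\<^sup>2 * (L - s m)"])
      show "F f n \<in> L2" for n unfolding F_def by (rule decaying_L2[OF decaying_op])
      show "(\<lambda>m. B\<^sup>2 * (L - s m)) \<longlonglongrightarrow> 0" using L(1) by (auto intro!: tendsto_eq_intros)
      show "0 \<le> B\<^sup>2 * (L - s m)" for m using L(2)[of m] by simp
      fix m n :: nat assume mn: "m \<le> n"
      define c where "c \<xi> = (if msize \<xi> \<le> m then 0 else ?c \<xi>)" for \<xi>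
      have sub: "msize_ball m \<subseteq> (msize_ball n :: (nat^'n) set)" using mn by (auto simp: msize_ball_def)
      have diff: "F f n x - F f m x = hermite_op n \<sigma> c x" for x
      proof -
        have "F f m x = (\<Sum>\<xi>\<in>msize_ball n. if msize \<xi> \<le> m then \<sigma> x \<xi> * ?c \<xi> * complex_of_real (hermite \<xi> x) else 0)"
          unfolding F_def hermite_op_def by (rule sum.mono_neutral_cong_left[OF finite_msize_ball sub]) (auto simp: msize_ball_def)
        then show ?thesis
          unfolding F_def hermite_op_def c_def by (simp add: sum_subtractf[symmetric]) (intro sum.cong refl, simp)
      qed
      have l2c: "(l2 n c)\<^sup>2 = s n - s m"
      proof -
        have "s m = (\<Sum>\<xi>\<in>msize_ball n. if msize \<xi> \<le> m then (cmod (?c \<xi>))\<^sup>2 else 0)"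
          unfolding s_def l2_sq by (rule sum.mono_neutral_cong_left[OF finite_msize_ball sub]) (auto simp: msize_ball_def)
        then show ?thesis
          unfolding s_def l2_sq c_def by (simp add: sum_subtractf[symmetric]) (intro sum.cong refl, simp)
      qed
      have "sqn (\<lambda>x. F f n x - F f m x) \<le> ennreal ((B * l2 n c)\<^sup>2)" unfolding diff by (rule sq)
      also have "\<dots> \<le> ennreal (B\<^sup>2 * (L - s m))"
        unfolding power_mult_distrib l2c using L(2)[of n] by (intro ennreal_leI mult_left_mono) auto
      finally show "sqn (\<lambda>x. F f n x - F f m x) \<le> ennreal (B\<^sup>2 * (L - s m))" .
    qed
  qed
  show ?thesis
  proof (rule bounded_L2_operatorI[where F=F and B=B, OF meas lim])
    show "F f = F g" if "f \<in> L2" "g \<in> L2" "AE x in lborel. f x = g x" for f g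
      unfolding F_def[abs_def] by (simp only: hermite_coeff_cong_AE[OF that])
    show "F (\<lambda>y. a * f y + b * g y) n x = a * F f n x + b * F g n x" if "f \<in> L2" "g \<in> L2" for f g a b n x
      unfolding F_def hermite_op_def hermite_coeff_linear[OF that] sum_distrib_left sum.distrib[symmetric]
      by (intro sum.cong refl) (simp add: algebra_simps)
    show "sqn (F f n) \<le> ennreal ((B * L2_norm f)\<^sup>2)" if "f \<in> L2" for f n
      unfolding F_def
      by (rule order_trans[OF sq]) (intro ennreal_leI power_mono mult_left_mono bessel that B mult_nonneg_nonneg l2_nonneg)
    fix T assume T: "bounded_L2_operator T" "\<And>f. f \<in> L2 \<Longrightarrow> L2_limit (F f) (T f)"
    have "AE x in lborel. T f x = pseudo_multiplier \<sigma> f x" if f: "f \<in> hermite_span" for f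
    proof -
      obtain N where N: "\<And>\<xi>. msize \<xi> > N \<Longrightarrow> hermite_coeff f \<xi> = 0" by (rule hermite_coeff_span[OF f]) blast
      have p: "F f n = pseudo_multiplier \<sigma> f" if "N \<le> n" for n
        unfolding F_def by (intro ext pseudo_multiplier_eq_op[OF N that])
      have "pseudo_multiplier \<sigma> f \<in> L2"
        unfolding p[OF order_refl, symmetric] F_def by (rule decaying_L2[OF decaying_op])
      moreover have "sqn (\<lambda>x. 0) = 0" by (simp add: sqn_def)
      ultimately have "L2_limit (\<lambda>n. pseudo_multiplier \<sigma> f) (pseudo_multiplier \<sigma> f)"
        unfolding L2_limit_def by (intro conjI exI[of _ "\<lambda>_. 0"]) auto
      from L2_limit_unique[OF T(2)[OF hermite_span_L2[OF f]] this meas p] show ?thesis .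
    qed
    then show ?thesis using T(1) by blast
  qed (assumption | rule B(1))+
qed

section \<open>The symbol class\<close>

lemma foldr_axis_power:
  assumes "distinct is"
  shows "foldr (\<lambda>j. D j ^^ (axis i l $ j)) is f = (if i \<in> set is then (D i ^^ l) f else f)"
  using assms by (induction "is") (auto simp: axis_def)

text \<open>
  For a multi-index concentrated in one coordinate the order of composition is irrelevant.
\<close>

lemma multi_power_axis: "multi_power D (axis i l) f = (D i ^^ l) f"
  unfolding multi_power_def by (subst foldr_axis_power) (auto simp: coords)

lemma multi_power_zero: "multi_power D 0 f = f"
  using multi_power_axis[of D undefined 0 f] by (simp add: axis_def zero_vec_def cong: if_cong)

lemma msize_zero [simp]: "msize 0 = 0"
  by (simp add: msize_def)

lemma msize_axis [simp]: "msize (axis i m) = m"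
  using msize_add_axis[of 0 i m] by simp

lemma Ck_continuous: "Ck k f \<Longrightarrow> continuous_on UNIV f"
  by (cases k) auto

text \<open>
  Derivatives in \<open>x\<close> commute with differences in \<open>\<xi>\<close>, so the bounds with \<open>\<nu> = 0\<close> and with
  \<open>\<nu> = e\<^sub>j\<close> are bounds for the symbol and for its partial derivatives. Finitely many constants
  occur, and \<open>A\<close> is their sum.
\<close>

lemma symbol_class_hermite_symbol:
  fixes \<sigma> :: "real^'n \<Rightarrow> nat^'n \<Rightarrow> complex"
  assumes \<delta>: "0 \<le> \<delta>" "\<delta> < 1" and K: "CARD('n) < 2 * K" and N: "N \<ge> 1"
    and \<sigma>: "\<sigma> \<in> symbol_class \<delta> K N"
  shows "\<exists>A. hermite_symbol \<sigma> (\<lambda>i x \<xi>. pderiv_at i (\<lambda>y. \<sigma> y \<xi>) x) \<delta> A K"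
proof -
  define \<sigma>' where "\<sigma>' i x \<xi> = pderiv_at i (\<lambda>y. \<sigma> y \<xi>) x" for i x \<xi>
  obtain N' where N': "N = Suc N'" using N by (cases N) auto
  have Ck: "Ck (Suc N') (\<lambda>x. \<sigma> x \<xi>)" for \<xi> using \<sigma> N' by (auto simp: symbol_class_def)
  have deriv: "((\<lambda>t. \<sigma> (x + t *\<^sub>R axis i 1) \<xi>) has_vector_derivative \<sigma>' i x \<xi>) (at 0)" for i x \<xi>
    using Ck[of \<xi>] unfolding \<sigma>'_def pderiv_at_def by (auto simp: vector_derivative_works[symmetric])
  have fderiv: "((\<lambda>t. (fdiff i ^^ l) (\<sigma> (x + t *\<^sub>R axis j 1)) \<xi>) has_vector_derivative (fdiff i ^^ l) (\<sigma>' j x) \<xi>) (at 0)" for i j l x \<xi>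
  proof (induction l arbitrary: \<xi>)
    case (Suc l)
    show ?case using has_vector_derivative_diff[OF Suc[of "\<xi> + axis i 1"] Suc[of \<xi>]] by (simp add: fdiff_def)
  qed (simp add: deriv)
  have pd: "pderiv_at j (\<lambda>y. (fdiff i ^^ l) (\<sigma> y) \<xi>) x = (fdiff i ^^ l) (\<sigma>' j x) \<xi>" for i j l x \<xi>
    unfolding pderiv_at_def by (rule vector_derivative_at[OF fderiv])
  have j0: "jbracket \<xi> powr (- real l + s) = jbracket \<xi> powr s / jbracket \<xi> ^ l" for \<xi> :: "nat^'n" and l s
    by (simp add: powr_diff powr_realpow)
  have main: "\<exists>C>0. \<forall>x \<xi>. cmod (mderiv \<nu> (\<lambda>y. mdiff \<kappa> (\<sigma> y) \<xi>) x)
      \<le> C * jbracket \<xi> powr (- real (msize \<kappa>) + \<delta> / 2 * real (msize \<nu>))"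
    if "msize \<nu> \<le> N" "msize \<kappa> \<le> K" for \<nu> \<kappa> :: "nat^'n"
    using \<sigma> that unfolding symbol_class_def by blast
  have ex1: "\<exists>C. \<forall>x \<xi>. cmod ((fdiff i ^^ l) (\<sigma> x) \<xi>) \<le> C / jbracket \<xi> ^ l" if "l \<le> K" for i l
  proof -
    from main[of 0 "axis i l"] that have "\<exists>C>0. \<forall>x \<xi>. cmod (mderiv 0 (\<lambda>y. mdiff (axis i l) (\<sigma> y) \<xi>) x)
        \<le> C * jbracket \<xi> powr (- real l + 0)" by simp
    then show ?thesis unfolding j0 by (auto simp: multi_power_zero multi_power_axis less_imp_neq[OF jbracket_pos, symmetric])
  qed
  define c where "c i l = (SOME C. \<forall>x \<xi>. cmod ((fdiff i ^^ l) (\<sigma> x) \<xi>) \<le> C / jbracket \<xi> ^ l)" for i l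
  have c: "cmod ((fdiff i ^^ l) (\<sigma> x) \<xi>) \<le> c i l / jbracket \<xi> ^ l" if "l \<le> K" for i l x \<xi>
    using someI_ex[OF ex1[OF that, of i]] unfolding c_def by blast
  have ex2: "\<exists>C. \<forall>x \<xi>. cmod ((fdiff i ^^ l) (\<sigma>' j x) \<xi>) \<le> C * jbracket \<xi> powr (\<delta> / 2) / jbracket \<xi> ^ l" if "l \<le> K" for i j l
  proof -
    from main[of "axis j 1" "axis i l"] that N have "\<exists>C>0. \<forall>x \<xi>. cmod (mderiv (axis j 1) (\<lambda>y. mdiff (axis i l) (\<sigma> y) \<xi>) x)
        \<le> C * jbracket \<xi> powr (- real l + \<delta> / 2)" by simp
    then show ?thesis unfolding j0 by (auto simp: multi_power_axis pd)
  qed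
  define d where "d i j l = (SOME C. \<forall>x \<xi>. cmod ((fdiff i ^^ l) (\<sigma>' j x) \<xi>) \<le> C * jbracket \<xi> powr (\<delta> / 2) / jbracket \<xi> ^ l)" for i j l
  have d: "cmod ((fdiff i ^^ l) (\<sigma>' j x) \<xi>) \<le> d i j l * jbracket \<xi> powr (\<delta> / 2) / jbracket \<xi> ^ l" if "l \<le> K" for i j l x \<xi>
    using someI_ex[OF ex2[OF that, of i j]] unfolding d_def by blast
  define A where "A = (\<Sum>i\<in>UNIV. \<Sum>l\<le>K. \<bar>c i l\<bar>) + (\<Sum>i\<in>UNIV. \<Sum>j\<in>UNIV. \<Sum>l\<le>K. \<bar>d i j l\<bar>)"
  have A0: "0 \<le> A" by (auto simp: A_def intro!: add_nonneg_nonneg sum_nonneg)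
  have cA: "c i l \<le> A" if "l \<le> K" for i l
  proof -
    have "\<bar>c i l\<bar> \<le> (\<Sum>l\<le>K. \<bar>c i l\<bar>)" by (rule member_le_sum) (use that in auto)
    also have "\<dots> \<le> (\<Sum>i\<in>UNIV. \<Sum>l\<le>K. \<bar>c i l\<bar>)" by (rule member_le_sum[of i]) (auto intro: sum_nonneg)
    also have "\<dots> \<le> A" by (auto simp: A_def intro!: sum_nonneg)
    finally show ?thesis by simp
  qed
  have dA: "d i j l \<le> A" if "l \<le> K" for i j l
  proof -
    have "\<bar>d i j l\<bar> \<le> (\<Sum>l\<le>K. \<bar>d i j l\<bar>)" by (rule member_le_sum) (use that in auto)
    also have "\<dots> \<le> (\<Sum>j\<in>UNIV. \<Sum>l\<le>K. \<bar>d i j l\<bar>)" by (rule member_le_sum[of j]) (auto intro: sum_nonneg)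
    also have "\<dots> \<le> (\<Sum>i\<in>UNIV. \<Sum>j\<in>UNIV. \<Sum>l\<le>K. \<bar>d i j l\<bar>)" by (rule member_le_sum[of i]) (auto intro!: sum_nonneg)
    also have "\<dots> \<le> A" by (auto simp: A_def intro!: sum_nonneg)
    finally show ?thesis by simp
  qed
  have "hermite_symbol \<sigma> \<sigma>' \<delta> A K"
  proof
    show "continuous_on UNIV (\<lambda>x. \<sigma> x \<xi>)" for \<xi> by (rule Ck_continuous[OF Ck])
    show "continuous_on UNIV (\<lambda>x. \<sigma>' i x \<xi>)" for i \<xi>
      unfolding \<sigma>'_def using Ck[of \<xi>] by (auto intro: Ck_continuous[of N'])
    show "cmod ((fdiff i ^^ l) (\<sigma> x) \<xi>) \<le> A / jbracket \<xi> ^ l" if "l \<le> K" for i l x \<xi>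
      by (rule order_trans[OF c[OF that]]) (intro divide_right_mono cA[OF that] zero_le_power less_imp_le[OF jbracket_pos])
    show "cmod ((fdiff i ^^ l) (\<sigma>' j x) \<xi>) \<le> A * jbracket \<xi> powr (\<delta> / 2) / jbracket \<xi> ^ l" if "l \<le> K" for i j l x \<xi>
      by (rule order_trans[OF d[OF that]])
        (intro divide_right_mono mult_right_mono dA[OF that] zero_le_power less_imp_le[OF jbracket_pos] powr_ge_zero)
  qed (use K \<delta> A0 deriv in auto)
  then show ?thesis unfolding \<sigma>'_def[abs_def] by blast
qed

theorem theorem1p2:
  fixes \<sigma> :: "real^'n \<Rightarrow> nat^'n \<Rightarrow> complex" and \<delta> :: real
  assumes "0 \<le> \<delta>" and "\<delta> < 1"
    and "\<sigma> \<in> symbol_class \<delta>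
           (nat \<lfloor>real CARD('n) / 2\<rfloor> + 1)
           (nat \<lfloor>2 * real CARD('n) / (1 - \<delta>)\<rfloor> + 1)"
  shows "\<exists>T. bounded_L2_operator T \<and>
           (\<forall>f\<in>hermite_span. AE x in lborel. T f x = pseudo_multiplier \<sigma> f x)"
proof -
  have "\<lfloor>real CARD('n) / 2\<rfloor> = int (CARD('n) div 2)"
    using floor_divide_of_nat_eq[of "CARD('n)" 2] by simp
  then have "CARD('n) < 2 * (nat \<lfloor>real CARD('n) / 2\<rfloor> + 1)" by simp
  then obtain A where "hermite_symbol \<sigma> (\<lambda>i x \<xi>. pderiv_at i (\<lambda>y. \<sigma> y \<xi>) x) \<delta> A (nat \<lfloor>real CARD('n) / 2\<rfloor> + 1)"
    using symbol_class_hermite_symbol[OF assms(1,2) _ _ assms(3)] by auto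
  then show ?thesis by (rule hermite_symbol.pseudo_multiplier_bounded)
qed

end
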